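(* Let $(X,Y)$ be an O2BP with parameters $\alpha,\beta,\gamma,\delta$ and correlation $\rho$, and let $\tau^{\mathbf 0}:=\inf\{t>0:(X_t,Y_t)=(0,0)\}$ (with $\inf\emptyset=\infty$). Then $\mathbb P(\tau^{\mathbf 0}<\infty)=0$ if one of the following conditions holds: $C_1$: $\beta\geq 0$, $\gamma\geq 0$ and $-1\leq\rho\leq\alpha+\delta$; $C_{2a}$: $\alpha\geq\frac12$ and $\beta\geq 0$; $C_{2b}$: $\delta\geq\frac12$ and $\gamma\geq 0$; $C_3$: there exist $\lambda>0$ and $\mu>0$ such that $\lambda\alpha+\mu\gamma\geq 0$, $\lambda\beta+\mu\delta\geq 0$ and \[\Big(\sqrt{\lambda(\lambda\alpha+\mu\gamma)}+\sqrt{\mu(\lambda\beta+\mu\delta)}\Big)^2\geq\tfrac12(\lambda^2+\mu^2+2\rho\lambda\mu).\]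
   Context: Let $(\Omega,\mathcal F,(\mathcal F_t)_{t\geq0},\mathbb P)$ be a complete filtered probability space satisfying the usual conditions, and $(B,C)$ an $(\mathcal F_t)$-adapted planar Brownian motion started at $0$ with $\langle B\rangle_t=\langle C\rangle_t=t$ and $\langle B,C\rangle_t=\rho t$, where $\rho\in[-1,1]$. Let $\alpha>0$, $\delta>0$, $\beta,\gamma\in\mathbb R$, $S=[0,\infty)^2$. An Oblique Two-dimensional Bessel Process (O2BP), also called a solution to the system (O), is an $(\mathcal F_t)$-adapted continuous process $(X,Y)$ with values in $S$ such that for all $t\geq0$ \[X_t=X_0+B_t+\alpha\int_0^t\frac{ds}{X_s}+\beta\int_0^t\frac{ds}{Y_s},\qquad Y_t=Y_0+C_t+\gamma\int_0^t\frac{ds}{X_s}+\delta\int_0^t\frac{ds}{Y_s},\] where $X_0,Y_0$ are nonnegative $\mathcal F_0$-measurable random variables, and for all $t\geq 0$: $\int_0^t\mathbf 1_{\{X_s=0\}}ds=\int_0^t\mathbf 1_{\{Y_s=0\}}ds=0$, $\int_0^t\mathbf 1_{\{X_s>0\}}\frac{ds}{X_s}<\infty$, $\int_0^t\mathbf 1_{\{Y_s>0\}}\frac{ds}{Y_s}<\infty$. *)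

theory Defs
  imports "HOL-Probability.Probability"
begin

definition filtration_usual :: "'a measure \<Rightarrow> (real \<Rightarrow> 'a measure) \<Rightarrow> bool" where
  "filtration_usual M F \<longleftrightarrow>
     (\<forall>t\<ge>0. space (F t) = space M \<and> sets (F t) \<subseteq> sets M) \<and>
     (\<forall>s t. 0 \<le> s \<longrightarrow> s \<le> t \<longrightarrow> sets (F s) \<subseteq> sets (F t)) \<and>
     (\<forall>N\<in>null_sets M. \<forall>A. A \<subseteq> N \<longrightarrow> A \<in> sets (F 0)) \<and>
     (\<forall>t\<ge>0. sets (F t) = (\<Inter>s\<in>{t<..}. sets (F s)))"

definition adapted :: "(real \<Rightarrow> 'a measure) \<Rightarrow> (real \<Rightarrow> 'a \<Rightarrow> real) \<Rightarrow> bool" where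
  "adapted F X \<longleftrightarrow> (\<forall>t\<ge>0. X t \<in> borel_measurable (F t))"

text \<open>(B,C) is an (F_t)-Brownian motion in the plane started at 0 with
  <B>_t = <C>_t = t and <B,C>_t = rho t, i.e. continuous paths, and for s < t the increment
  (B_t - B_s, C_t - C_s) is independent of F_s and centred Gaussian with covariance
  (t - s) [[1, rho], [rho, 1]]. Independence plus the law of the increment are expressed jointly
  through the (conditional) characteristic function.\<close>
definition corr_brownian :: "'a measure \<Rightarrow> (real \<Rightarrow> 'a measure) \<Rightarrow> real \<Rightarrow>
    (real \<Rightarrow> 'a \<Rightarrow> real) \<Rightarrow> (real \<Rightarrow> 'a \<Rightarrow> real) \<Rightarrow> bool" where
  "corr_brownian M F \<rho> B C \<longleftrightarrow>
     adapted F B \<and> adapted F C \<and>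
     (AE \<omega> in M. B 0 \<omega> = 0 \<and> C 0 \<omega> = 0 \<and>
        continuous_on {0..} (\<lambda>t. B t \<omega>) \<and> continuous_on {0..} (\<lambda>t. C t \<omega>)) \<and>
     (\<forall>s t u v A. 0 \<le> s \<longrightarrow> s < t \<longrightarrow> A \<in> sets (F s) \<longrightarrow>
        (\<integral>\<omega>. indicator A \<omega> * cos (u * (B t \<omega> - B s \<omega>) + v * (C t \<omega> - C s \<omega>)) \<partial>M)
          = measure M A * exp (- (t - s) / 2 * (u\<^sup>2 + 2 * \<rho> * u * v + v\<^sup>2)) \<and>
        (\<integral>\<omega>. indicator A \<omega> * sin (u * (B t \<omega> - B s \<omega>) + v * (C t \<omega> - C s \<omega>)) \<partial>M) = 0)"

definition O2BP :: "'a measure \<Rightarrow> (real \<Rightarrow> 'a measure) \<Rightarrow> real \<Rightarrow> real \<Rightarrow> real \<Rightarrow> real \<Rightarrow>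
    (real \<Rightarrow> 'a \<Rightarrow> real) \<Rightarrow> (real \<Rightarrow> 'a \<Rightarrow> real) \<Rightarrow>
    (real \<Rightarrow> 'a \<Rightarrow> real) \<Rightarrow> (real \<Rightarrow> 'a \<Rightarrow> real) \<Rightarrow> bool" where
  "O2BP M F \<alpha> \<beta> \<gamma> \<delta> B C X Y \<longleftrightarrow>
     adapted F X \<and> adapted F Y \<and>
     (AE \<omega> in M.
        continuous_on {0..} (\<lambda>t. X t \<omega>) \<and> continuous_on {0..} (\<lambda>t. Y t \<omega>) \<and>
        (\<forall>t\<ge>0. X t \<omega> \<ge> 0 \<and> Y t \<omega> \<ge> 0 \<and>
           emeasure lborel {s\<in>{0..t}. X s \<omega> = 0} = 0 \<and>
           emeasure lborel {s\<in>{0..t}. Y s \<omega> = 0} = 0 \<and>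
           set_integrable lborel {0..t} (\<lambda>s. 1 / X s \<omega>) \<and>
           set_integrable lborel {0..t} (\<lambda>s. 1 / Y s \<omega>) \<and>
           X t \<omega> = X 0 \<omega> + B t \<omega> + \<alpha> * (LINT s:{0..t}|lborel. 1 / X s \<omega>)
                     + \<beta> * (LINT s:{0..t}|lborel. 1 / Y s \<omega>) \<and>
           Y t \<omega> = Y 0 \<omega> + C t \<omega> + \<gamma> * (LINT s:{0..t}|lborel. 1 / X s \<omega>)
                     + \<delta> * (LINT s:{0..t}|lborel. 1 / Y s \<omega>)))"

definition corner_time :: "(real \<Rightarrow> 'a \<Rightarrow> real) \<Rightarrow> (real \<Rightarrow> 'a \<Rightarrow> real) \<Rightarrow> 'a \<Rightarrow> ereal" where
  "corner_time X Y \<omega> = Inf {ereal t |t. t > 0 \<and> X t \<omega> = 0 \<and> Y t \<omega> = 0}"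

end

theory Submission
  imports Defs
begin

text \<open>
  Write V = X c1 + Y c2, where (c1, c2) is the standard basis of the plane under C1, the pair of
  scalars (la, mu) under C3, and (1, 0) or (0, 1) under C2. In each case the drift of V is so strong
  that -ln |V| is formally a supermartingale. To avoid localisation, use instead
  f(V) = ln ((|V|^2 + 1 + eps) / (|V|^2 + eps)), which is nonnegative, bounded, has bounded
  derivatives, and whose generator is at most a constant 2 theta that does not depend on eps. So
  f(V_t) - 2 theta t is a supermartingale, and the maximal inequality bounds the probability that V
  reaches the origin, where f exceeds ln (1/eps), by a multiple of 1 / ln (1/eps).

  Ito's formula is replaced by a partition argument. Each increment of f(V) splits into a Gaussian
  part, treated by Taylor expansion and conditional moments, and a drift part, estimated path by
  path. The drift need not be integrable over the probability space, but the sums of its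
  contributions are bounded in L2, because the Gaussian sums are and f is bounded; this is enough
  to carry a pathwise upper bound over to expectations.
\<close>

section \<open>Expectations on events\<close>

context prob_space
begin

lemma
  fixes h :: "'a \<Rightarrow> real"
  assumes "A \<in> events" and "prob A > 0" and "h \<in> borel_measurable M"
  shows integrable_uniform_measure_iff:
      "integrable (uniform_measure M A) h \<longleftrightarrow> integrable M (\<lambda>\<omega>. indicator A \<omega> * h \<omega>)"
    and integral_uniform_measure:
      "(\<integral>\<omega>. h \<omega> \<partial>uniform_measure M A) = expectation (\<lambda>\<omega>. indicator A \<omega> * h \<omega>) / prob A"
proof -
  have density: "uniform_measure M A = density M (\<lambda>\<omega>. indicator A \<omega> / prob A)"
    unfolding uniform_measure_def emeasure_eq_measure
    using assms(2) by (intro arg_cong[where f="density M"] ext) (simp add: divide_ennreal flip: ennreal_indicator)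
  show "(\<integral>\<omega>. h \<omega> \<partial>uniform_measure M A) = expectation (\<lambda>\<omega>. indicator A \<omega> * h \<omega>) / prob A"
    unfolding density using assms by (subst integral_density) auto
  have "integrable (uniform_measure M A) h \<longleftrightarrow> integrable M (\<lambda>\<omega>. indicator A \<omega> * h \<omega> / prob A)"
    unfolding density using assms by (subst integrable_density) auto
  then show "integrable (uniform_measure M A) h \<longleftrightarrow> integrable M (\<lambda>\<omega>. indicator A \<omega> * h \<omega>)"
    using assms(2) by (simp add: divide_inverse mult.commute[of _ "inverse (prob A)"])
qed

lemma distr_uniform_measure_eqI_char:
  fixes Z :: "'a \<Rightarrow> real"
  assumes "real_distribution \<mu>" and Z[measurable]: "Z \<in> borel_measurable M"
    and A: "A \<in> events" "prob A > 0"
    and cos: "\<And>u. expectation (\<lambda>\<omega>. indicator A \<omega> * cos (u * Z \<omega>)) = prob A * Re (char \<mu> u)"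
    and sin: "\<And>u. expectation (\<lambda>\<omega>. indicator A \<omega> * sin (u * Z \<omega>)) = prob A * Im (char \<mu> u)"
  shows "distr (uniform_measure M A) borel Z = \<mu>"
proof -
  interpret cond: prob_space "uniform_measure M A"
    using A by (intro prob_space_uniform_measure) (auto simp: emeasure_eq_measure)
  have [measurable]: "Z \<in> borel_measurable (uniform_measure M A)"
    using Z by simp
  have "char (distr (uniform_measure M A) borel Z) u = char \<mu> u" for u
  proof -
    have "integrable (uniform_measure M A) (\<lambda>\<omega>. iexp (u * Z \<omega>))"
      by (rule cond.integrable_const_bound[where B=1]) auto
    then have "char (distr (uniform_measure M A) borel Z) u
      = complex_of_real (\<integral>\<omega>. cos (u * Z \<omega>) \<partial>uniform_measure M A)
        + \<i> * complex_of_real (\<integral>\<omega>. sin (u * Z \<omega>) \<partial>uniform_measure M A)"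
      unfolding char_def
      by (subst integral_distr) (auto simp: complex_eq_iff Re_exp Im_exp simp flip: integral_Re integral_Im)
    also have "\<dots> = char \<mu> u"
      using A(2) by (simp add: integral_uniform_measure[OF A] cos sin complex_eq_iff)
    finally show ?thesis .
  qed
  then show ?thesis
    using assms(1) cond.prob_space_distr[of Z borel]
    by (intro Levy_uniqueness) (auto simp: real_distribution_def real_distribution_axioms_def)
qed

lemma
  fixes Z :: "'a \<Rightarrow> real" and h :: "real \<Rightarrow> real"
  assumes \<mu>: "real_distribution \<mu>" and Z[measurable]: "Z \<in> borel_measurable M" and A: "A \<in> events"
    and cos: "\<And>u. expectation (\<lambda>\<omega>. indicator A \<omega> * cos (u * Z \<omega>)) = prob A * Re (char \<mu> u)"
    and sin: "\<And>u. expectation (\<lambda>\<omega>. indicator A \<omega> * sin (u * Z \<omega>)) = prob A * Im (char \<mu> u)"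
    and h: "integrable \<mu> h" and h_borel[measurable]: "h \<in> borel_measurable borel"
  shows integrable_indicator_compose_of_char: "integrable M (\<lambda>\<omega>. indicator A \<omega> * h (Z \<omega>))"
    and expectation_indicator_compose_of_char:
      "expectation (\<lambda>\<omega>. indicator A \<omega> * h (Z \<omega>)) = prob A * integral\<^sup>L \<mu> h"
proof -
  have "integrable M (\<lambda>\<omega>. indicator A \<omega> * h (Z \<omega>)) \<and>
    expectation (\<lambda>\<omega>. indicator A \<omega> * h (Z \<omega>)) = prob A * integral\<^sup>L \<mu> h"
  proof (cases "prob A = 0")
    case True
    then have "AE \<omega> in M. \<omega> \<notin> A"
      using A by (simp add: prob_eq_0)
    then have null: "AE \<omega> in M. indicator A \<omega> * h (Z \<omega>) = 0"
      by eventually_elim auto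
    with A True show ?thesis
      using integrable_cong_AE[OF _ _ null] integral_cong_AE[OF _ _ null] by simp
  next
    case False
    then have pos: "prob A > 0"
      by (simp add: zero_less_measure_iff)
    have \<mu>_eq: "\<mu> = distr (uniform_measure M A) borel Z"
      using distr_uniform_measure_eqI_char[OF \<mu> Z A pos cos sin] ..
    have "integrable (uniform_measure M A) (\<lambda>\<omega>. h (Z \<omega>))"
      using h unfolding \<mu>_eq by (subst (asm) integrable_distr_eq) auto
    moreover have "integral\<^sup>L \<mu> h = (\<integral>\<omega>. h (Z \<omega>) \<partial>uniform_measure M A)"
      unfolding \<mu>_eq by (rule integral_distr) auto
    ultimately show ?thesis
      using pos by (simp add: integrable_uniform_measure_iff[OF A pos] integral_uniform_measure[OF A pos])
  qed
  then show "integrable M (\<lambda>\<omega>. indicator A \<omega> * h (Z \<omega>))"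
    and "expectation (\<lambda>\<omega>. indicator A \<omega> * h (Z \<omega>)) = prob A * integral\<^sup>L \<mu> h"
    by auto
qed

lemma expectation_mult_eq_of_events:
  fixes G Z :: "'a \<Rightarrow> real"
  assumes sub: "subalgebra M F" and Z: "integrable M Z"
    and on_events: "\<And>A. A \<in> sets F \<Longrightarrow> expectation (\<lambda>\<omega>. indicator A \<omega> * Z \<omega>) = prob A * z"
    and G[measurable]: "G \<in> borel_measurable F" and GZ: "integrable M (\<lambda>\<omega>. G \<omega> * Z \<omega>)"
  shows "expectation (\<lambda>\<omega>. G \<omega> * Z \<omega>) = expectation G * z"
proof -
  interpret finite_measure_subalgebra M F
    using sub by unfold_locales
  have [measurable]: "G \<in> borel_measurable M" "Z \<in> borel_measurable M"
    using measurable_from_subalg[OF sub G] Z by auto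
  have "AE \<omega> in M. real_cond_exp M F Z \<omega> = z"
  proof (rule real_cond_exp_charact)
    fix A assume "A \<in> sets F"
    then show "(\<integral>\<omega>\<in>A. Z \<omega> \<partial>M) = (\<integral>\<omega>\<in>A. z \<partial>M)"
      using on_events[of A] sub
      by (auto simp: set_lebesgue_integral_def subalgebra_def sets.Int_space_eq2)
  qed (use Z in auto)
  then have "expectation (\<lambda>\<omega>. G \<omega> * real_cond_exp M F Z \<omega>) = expectation (\<lambda>\<omega>. G \<omega> * z)"
    by (intro integral_cong_AE) auto
  moreover have "expectation (\<lambda>\<omega>. G \<omega> * real_cond_exp M F Z \<omega>) = expectation (\<lambda>\<omega>. G \<omega> * Z \<omega>)"
    by (rule real_cond_exp_intg(2)) (use GZ in auto)
  ultimately show ?thesis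
    by simp
qed

lemma integrable_indicator_mult:
  fixes Z :: "'a \<Rightarrow> real"
  assumes "A \<in> events" "integrable M Z"
  shows "integrable M (\<lambda>\<omega>. indicator A \<omega> * Z \<omega>)"
  using integrable_mult_indicator[OF assms] by simp

lemma integrable_indicator_mult_bounded:
  fixes Z :: "'a \<Rightarrow> real"
  assumes "A \<in> events" "Z \<in> borel_measurable M" "\<And>\<omega>. \<bar>Z \<omega>\<bar> \<le> k"
  shows "integrable M (\<lambda>\<omega>. indicator A \<omega> * Z \<omega>)"
  using assms by (intro integrable_indicator_mult integrable_const_bound[where B=k]) auto

lemma integrable_mult_bounded:
  fixes G Z :: "'a \<Rightarrow> real"
  assumes "G \<in> borel_measurable M" and "integrable M Z" and "\<And>\<omega>. \<bar>G \<omega>\<bar> \<le> k"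
  shows "integrable M (\<lambda>\<omega>. G \<omega> * Z \<omega>)"
proof (rule Bochner_Integration.integrable_bound[where f="\<lambda>\<omega>. k * Z \<omega>"])
  have "\<bar>G \<omega>\<bar> * \<bar>Z \<omega>\<bar> \<le> \<bar>k\<bar> * \<bar>Z \<omega>\<bar>" for \<omega>
    using assms(3)[of \<omega>] by (intro mult_right_mono) auto
  then show "AE \<omega> in M. norm (G \<omega> * Z \<omega>) \<le> norm (k * Z \<omega>)"
    by (simp add: abs_mult)
qed (use assms(1,2) in auto)

lemma integrable_mult_of_square_integrable:
  fixes X Y :: "'a \<Rightarrow> real"
  assumes "X \<in> borel_measurable M" "Y \<in> borel_measurable M"
    and "integrable M (\<lambda>\<omega>. (X \<omega>)\<^sup>2)" "integrable M (\<lambda>\<omega>. (Y \<omega>)\<^sup>2)"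
  shows "integrable M (\<lambda>\<omega>. X \<omega> * Y \<omega>)"
proof (rule Bochner_Integration.integrable_bound[where f="\<lambda>\<omega>. (X \<omega>)\<^sup>2 + (Y \<omega>)\<^sup>2"])
  have "\<bar>x * y\<bar> \<le> x\<^sup>2 + y\<^sup>2" for x y :: real
    using sum_squares_bound[of "\<bar>x\<bar>" "\<bar>y\<bar>"] abs_ge_zero[of "x * y"] by (simp only: abs_mult power2_abs)
  then show "AE \<omega> in M. norm (X \<omega> * Y \<omega>) \<le> norm ((X \<omega>)\<^sup>2 + (Y \<omega>)\<^sup>2)"
    by simp
qed (use assms in auto)

lemma expectation_square_sum_orthogonal:
  fixes X :: "'i \<Rightarrow> 'a \<Rightarrow> real"
  assumes "finite I"
    and "\<And>i. i \<in> I \<Longrightarrow> X i \<in> borel_measurable M"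
    and "\<And>i. i \<in> I \<Longrightarrow> integrable M (\<lambda>\<omega>. (X i \<omega>)\<^sup>2)"
    and orthogonal: "\<And>i j. i \<in> I \<Longrightarrow> j \<in> I \<Longrightarrow> i \<noteq> j \<Longrightarrow> expectation (\<lambda>\<omega>. X i \<omega> * X j \<omega>) = 0"
  shows "integrable M (\<lambda>\<omega>. (\<Sum>i\<in>I. X i \<omega>)\<^sup>2)"
    and "expectation (\<lambda>\<omega>. (\<Sum>i\<in>I. X i \<omega>)\<^sup>2) = (\<Sum>i\<in>I. expectation (\<lambda>\<omega>. (X i \<omega>)\<^sup>2))"
proof -
  have product: "integrable M (\<lambda>\<omega>. X i \<omega> * X j \<omega>)" if "i \<in> I" "j \<in> I" for i j
    using that assms by (intro integrable_mult_of_square_integrable) auto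
  have square: "(\<lambda>\<omega>. (\<Sum>i\<in>I. X i \<omega>)\<^sup>2) = (\<lambda>\<omega>. \<Sum>i\<in>I. \<Sum>j\<in>I. X i \<omega> * X j \<omega>)"
    by (simp add: power2_eq_square sum_product)
  show "integrable M (\<lambda>\<omega>. (\<Sum>i\<in>I. X i \<omega>)\<^sup>2)"
    unfolding square by (intro Bochner_Integration.integrable_sum product)
  have "expectation (\<lambda>\<omega>. (\<Sum>i\<in>I. X i \<omega>)\<^sup>2) = (\<Sum>i\<in>I. \<Sum>j\<in>I. expectation (\<lambda>\<omega>. X i \<omega> * X j \<omega>))"
    unfolding square using product by (simp add: Bochner_Integration.integral_sum)
  also have "\<dots> = (\<Sum>i\<in>I. expectation (\<lambda>\<omega>. (X i \<omega>)\<^sup>2))"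
  proof (rule sum.cong[OF refl])
    fix i assume "i \<in> I"
    then have "(\<Sum>j\<in>I. expectation (\<lambda>\<omega>. X i \<omega> * X j \<omega>)) = (\<Sum>j\<in>I. if i = j then expectation (\<lambda>\<omega>. (X i \<omega>)\<^sup>2) else 0)"
      using orthogonal by (intro sum.cong) (auto simp: power2_eq_square)
    then show "(\<Sum>j\<in>I. expectation (\<lambda>\<omega>. X i \<omega> * X j \<omega>)) = expectation (\<lambda>\<omega>. (X i \<omega>)\<^sup>2)"
      using \<open>i \<in> I\<close> \<open>finite I\<close> by simp
  qed
  finally show "expectation (\<lambda>\<omega>. (\<Sum>i\<in>I. X i \<omega>)\<^sup>2) = (\<Sum>i\<in>I. expectation (\<lambda>\<omega>. (X i \<omega>)\<^sup>2))" .
qed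

end

section \<open>Increments of a correlated Brownian motion\<close>

text \<open>The trace of the bilinear form H against the covariance of the noise B a + C b.\<close>

definition cov_trace :: "real \<Rightarrow> 'b \<Rightarrow> 'b \<Rightarrow> ('b \<Rightarrow> 'b \<Rightarrow> real) \<Rightarrow> real" where
  "cov_trace \<rho> a b H = H a a + \<rho> * (H a b + H b a) + H b b"

lemma cov_trace_real: "cov_trace \<rho> u v (*) = u\<^sup>2 + 2 * \<rho> * u * v + v\<^sup>2" for u v :: real
  by (simp add: cov_trace_def power2_eq_square)

lemma cov_trace_real_nonneg:
  fixes u v :: real
  assumes "-1 \<le> \<rho>" "\<rho> \<le> 1"
  shows "cov_trace \<rho> u v (*) \<ge> 0"
proof -
  have "0 \<le> (u + \<rho> * v)\<^sup>2 + (1 - \<rho>\<^sup>2) * v\<^sup>2"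
    using assms by (intro add_nonneg_nonneg mult_nonneg_nonneg) (auto simp: abs_square_le_1)
  then show ?thesis
    by (simp add: cov_trace_real power2_eq_square algebra_simps)
qed

lemma char_scaled_std_normal:
  "char (distr std_normal_distribution borel (\<lambda>x. \<sigma> * x)) u = complex_of_real (exp (- (\<sigma>\<^sup>2 * u\<^sup>2) / 2))"
proof -
  have "char (distr std_normal_distribution borel (\<lambda>x. \<sigma> * x)) u = char std_normal_distribution (u * \<sigma>)"
    unfolding char_def by (subst integral_distr) (auto simp: ac_simps)
  then show ?thesis
    by (simp add: char_std_normal_distribution power_mult_distrib mult.commute)
qed

lemma real_distribution_scaled_std_normal:
  "real_distribution (distr std_normal_distribution borel (\<lambda>x. \<sigma> * x))"
proof -
  interpret real_distribution std_normal_distribution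
    by (rule real_dist_normal_dist)
  show ?thesis
    by (auto simp: real_distribution_def real_distribution_axioms_def intro!: prob_space_distr)
qed

lemma std_normal_moments:
  "(LINT x|std_normal_distribution. x ^ 1) = 0"
  "(LINT x|std_normal_distribution. x ^ 2) = 1"
  "(LINT x|std_normal_distribution. x ^ 4) = 3"
  using integral_std_normal_distribution_moment_odd[of 1]
    std_normal_distribution_even_moments(1)[of 1] std_normal_distribution_even_moments(1)[of 2]
  by (simp_all add: fact_numeral)

locale filtered_prob_space = prob_space M for M :: "'a measure" +
  fixes F :: "real \<Rightarrow> 'a measure"
  assumes filtration: "filtration_usual M F"
begin

lemma subalgebra_filtration: "0 \<le> t \<Longrightarrow> subalgebra M (F t)"
  using filtration[unfolded filtration_usual_def, THEN conjunct1] by (simp add: subalgebra_def)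

lemma sets_filtration_mono: "0 \<le> s \<Longrightarrow> s \<le> t \<Longrightarrow> sets (F s) \<subseteq> sets (F t)"
  using filtration[unfolded filtration_usual_def, THEN conjunct2, THEN conjunct1] by simp

lemma space_filtration: "0 \<le> t \<Longrightarrow> space (F t) = space M"
  using subalgebra_filtration by (simp add: subalgebra_def)

lemma filtration_event: "0 \<le> t \<Longrightarrow> A \<in> sets (F t) \<Longrightarrow> A \<in> events"
  using subalgebra_filtration by (auto simp: subalgebra_def)

lemma measurable_filtration_mono:
  assumes "0 \<le> s" "s \<le> t" and "f \<in> measurable (F s) N"
  shows "f \<in> measurable (F t) N"
  using assms sets_filtration_mono[of s t]
  by (intro measurable_from_subalg[OF _ assms(3)]) (simp add: subalgebra_def space_filtration)

lemma measurable_filtration_imp_measurable: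
  "0 \<le> t \<Longrightarrow> f \<in> measurable (F t) N \<Longrightarrow> f \<in> measurable M N"
  by (rule measurable_from_subalg[OF subalgebra_filtration])

end

locale brownian_pair = filtered_prob_space M F
  for M :: "'a measure" and F :: "real \<Rightarrow> 'a measure" +
  fixes \<rho> :: real and B C :: "real \<Rightarrow> 'a \<Rightarrow> real"
  assumes brownian: "corr_brownian M F \<rho> B C" and correlation: "-1 \<le> \<rho>" "\<rho> \<le> 1"
begin

definition incr :: "real \<Rightarrow> real \<Rightarrow> real \<Rightarrow> real \<Rightarrow> 'a \<Rightarrow> real" where
  "incr u v s t \<omega> = u * (B t \<omega> - B s \<omega>) + v * (C t \<omega> - C s \<omega>)"

lemma measurable_incr:
  assumes "0 \<le> s" "s \<le> t"
  shows "incr u v s t \<in> borel_measurable (F t)"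
proof -
  have "B r \<in> borel_measurable (F t)" "C r \<in> borel_measurable (F t)" if "0 \<le> r" "r \<le> t" for r
    using brownian that by (auto simp: corr_brownian_def adapted_def intro: measurable_filtration_mono)
  then show ?thesis
    unfolding incr_def using assms by (intro borel_measurable_add borel_measurable_times borel_measurable_diff) auto
qed

lemma
  assumes "0 \<le> s" "s < t" and A: "A \<in> sets (F s)"
  shows integrable_indicator_incr_power: "integrable M (\<lambda>\<omega>. indicator A \<omega> * incr u v s t \<omega> ^ n)"
    and expectation_indicator_incr_power: "expectation (\<lambda>\<omega>. indicator A \<omega> * incr u v s t \<omega> ^ n)
      = prob A * (sqrt ((t - s) * cov_trace \<rho> u v (*)) ^ n * (LINT x|std_normal_distribution. x ^ n))"
proof -
  define \<sigma> where "\<sigma> = sqrt ((t - s) * cov_trace \<rho> u v (*))"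
  define \<mu> where "\<mu> = distr std_normal_distribution borel (\<lambda>x. \<sigma> * x)"
  have \<sigma>: "\<sigma>\<^sup>2 = (t - s) * (u\<^sup>2 + 2 * \<rho> * u * v + v\<^sup>2)"
    unfolding \<sigma>_def using assms cov_trace_real_nonneg[OF correlation] by (simp add: cov_trace_real)
  have exponent: "- (t - s) / 2 * ((z * u)\<^sup>2 + 2 * \<rho> * (z * u) * (z * v) + (z * v)\<^sup>2) = - (\<sigma>\<^sup>2 * z\<^sup>2) / 2" for z
    unfolding \<sigma> by (simp add: power2_eq_square field_simps)
  have incr_measurable: "incr u v s t \<in> borel_measurable M"
    using assms by (intro measurable_filtration_imp_measurable[OF _ measurable_incr]) auto
  have char: "expectation (\<lambda>\<omega>. indicator A \<omega> * cos (z * incr u v s t \<omega>)) = prob A * Re (char \<mu> z)"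
    "expectation (\<lambda>\<omega>. indicator A \<omega> * sin (z * incr u v s t \<omega>)) = prob A * Im (char \<mu> z)" for z
    using brownian[unfolded corr_brownian_def, THEN conjunct2, THEN conjunct2, THEN conjunct2,
        rule_format, OF assms, of "z * u" "z * v"]
    unfolding exponent \<mu>_def char_scaled_std_normal by (simp_all add: incr_def distrib_left mult.assoc)
  have power: "integrable \<mu> (\<lambda>x. x ^ n)" "(LINT x|\<mu>. x ^ n) = \<sigma> ^ n * (LINT x|std_normal_distribution. x ^ n)"
    unfolding \<mu>_def using integrable_std_normal_distribution_moment[of n]
    by (simp_all add: integrable_distr_eq integral_distr power_mult_distrib)
  note transfer = real_distribution_scaled_std_normal[of \<sigma>, folded \<mu>_def] incr_measurable
    filtration_event[OF assms(1) A] char power(1) borel_measurable_power[OF measurable_ident_sets[OF refl]]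
  show "integrable M (\<lambda>\<omega>. indicator A \<omega> * incr u v s t \<omega> ^ n)"
    by (rule integrable_indicator_compose_of_char[OF transfer])
  show "expectation (\<lambda>\<omega>. indicator A \<omega> * incr u v s t \<omega> ^ n)
      = prob A * (sqrt ((t - s) * cov_trace \<rho> u v (*)) ^ n * (LINT x|std_normal_distribution. x ^ n))"
    unfolding \<sigma>_def[symmetric] power(2)[symmetric] by (rule expectation_indicator_compose_of_char[OF transfer])
qed

lemma integrable_incr_power:
  assumes "0 \<le> s" "s < t"
  shows "integrable M (\<lambda>\<omega>. incr u v s t \<omega> ^ n)"
proof -
  have "space M \<in> sets (F s)"
    using space_filtration[OF assms(1)] sets.top by metis
  from integrable_indicator_incr_power[OF assms this] show ?thesis
    by (subst Bochner_Integration.integrable_cong[OF refl, of _ _ "\<lambda>\<omega>. indicator (space M) \<omega> * incr u v s t \<omega> ^ n"]) auto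
qed

context
  fixes s t k :: real and G :: "'a \<Rightarrow> real"
  assumes times: "0 \<le> s" "s < t" and G_measurable: "G \<in> borel_measurable (F s)" and G_bounded: "\<And>\<omega>. \<bar>G \<omega>\<bar> \<le> k"
begin

lemma integrable_mult_incr_power: "integrable M (\<lambda>\<omega>. G \<omega> * incr u v s t \<omega> ^ n)"
  using integrable_incr_power[OF times] measurable_filtration_imp_measurable[OF times(1) G_measurable]
  by (intro integrable_mult_bounded[OF _ _ G_bounded])

lemma expectation_mult_incr_power:
  "expectation (\<lambda>\<omega>. G \<omega> * incr u v s t \<omega> ^ n)
    = expectation G * (sqrt ((t - s) * cov_trace \<rho> u v (*)) ^ n * (LINT x|std_normal_distribution. x ^ n))"
  using times by (intro expectation_mult_eq_of_events[OF subalgebra_filtration _ _ G_measurable]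
      integrable_incr_power integrable_mult_incr_power expectation_indicator_incr_power) auto

lemma integrable_mult_incr: "integrable M (\<lambda>\<omega>. G \<omega> * incr u v s t \<omega>)"
  using integrable_mult_incr_power[of _ _ 1] by simp

lemma expectation_mult_incr: "expectation (\<lambda>\<omega>. G \<omega> * incr u v s t \<omega>) = 0"
  using expectation_mult_incr_power[of _ _ 1] std_normal_moments(1) by simp

lemma expectation_mult_incr_square:
  "expectation (\<lambda>\<omega>. G \<omega> * (incr u v s t \<omega>)\<^sup>2) = (t - s) * cov_trace \<rho> u v (*) * expectation G"
  using expectation_mult_incr_power[of u v 2] times cov_trace_real_nonneg[OF correlation, of u v]
  by (simp add: std_normal_moments)

lemma
  shows integrable_mult_incr_product: "integrable M (\<lambda>\<omega>. G \<omega> * (incr 1 0 s t \<omega> * incr 0 1 s t \<omega>))"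
    and expectation_mult_incr_product:
      "expectation (\<lambda>\<omega>. G \<omega> * (incr 1 0 s t \<omega> * incr 0 1 s t \<omega>)) = \<rho> * (t - s) * expectation G"
proof -
  have polarization: "G \<omega> * (incr 1 0 s t \<omega> * incr 0 1 s t \<omega>)
    = (G \<omega> * (incr 1 1 s t \<omega>)\<^sup>2 - G \<omega> * (incr 1 0 s t \<omega>)\<^sup>2 - G \<omega> * (incr 0 1 s t \<omega>)\<^sup>2) / 2" for \<omega>
    by (simp add: incr_def power2_eq_square algebra_simps)
  show "integrable M (\<lambda>\<omega>. G \<omega> * (incr 1 0 s t \<omega> * incr 0 1 s t \<omega>))"
    unfolding polarization by (intro integrable_divide Bochner_Integration.integrable_diff integrable_mult_incr_power)
  show "expectation (\<lambda>\<omega>. G \<omega> * (incr 1 0 s t \<omega> * incr 0 1 s t \<omega>)) = \<rho> * (t - s) * expectation G"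
    unfolding polarization using integrable_mult_incr_power[of _ _ 2]
    by (simp add: expectation_mult_incr_square cov_trace_real field_simps)
qed

end

lemma
  assumes "0 \<le> s" "s < t"
  shows expectation_incr_square: "expectation (\<lambda>\<omega>. (incr u v s t \<omega>)\<^sup>2) = (t - s) * cov_trace \<rho> u v (*)"
    and expectation_incr_fourth: "expectation (\<lambda>\<omega>. incr u v s t \<omega> ^ 4) = 3 * ((t - s) * cov_trace \<rho> u v (*))\<^sup>2"
proof -
  have "\<bar>q\<bar> = q" if "q = (t - s) * cov_trace \<rho> u v (*)" for q
    using that assms cov_trace_real_nonneg[OF correlation, of u v] by simp
  then have "sqrt ((t - s) * cov_trace \<rho> u v (*)) ^ 4 = ((t - s) * cov_trace \<rho> u v (*))\<^sup>2"
    by (simp add: power4_eq_xxxx power2_eq_square)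
  then show "expectation (\<lambda>\<omega>. incr u v s t \<omega> ^ 4) = 3 * ((t - s) * cov_trace \<rho> u v (*))\<^sup>2"
    using expectation_mult_incr_power[OF assms, of "\<lambda>_. 1" 1 u v 4] by (simp add: std_normal_moments prob_space)
  show "expectation (\<lambda>\<omega>. (incr u v s t \<omega>)\<^sup>2) = (t - s) * cov_trace \<rho> u v (*)"
    using expectation_mult_incr_square[OF assms, of "\<lambda>_. 1" 1 u v] by (simp add: prob_space)
qed

end

section \<open>Functions with three bounded derivatives\<close>

lemma has_real_derivative_along_line:
  fixes f :: "'b::real_normed_vector \<Rightarrow> real"
  assumes f': "(f has_derivative f') (at (v + s *\<^sub>R w))"
  shows "((\<lambda>s. f (v + s *\<^sub>R w)) has_real_derivative f' w) (at s)"
proof -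
  have "((\<lambda>s. v + s *\<^sub>R w) has_derivative (\<lambda>h. h *\<^sub>R w)) (at s)"
    by (auto intro!: derivative_eq_intros)
  from has_derivative_compose[OF this f'] have "((\<lambda>s. f (v + s *\<^sub>R w)) has_derivative (\<lambda>h. f' (h *\<^sub>R w))) (at s)" .
  moreover have "f' (h *\<^sub>R w) = f' w * h" for h
    using linear_scale[OF has_derivative_linear[OF f']] by simp
  ultimately show ?thesis
    by (simp add: has_field_derivative_def)
qed

locale bounded_C3 =
  fixes f :: "'b::real_normed_vector \<Rightarrow> real" and D1 :: "'b \<Rightarrow> 'b \<Rightarrow> real"
    and D2 :: "'b \<Rightarrow> 'b \<Rightarrow> 'b \<Rightarrow> real" and D3 :: "'b \<Rightarrow> 'b \<Rightarrow> 'b \<Rightarrow> 'b \<Rightarrow> real" and K :: real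
  assumes has_derivative_f: "\<And>v. (f has_derivative D1 v) (at v)"
    and has_derivative_D1: "\<And>v a. ((\<lambda>v. D1 v a) has_derivative (\<lambda>w. D2 v w a)) (at v)"
    and has_derivative_D2: "\<And>v a b. ((\<lambda>v. D2 v a b) has_derivative (\<lambda>w. D3 v w a b)) (at v)"
    and D1_bound: "\<And>v a. \<bar>D1 v a\<bar> \<le> K * norm a"
    and D2_bound: "\<And>v a b. \<bar>D2 v a b\<bar> \<le> K * norm a * norm b"
    and D3_bound: "\<And>v a b c. \<bar>D3 v a b c\<bar> \<le> K * norm a * norm b * norm c"
    and K_nonneg: "0 \<le> K"
begin

lemma linear_D1: "linear (D1 v)"
  using has_derivative_f by (rule has_derivative_linear)

lemma bounded_linear_D1: "bounded_linear (D1 v)"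
  using has_derivative_f by (rule has_derivative_bounded_linear)

lemma linear_D2_left: "linear (\<lambda>w. D2 v w a)"
  using has_derivative_D1 by (rule has_derivative_linear)

lemma linear_D2_right: "linear (D2 v w)"
proof (rule linearI)
  fix a b :: 'b and x :: real
  have "((\<lambda>v. D1 v a + D1 v b) has_derivative (\<lambda>w. D2 v w (a + b))) (at v)"
    using has_derivative_D1[of "a + b" v] by (simp add: linear_add[OF linear_D1])
  moreover have "((\<lambda>v. D1 v a + D1 v b) has_derivative (\<lambda>w. D2 v w a + D2 v w b)) (at v)"
    by (intro has_derivative_add has_derivative_D1)
  ultimately show "D2 v w (a + b) = D2 v w a + D2 v w b"
    by (metis has_derivative_unique)
  have "((\<lambda>v. x * D1 v a) has_derivative (\<lambda>w. D2 v w (x *\<^sub>R a))) (at v)"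
    using has_derivative_D1[of "x *\<^sub>R a" v] by (simp add: linear_scale[OF linear_D1])
  moreover have "((\<lambda>v. x * D1 v a) has_derivative (\<lambda>w. x * D2 v w a)) (at v)"
    by (intro has_derivative_mult_right has_derivative_D1)
  ultimately show "D2 v w (x *\<^sub>R a) = x *\<^sub>R D2 v w a"
    by (metis has_derivative_unique real_scaleR_def)
qed

lemma continuous_on_f: "continuous_on UNIV f"
  and continuous_on_D1: "continuous_on UNIV (\<lambda>v. D1 v a)"
  and continuous_on_D2: "continuous_on UNIV (\<lambda>v. D2 v a b)"
  by (rule has_derivative_continuous_on, rule has_derivative_at_withinI, rule has_derivative_f has_derivative_D1 has_derivative_D2)+

lemma derivatives_along_line:
  shows "((\<lambda>s. f (v + s *\<^sub>R w)) has_real_derivative D1 (v + s *\<^sub>R w) w) (at s)"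
    and "((\<lambda>s. D1 (v + s *\<^sub>R w) a) has_real_derivative D2 (v + s *\<^sub>R w) w a) (at s)"
    and "((\<lambda>s. D2 (v + s *\<^sub>R w) a b) has_real_derivative D3 (v + s *\<^sub>R w) w a b) (at s)"
  by (rule has_real_derivative_along_line, rule has_derivative_f has_derivative_D1 has_derivative_D2)+

lemma D1_lipschitz: "\<bar>D1 (v + w) a - D1 v a\<bar> \<le> K * norm w * norm a"
proof -
  obtain s where "D1 (v + 1 *\<^sub>R w) a - D1 (v + 0 *\<^sub>R w) a = (1 - 0) * D2 (v + s *\<^sub>R w) w a"
    using MVT2[of 0 1 "\<lambda>s. D1 (v + s *\<^sub>R w) a" "\<lambda>s. D2 (v + s *\<^sub>R w) w a"] derivatives_along_line(2) by auto
  then show ?thesis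
    using D2_bound[of "v + s *\<^sub>R w" w a] by simp
qed

lemma
  shows taylor2: "\<bar>f (v + w) - f v - D1 v w\<bar> \<le> K * (norm w)\<^sup>2"
    and taylor3: "\<bar>f (v + w) - f v - D1 v w - D2 v w w / 2\<bar> \<le> K * norm w ^ 3"
proof -
  define d where "d = (\<lambda>k s. [f (v + s *\<^sub>R w), D1 (v + s *\<^sub>R w) w, D2 (v + s *\<^sub>R w) w w, D3 (v + s *\<^sub>R w) w w w] ! k)"
  have d: "(d k has_real_derivative d (Suc k) s) (at s)" if "k < 3" for k s
    using that derivatives_along_line[of v w] by (auto simp: d_def less_Suc_eq eval_nat_numeral)
  have at_1: "d 0 1 = f (v + w)"
    by (simp add: d_def)
  have "\<exists>s>0. s \<le> 1 \<and> d 0 1 = (\<Sum>k<2. d k 0 / fact k * 1 ^ k) + d 2 s / fact 2 * 1 ^ 2"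
    by (rule Maclaurin2) (use d in auto)
  then obtain s where "f (v + w) - f v - D1 v w = D2 (v + s *\<^sub>R w) w w / 2"
    unfolding at_1 by (auto simp: d_def eval_nat_numeral)
  then show "\<bar>f (v + w) - f v - D1 v w\<bar> \<le> K * (norm w)\<^sup>2"
    using D2_bound[of "v + s *\<^sub>R w" w w] by (simp add: power2_eq_square)
  have "\<exists>s>0. s \<le> 1 \<and> d 0 1 = (\<Sum>k<3. d k 0 / fact k * 1 ^ k) + d 3 s / fact 3 * 1 ^ 3"
    by (rule Maclaurin2) (use d in auto)
  then obtain s where "f (v + w) - f v - D1 v w - D2 v w w / 2 = D3 (v + s *\<^sub>R w) w w w / 6"
    unfolding at_1 by (auto simp: d_def eval_nat_numeral)
  then show "\<bar>f (v + w) - f v - D1 v w - D2 v w w / 2\<bar> \<le> K * norm w ^ 3"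
    using D3_bound[of "v + s *\<^sub>R w" w w w] by (simp add: power3_eq_cube)
qed

end

lemma has_derivative_radial:
  fixes v :: "'b::real_inner"
  assumes "\<And>n. 0 \<le> n \<Longrightarrow> (\<phi> has_real_derivative \<phi>' n) (at n)"
  shows "((\<lambda>v. \<phi> (v \<bullet> v)) has_derivative (\<lambda>w. 2 * \<phi>' (v \<bullet> v) * (v \<bullet> w))) (at v)"
proof -
  have "((\<lambda>v. v \<bullet> v) has_derivative (\<lambda>w. 2 * (v \<bullet> w))) (at v)"
    by (auto intro!: derivative_eq_intros simp: inner_commute)
  from has_derivative_compose[OF this assms[of "v \<bullet> v", unfolded has_field_derivative_def]]
  show ?thesis
    by (simp add: ac_simps)
qed

definition radial_D1 :: "(real \<Rightarrow> real) \<Rightarrow> 'b::real_inner \<Rightarrow> 'b \<Rightarrow> real" where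
  "radial_D1 \<phi>1 v a = 2 * \<phi>1 (v \<bullet> v) * (v \<bullet> a)"

definition radial_D2 :: "(real \<Rightarrow> real) \<Rightarrow> (real \<Rightarrow> real) \<Rightarrow> 'b::real_inner \<Rightarrow> 'b \<Rightarrow> 'b \<Rightarrow> real" where
  "radial_D2 \<phi>1 \<phi>2 v a b = 2 * \<phi>1 (v \<bullet> v) * (a \<bullet> b) + 4 * \<phi>2 (v \<bullet> v) * ((v \<bullet> a) * (v \<bullet> b))"

definition radial_D3 :: "(real \<Rightarrow> real) \<Rightarrow> (real \<Rightarrow> real) \<Rightarrow> 'b::real_inner \<Rightarrow> 'b \<Rightarrow> 'b \<Rightarrow> 'b \<Rightarrow> real" where
  "radial_D3 \<phi>2 \<phi>3 v a b c =
    4 * \<phi>2 (v \<bullet> v) * ((v \<bullet> a) * (b \<bullet> c) + (a \<bullet> b) * (v \<bullet> c) + (v \<bullet> b) * (a \<bullet> c))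
      + 8 * \<phi>3 (v \<bullet> v) * ((v \<bullet> a) * (v \<bullet> b) * (v \<bullet> c))"

lemma abs_mult_le_of_decay:
  fixes v :: "'b::real_inner" and x p m L :: real
  assumes decay: "\<bar>x\<bar> * (1 + v \<bullet> v) ^ k \<le> L" and "j \<le> k" and p: "\<bar>p\<bar> \<le> norm v ^ j * m" and "0 \<le> m"
  shows "\<bar>x * p\<bar> \<le> L * m"
proof -
  have "norm v \<le> 1 + v \<bullet> v"
    using sum_squares_bound[of "norm v" 1, simplified] norm_ge_zero[of v] unfolding dot_square_norm by linarith
  then have "norm v ^ j \<le> (1 + v \<bullet> v) ^ j"
    by (intro power_mono) auto
  also have "\<dots> \<le> (1 + v \<bullet> v) ^ k"
    using \<open>j \<le> k\<close> by (intro power_increasing) auto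
  finally have norm_power_le: "norm v ^ j \<le> (1 + v \<bullet> v) ^ k" .
  have "\<bar>x * p\<bar> \<le> (\<bar>x\<bar> * norm v ^ j) * m"
    using mult_left_mono[OF p, of "\<bar>x\<bar>"] by (simp add: abs_mult mult.assoc)
  also have "\<dots> \<le> (\<bar>x\<bar> * (1 + v \<bullet> v) ^ k) * m"
    using norm_power_le \<open>0 \<le> m\<close> by (intro mult_right_mono mult_left_mono) auto
  also have "\<dots> \<le> L * m"
    using decay \<open>0 \<le> m\<close> by (rule mult_right_mono)
  finally show ?thesis .
qed

lemma abs_inner_mult_inner_le:
  "\<bar>(a \<bullet> b) * (c \<bullet> d)\<bar> \<le> (norm a * norm b) * (norm c * norm d)" for a b c d :: "'b::real_inner"
  unfolding abs_mult by (intro mult_mono Cauchy_Schwarz_ineq2) auto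

lemma radial_D1_bound:
  fixes v a :: "'b::real_inner"
  assumes decay: "\<bar>\<phi>1 (v \<bullet> v)\<bar> * (1 + v \<bullet> v) \<le> L"
  shows "\<bar>radial_D1 \<phi>1 v a\<bar> \<le> 20 * L * norm a"
proof -
  have first: "\<bar>\<phi>1 (v \<bullet> v) * (v \<bullet> a)\<bar> \<le> L * norm a"
    by (rule abs_mult_le_of_decay[where v=v and k=1 and j=1]) (use decay Cauchy_Schwarz_ineq2[of v a] in auto)
  then show ?thesis
    using order_trans[OF abs_ge_zero first] first by (simp add: radial_D1_def abs_mult ac_simps)
qed

lemma radial_D2_bound:
  fixes v a b :: "'b::real_inner"
  assumes decay: "\<bar>\<phi>1 (v \<bullet> v)\<bar> * (1 + v \<bullet> v) \<le> L" "\<bar>\<phi>2 (v \<bullet> v)\<bar> * (1 + v \<bullet> v)\<^sup>2 \<le> L"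
  shows "\<bar>radial_D2 \<phi>1 \<phi>2 v a b\<bar> \<le> 20 * L * norm a * norm b"
proof -
  have "\<bar>\<phi>1 (v \<bullet> v) * (a \<bullet> b)\<bar> \<le> L * (norm a * norm b)"
    by (rule abs_mult_le_of_decay[where v=v and k=1 and j=0]) (use decay Cauchy_Schwarz_ineq2[of a b] in auto)
  moreover have "\<bar>\<phi>2 (v \<bullet> v) * ((v \<bullet> a) * (v \<bullet> b))\<bar> \<le> L * (norm a * norm b)"
    by (rule abs_mult_le_of_decay[OF decay(2), where j=2])
      (use abs_inner_mult_inner_le[of v a v b] in \<open>auto simp: power2_eq_square ac_simps\<close>)
  ultimately show ?thesis
    by (simp add: radial_D2_def mult.assoc)
qed

lemma radial_D3_bound:
  fixes v a b c :: "'b::real_inner"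
  assumes decay: "\<bar>\<phi>2 (v \<bullet> v)\<bar> * (1 + v \<bullet> v)\<^sup>2 \<le> L" "\<bar>\<phi>3 (v \<bullet> v)\<bar> * (1 + v \<bullet> v) ^ 3 \<le> L"
  shows "\<bar>radial_D3 \<phi>2 \<phi>3 v a b c\<bar> \<le> 20 * L * norm a * norm b * norm c"
proof -
  have second: "\<bar>\<phi>2 (v \<bullet> v) * ((v \<bullet> x) * (y \<bullet> z))\<bar> \<le> L * (norm x * norm y * norm z)" for x y z :: 'b
    by (rule abs_mult_le_of_decay[OF decay(1), where j=1])
      (use abs_inner_mult_inner_le[of v x y z] in \<open>auto simp: ac_simps\<close>)
  have "\<bar>\<phi>3 (v \<bullet> v) * ((v \<bullet> a) * (v \<bullet> b) * (v \<bullet> c))\<bar> \<le> L * (norm a * norm b * norm c)"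
  proof (rule abs_mult_le_of_decay[OF decay(2), where j=3])
    have "\<bar>(v \<bullet> a) * (v \<bullet> b) * (v \<bullet> c)\<bar> \<le> ((norm v * norm a) * (norm v * norm b)) * (norm v * norm c)"
      unfolding abs_mult by (intro mult_mono Cauchy_Schwarz_ineq2) auto
    then show "\<bar>(v \<bullet> a) * (v \<bullet> b) * (v \<bullet> c)\<bar> \<le> norm v ^ 3 * (norm a * norm b * norm c)"
      by (simp add: power3_eq_cube ac_simps)
  qed auto
  then show ?thesis
    using second[of a b c] second[of c a b] second[of b a c] by (simp add: radial_D3_def distrib_left ac_simps)
qed

lemma bounded_C3_radial:
  fixes \<phi> \<phi>1 \<phi>2 \<phi>3 :: "real \<Rightarrow> real"
  assumes \<phi>: "\<And>n. 0 \<le> n \<Longrightarrow> (\<phi> has_real_derivative \<phi>1 n) (at n)"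
    and \<phi>1: "\<And>n. 0 \<le> n \<Longrightarrow> (\<phi>1 has_real_derivative \<phi>2 n) (at n)"
    and \<phi>2: "\<And>n. 0 \<le> n \<Longrightarrow> (\<phi>2 has_real_derivative \<phi>3 n) (at n)"
    and decay: "\<And>n. 0 \<le> n \<Longrightarrow> \<bar>\<phi>1 n\<bar> * (1 + n) \<le> L" "\<And>n. 0 \<le> n \<Longrightarrow> \<bar>\<phi>2 n\<bar> * (1 + n)\<^sup>2 \<le> L"
      "\<And>n. 0 \<le> n \<Longrightarrow> \<bar>\<phi>3 n\<bar> * (1 + n) ^ 3 \<le> L"
  shows "bounded_C3 (\<lambda>v::'b::real_inner. \<phi> (v \<bullet> v)) (radial_D1 \<phi>1) (radial_D2 \<phi>1 \<phi>2) (radial_D3 \<phi>2 \<phi>3) (20 * L)"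
proof
  fix v a b c :: 'b
  show "((\<lambda>v. \<phi> (v \<bullet> v)) has_derivative radial_D1 \<phi>1 v) (at v)"
    using has_derivative_radial[OF \<phi>, of v] unfolding radial_D1_def by simp
  have \<phi>1': "((\<lambda>v. \<phi>1 (v \<bullet> v)) has_derivative (\<lambda>a. 2 * \<phi>2 (v \<bullet> v) * (v \<bullet> a))) (at v)"
    by (rule has_derivative_radial[OF \<phi>1])
  have \<phi>2': "((\<lambda>v. \<phi>2 (v \<bullet> v)) has_derivative (\<lambda>a. 2 * \<phi>3 (v \<bullet> v) * (v \<bullet> a))) (at v)"
    by (rule has_derivative_radial[OF \<phi>2])
  show "((\<lambda>v. radial_D1 \<phi>1 v a) has_derivative (\<lambda>w. radial_D2 \<phi>1 \<phi>2 v w a)) (at v)"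
    unfolding radial_D1_def radial_D2_def
    by (rule has_derivative_eq_rhs, (rule derivative_intros \<phi>1')+) (simp add: fun_eq_iff algebra_simps)
  show "((\<lambda>v. radial_D2 \<phi>1 \<phi>2 v a b) has_derivative (\<lambda>w. radial_D3 \<phi>2 \<phi>3 v w a b)) (at v)"
    unfolding radial_D2_def radial_D3_def
    by (rule has_derivative_eq_rhs, (rule derivative_intros \<phi>1' \<phi>2')+) (simp add: fun_eq_iff algebra_simps)
  have "\<bar>\<phi>1 0\<bar> \<le> L"
    using decay(1)[of 0] by simp
  then show "0 \<le> 20 * L"
    by simp
  note decay_v = decay[OF inner_ge_zero[of v]]
  show "\<bar>radial_D1 \<phi>1 v a\<bar> \<le> 20 * L * norm a"
    by (rule radial_D1_bound) (fact decay_v)+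
  show "\<bar>radial_D2 \<phi>1 \<phi>2 v a b\<bar> \<le> 20 * L * norm a * norm b"
    by (rule radial_D2_bound) (fact decay_v)+
  show "\<bar>radial_D3 \<phi>2 \<phi>3 v a b c\<bar> \<le> 20 * L * norm a * norm b * norm c"
    by (rule radial_D3_bound) (fact decay_v)+
qed

section \<open>The regularised logarithmic potential\<close>

definition log_ratio :: "real \<Rightarrow> real \<Rightarrow> real" where
  "log_ratio \<epsilon> n = ln (n + (1 + \<epsilon>)) - ln (n + \<epsilon>)"

definition inv_power_gap :: "real \<Rightarrow> nat \<Rightarrow> real \<Rightarrow> real" where
  "inv_power_gap \<epsilon> k n = (1 / (n + \<epsilon>)) ^ k - (1 / (n + (1 + \<epsilon>))) ^ k"

context
  fixes \<epsilon> n :: real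
  assumes \<epsilon>: "0 < \<epsilon>" and n: "0 \<le> n"
begin

lemma log_ratio_eq: "log_ratio \<epsilon> n = ln (1 + 1 / (n + \<epsilon>))"
proof -
  have "1 + 1 / (n + \<epsilon>) = (n + (1 + \<epsilon>)) / (n + \<epsilon>)"
    using n \<epsilon> by (simp add: field_simps)
  then show ?thesis
    using n \<epsilon> by (simp add: log_ratio_def ln_div)
qed

lemma log_ratio_nonneg: "0 \<le> log_ratio \<epsilon> n"
  unfolding log_ratio_eq using n \<epsilon> by simp

lemma log_ratio_le:
  assumes "0 < m" "m \<le> n + \<epsilon>"
  shows "log_ratio \<epsilon> n \<le> ln (1 + 1 / m)"
  unfolding log_ratio_eq using assms n \<epsilon>
  by (subst ln_le_cancel_iff) (auto intro!: divide_left_mono add_pos_pos)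

lemma has_real_derivative_log_ratio: "(log_ratio \<epsilon> has_real_derivative - inv_power_gap \<epsilon> 1 n) (at n)"
  unfolding log_ratio_def inv_power_gap_def using n \<epsilon> by (auto intro!: derivative_eq_intros)

lemma has_real_derivative_inv_power_gap:
  "(inv_power_gap \<epsilon> (Suc k) has_real_derivative - (real (Suc k) * inv_power_gap \<epsilon> (Suc (Suc k)) n)) (at n)"
proof -
  have "((\<lambda>n. (1 / (n + a)) ^ Suc k) has_real_derivative - (real (Suc k) * (1 / (n + a)) ^ Suc (Suc k))) (at n)"
    if "0 < a" for a
  proof -
    have "((\<lambda>n. 1 / (n + a)) has_real_derivative - ((1 / (n + a))\<^sup>2)) (at n)"
      using n that by (auto intro!: derivative_eq_intros simp: power2_eq_square)
    then show ?thesis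
      by (rule DERIV_cong[OF DERIV_power_Suc]) (simp add: power2_eq_square mult.assoc)
  qed
  from DERIV_diff[OF this[of \<epsilon>] this[of "1 + \<epsilon>"]] show ?thesis
    unfolding inv_power_gap_def using \<epsilon> by (simp add: right_diff_distrib)
qed

lemma inv_power_gap_nonneg: "0 \<le> inv_power_gap \<epsilon> k n"
  unfolding inv_power_gap_def using n \<epsilon> by (simp add: power_mono frac_le)

lemma inv_power_gap_decay:
  assumes "k \<le> l"
  shows "inv_power_gap \<epsilon> k n * (1 + n) ^ k \<le> (1 + 1 / \<epsilon>) ^ l"
proof -
  have "inv_power_gap \<epsilon> k n * (1 + n) ^ k \<le> (1 / (n + \<epsilon>)) ^ k * (1 + n) ^ k"
    unfolding inv_power_gap_def using n \<epsilon> by (intro mult_right_mono) auto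
  also have "\<dots> = ((1 + n) / (n + \<epsilon>)) ^ k"
    by (simp flip: power_mult_distrib)
  also have "\<dots> \<le> (1 + 1 / \<epsilon>) ^ k"
  proof (rule power_mono)
    have "1 / (n + \<epsilon>) \<le> 1 / \<epsilon>" "n / (n + \<epsilon>) \<le> 1"
      using n \<epsilon> by (auto intro!: divide_left_mono)
    then show "(1 + n) / (n + \<epsilon>) \<le> 1 + 1 / \<epsilon>"
      unfolding add_divide_distrib by linarith
  qed (use n \<epsilon> in auto)
  also have "\<dots> \<le> (1 + 1 / \<epsilon>) ^ l"
    using assms \<epsilon> by (intro power_increasing) auto
  finally show ?thesis .
qed

text \<open>
  For phi = log_ratio eps this reads (n phi'(n))' <= 1, which bounds the planar Laplacian of
  phi(|v|^2) uniformly in eps.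
\<close>

lemma inv_power_gap_supersolution: "n * inv_power_gap \<epsilon> 2 n - inv_power_gap \<epsilon> 1 n \<le> 1"
proof -
  have split: "n * (1 / (n + a))\<^sup>2 - 1 / (n + a) = - (a / (n + a)\<^sup>2)" if "0 < a" for a
    using n that by (simp add: divide_simps power2_eq_square)
  have "(1 + \<epsilon>) / (n + (1 + \<epsilon>))\<^sup>2 \<le> 1"
  proof -
    have "1 + \<epsilon> \<le> (n + (1 + \<epsilon>)) * 1"
      using n by simp
    also have "\<dots> \<le> (n + (1 + \<epsilon>)) * (n + (1 + \<epsilon>))"
      using n \<epsilon> by (intro mult_left_mono) auto
    finally show ?thesis
      using n \<epsilon> by (simp add: power2_eq_square)
  qed
  moreover have "0 \<le> \<epsilon> / (n + \<epsilon>)\<^sup>2"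
    using \<epsilon> by simp
  ultimately show ?thesis
    unfolding inv_power_gap_def right_diff_distrib power_one_right using split[of \<epsilon>] split[of "1 + \<epsilon>"] \<epsilon> by linarith
qed

end

abbreviation log_ratio_D1 :: "real \<Rightarrow> 'b::real_inner \<Rightarrow> 'b \<Rightarrow> real" where
  "log_ratio_D1 \<epsilon> \<equiv> radial_D1 (\<lambda>n. - inv_power_gap \<epsilon> 1 n)"

abbreviation log_ratio_D2 :: "real \<Rightarrow> 'b::real_inner \<Rightarrow> 'b \<Rightarrow> 'b \<Rightarrow> real" where
  "log_ratio_D2 \<epsilon> \<equiv> radial_D2 (\<lambda>n. - inv_power_gap \<epsilon> 1 n) (inv_power_gap \<epsilon> 2)"

abbreviation log_ratio_D3 :: "real \<Rightarrow> 'b::real_inner \<Rightarrow> 'b \<Rightarrow> 'b \<Rightarrow> 'b \<Rightarrow> real" where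
  "log_ratio_D3 \<epsilon> \<equiv> radial_D3 (inv_power_gap \<epsilon> 2) (\<lambda>n. - 2 * inv_power_gap \<epsilon> 3 n)"

definition log_ratio_D_bound :: "real \<Rightarrow> real" where
  "log_ratio_D_bound \<epsilon> = 20 * (2 * (1 + 1 / \<epsilon>) ^ 3)"

lemma bounded_C3_log_ratio:
  assumes \<epsilon>: "0 < \<epsilon>"
  shows "bounded_C3 (\<lambda>v::'b::real_inner. log_ratio \<epsilon> (v \<bullet> v)) (log_ratio_D1 \<epsilon>) (log_ratio_D2 \<epsilon>) (log_ratio_D3 \<epsilon>)
    (log_ratio_D_bound \<epsilon>)"
  unfolding log_ratio_D_bound_def
proof (rule bounded_C3_radial)
  fix n :: real assume n: "0 \<le> n"
  show "(log_ratio \<epsilon> has_real_derivative - inv_power_gap \<epsilon> 1 n) (at n)"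
    by (rule has_real_derivative_log_ratio[OF \<epsilon> n])
  show "((\<lambda>n. - inv_power_gap \<epsilon> 1 n) has_real_derivative inv_power_gap \<epsilon> 2 n) (at n)"
    using DERIV_minus[OF has_real_derivative_inv_power_gap[OF \<epsilon> n, of 0]] by (simp add: numeral_2_eq_2)
  show "(inv_power_gap \<epsilon> 2 has_real_derivative - 2 * inv_power_gap \<epsilon> 3 n) (at n)"
    using has_real_derivative_inv_power_gap[OF \<epsilon> n, of 1] by (simp add: numeral_2_eq_2 numeral_3_eq_3)
  note nonneg = inv_power_gap_nonneg[OF \<epsilon> n] and decay = inv_power_gap_decay[OF \<epsilon> n, of _ 3]
  have "0 \<le> (1 + 1 / \<epsilon>) ^ 3"
    using \<epsilon> by (intro zero_le_power add_nonneg_nonneg) auto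
  then have "p \<le> 2 * (1 + 1 / \<epsilon>) ^ 3" if "p \<le> (1 + 1 / \<epsilon>) ^ 3" for p
    using that by linarith
  then show "\<bar>- inv_power_gap \<epsilon> 1 n\<bar> * (1 + n) \<le> 2 * (1 + 1 / \<epsilon>) ^ 3"
    "\<bar>inv_power_gap \<epsilon> 2 n\<bar> * (1 + n)\<^sup>2 \<le> 2 * (1 + 1 / \<epsilon>) ^ 3"
    "\<bar>- 2 * inv_power_gap \<epsilon> 3 n\<bar> * (1 + n) ^ 3 \<le> 2 * (1 + 1 / \<epsilon>) ^ 3"
    using nonneg[of 1] nonneg[of 2] nonneg[of 3] decay[of 1] decay[of 2] decay[of 3] by (simp_all add: abs_mult)
qed

lemma log_ratio_generator_le:
  fixes v x c1 c2 :: "'b::real_inner"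
  assumes \<epsilon>: "0 < \<epsilon>" and \<theta>: "0 \<le> \<theta>"
    and dispersion: "cov_trace \<rho> c1 c2 (\<lambda>a b. (v \<bullet> a) * (v \<bullet> b)) \<le> \<theta> * (v \<bullet> v)"
    and drift: "2 * \<theta> \<le> 2 * (v \<bullet> x) + cov_trace \<rho> c1 c2 (\<bullet>)"
  shows "log_ratio_D1 \<epsilon> v x + cov_trace \<rho> c1 c2 (log_ratio_D2 \<epsilon> v) / 2 \<le> 2 * \<theta>"
proof -
  define n where "n = v \<bullet> v"
  have n: "0 \<le> n"
    by (simp add: n_def)
  note nonneg = inv_power_gap_nonneg[OF \<epsilon> n]
  have "log_ratio_D1 \<epsilon> v x + cov_trace \<rho> c1 c2 (log_ratio_D2 \<epsilon> v) / 2
    = 2 * (inv_power_gap \<epsilon> 2 n * cov_trace \<rho> c1 c2 (\<lambda>a b. (v \<bullet> a) * (v \<bullet> b)))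
      - inv_power_gap \<epsilon> 1 n * (2 * (v \<bullet> x) + cov_trace \<rho> c1 c2 (\<bullet>))"
    by (simp add: cov_trace_def radial_D1_def radial_D2_def n_def field_simps)
  also have "\<dots> \<le> 2 * (inv_power_gap \<epsilon> 2 n * (\<theta> * n)) - inv_power_gap \<epsilon> 1 n * (2 * \<theta>)"
    using dispersion drift nonneg unfolding n_def by (intro diff_mono mult_left_mono) auto
  also have "\<dots> = 2 * \<theta> * (n * inv_power_gap \<epsilon> 2 n - inv_power_gap \<epsilon> 1 n)"
    by (simp add: algebra_simps)
  also have "\<dots> \<le> 2 * \<theta> * 1"
    using inv_power_gap_supersolution[OF \<epsilon> n] \<theta> by (intro mult_left_mono) auto
  finally show ?thesis
    by simp
qed

section \<open>The drift along a finely partitioned path\<close>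

definition uniform_grid :: "real \<Rightarrow> real \<Rightarrow> nat \<Rightarrow> nat \<Rightarrow> real" where
  "uniform_grid s t n i = s + real i * ((t - s) / real n)"

lemma uniform_grid_0: "uniform_grid s t n 0 = s"
  by (simp add: uniform_grid_def)

lemma uniform_grid_last: "0 < n \<Longrightarrow> uniform_grid s t n n = t"
  by (simp add: uniform_grid_def)

lemma uniform_grid_Suc: "uniform_grid s t n (Suc i) = uniform_grid s t n i + (t - s) / real n"
  by (simp add: uniform_grid_def distrib_right add_divide_distrib)

lemma uniform_grid_mono: "s \<le> t \<Longrightarrow> i \<le> j \<Longrightarrow> uniform_grid s t n i \<le> uniform_grid s t n j"
  by (simp add: uniform_grid_def mult_right_mono divide_right_mono)

lemma uniform_grid_less_Suc: "s < t \<Longrightarrow> 0 < n \<Longrightarrow> uniform_grid s t n i < uniform_grid s t n (Suc i)"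
  by (simp add: uniform_grid_Suc)

lemma uniform_grid_ge: "s \<le> t \<Longrightarrow> s \<le> uniform_grid s t n i"
  using uniform_grid_mono[of s t 0 i n] by (simp add: uniform_grid_0)

lemma uniform_grid_le: "s \<le> t \<Longrightarrow> 0 < n \<Longrightarrow> i \<le> n \<Longrightarrow> uniform_grid s t n i \<le> t"
  using uniform_grid_mono[of s t i n n] by (simp add: uniform_grid_last)

definition grid_oscillation_le :: "(real \<Rightarrow> 'b::metric_space) \<Rightarrow> real \<Rightarrow> real \<Rightarrow> nat \<Rightarrow> real \<Rightarrow> bool" where
  "grid_oscillation_le z s t n w \<longleftrightarrow>
    (\<forall>i<n. \<forall>u\<in>{uniform_grid s t n i..uniform_grid s t n (Suc i)}. dist (z u) (z (uniform_grid s t n i)) \<le> w)"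

lemma eventually_grid_oscillation_le:
  fixes z :: "real \<Rightarrow> 'b::metric_space"
  assumes z: "continuous_on {s..t} z" and "s < t" "0 < w"
  shows "\<forall>\<^sub>F n in sequentially. grid_oscillation_le z s t n w"
proof -
  have "uniformly_continuous_on {s..t} z"
    using z by (rule compact_uniformly_continuous) auto
  then obtain d where d: "0 < d" "\<And>u u'. u \<in> {s..t} \<Longrightarrow> u' \<in> {s..t} \<Longrightarrow> dist u' u < d \<Longrightarrow> dist (z u') (z u) < w"
    unfolding uniformly_continuous_on_def using \<open>0 < w\<close> by metis
  have "(\<lambda>n. (t - s) / real n) \<longlonglongrightarrow> 0"
    by (rule lim_const_over_n)
  then have "\<forall>\<^sub>F n in sequentially. (t - s) / real n < d"
    using d(1) by (rule order_tendstoD)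
  with eventually_gt_at_top[of 0] show ?thesis
  proof eventually_elim
    case (elim n)
    show ?case
      unfolding grid_oscillation_le_def
    proof (intro allI impI ballI)
      fix i u assume "i < n" and u: "u \<in> {uniform_grid s t n i..uniform_grid s t n (Suc i)}"
      then have "s \<le> uniform_grid s t n i" "uniform_grid s t n (Suc i) \<le> t"
        using \<open>s < t\<close> by (auto intro!: uniform_grid_ge uniform_grid_le)
      moreover have "dist u (uniform_grid s t n i) < d"
        using u elim(2) by (simp add: dist_real_def uniform_grid_Suc)
      ultimately show "dist (z u) (z (uniform_grid s t n i)) \<le> w"
        using u by (intro less_imp_le d(2)) auto
    qed
  qed
qed

lemma set_lebesgue_integral_Icc_split:
  fixes f :: "real \<Rightarrow> 'b::{banach, second_countable_topology}"
  assumes "p \<le> q" "q \<le> r" and f: "set_integrable lborel {p..r} f"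
  shows "(LINT u:{p..r}|lborel. f u) = (LINT u:{p..q}|lborel. f u) + (LINT u:{q..r}|lborel. f u)"
proof -
  have "AE u in lborel. \<not> (u \<in> {p..q} \<and> u \<in> {q..r})"
    using AE_lborel_singleton[of q] by eventually_elim auto
  moreover have "set_integrable lborel {p..q} f" "set_integrable lborel {q..r} f"
    using assms(1,2) by (auto intro: set_integrable_subset[OF f])
  ultimately have "(LINT u:{p..q} \<union> {q..r}|lborel. f u) = (LINT u:{p..q}|lborel. f u) + (LINT u:{q..r}|lborel. f u)"
    by (intro set_integral_Un_AE) auto
  then show ?thesis
    using assms(1,2) by (simp add: ivl_disj_un_two_touch)
qed

lemma sum_set_lebesgue_integral_uniform_grid:
  fixes f :: "real \<Rightarrow> real"
  assumes "s < t" "0 < n" and f: "set_integrable lborel {s..t} f"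
  shows "(\<Sum>i<n. LINT u:{uniform_grid s t n i..uniform_grid s t n (Suc i)}|lborel. f u) = (LINT u:{s..t}|lborel. f u)"
proof -
  define I where "I = (\<lambda>i. LINT u:{s..uniform_grid s t n i}|lborel. f u)"
  have "(LINT u:{uniform_grid s t n i..uniform_grid s t n (Suc i)}|lborel. f u) = I (Suc i) - I i" if "i < n" for i
    using assms that set_lebesgue_integral_Icc_split[of s "uniform_grid s t n i" "uniform_grid s t n (Suc i)" f]
      set_integrable_subset[OF f, of "{s..uniform_grid s t n (Suc i)}"]
    by (auto simp: I_def uniform_grid_ge uniform_grid_mono uniform_grid_le)
  then have "(\<Sum>i<n. LINT u:{uniform_grid s t n i..uniform_grid s t n (Suc i)}|lborel. f u) = I n - I 0"
    by (simp add: sum_lessThan_telescope)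
  moreover have "I 0 = 0"
    unfolding I_def uniform_grid_0 set_lebesgue_integral_def
    by (rule integral_eq_zero_AE) (use AE_lborel_singleton[of s] in eventually_elim, auto)
  ultimately show ?thesis
    by (simp add: I_def uniform_grid_last[OF assms(2)])
qed

lemma (in bounded_C3) taylor2_displaced:
  assumes m: "norm m \<le> w" and x: "norm x \<le> 2 * w"
  shows "f (v + m + x) - f (v + m) \<le> D1 v x + 3 * K * w * norm x"
proof -
  have "K * norm m * norm x \<le> K * w * norm x"
    using m K_nonneg by (intro mult_right_mono mult_left_mono) auto
  moreover have "K * norm x * norm x \<le> K * (2 * w) * norm x"
    using x K_nonneg by (intro mult_right_mono mult_left_mono) auto
  moreover have "f (v + m + x) - f (v + m) - D1 (v + m) x \<le> K * (norm x)\<^sup>2"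
    using taylor2[of "v + m" x] by linarith
  moreover have "D1 (v + m) x - D1 v x \<le> K * norm m * norm x"
    using D1_lipschitz[of v m x] by linarith
  ultimately show ?thesis
    by (simp add: power2_eq_square)
qed

context
  fixes f :: "'b::{banach, second_countable_topology} \<Rightarrow> real" and D1 D2 D3 K
    and v r :: "real \<Rightarrow> 'b" and a :: "'b \<Rightarrow> real"
  assumes C3: "bounded_C3 f D1 D2 D3 K"
begin

interpretation bounded_C3 f D1 D2 D3 K
  by (fact C3)

lemma generator_frozen_integral_le:
  assumes "p \<le> q" and r: "set_integrable lborel {p..q} r"
    and generator: "AE u in lborel. u \<in> {p..q} \<longrightarrow> D1 (v u) (r u) + a (v u) \<le> \<theta>"
    and v_osc: "\<And>u. u \<in> {p..q} \<Longrightarrow> norm (v u - v p) \<le> w"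
    and a_osc: "\<And>u. u \<in> {p..q} \<Longrightarrow> \<bar>a (v u) - a (v p)\<bar> \<le> w"
  shows "D1 (v p) (LINT u:{p..q}|lborel. r u) + (q - p) * a (v p)
    \<le> (\<theta> + w) * (q - p) + K * w * (LINT u:{p..q}|lborel. norm (r u))"
proof -
  have const: "set_integrable lborel {p..q} (\<lambda>u. x)" for x :: real
    by (auto simp: set_integrable_def emeasure_lborel_Icc_eq intro!: integrable_mult_left integrable_real_indicator)
  have integral_const: "(LINT u:{p..q}|lborel. x) = (q - p) * x" for x :: real
    using assms(1) by (simp add: set_lebesgue_integral_def)
  have D1_r: "set_integrable lborel {p..q} (\<lambda>u. D1 (v p) (r u))"
    "(LINT u:{p..q}|lborel. D1 (v p) (r u)) = D1 (v p) (LINT u:{p..q}|lborel. r u)"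
    using integrable_bounded_linear[OF bounded_linear_D1 r[unfolded set_integrable_def], of "v p"]
      integral_bounded_linear[OF bounded_linear_D1 r[unfolded set_integrable_def], of "v p"]
    by (simp_all add: set_integrable_def set_lebesgue_integral_def linear_scale[OF linear_D1])
  have norm_r: "set_integrable lborel {p..q} (\<lambda>u. K * w * norm (r u))"
    using r by (intro set_integrable_mult_right set_integrable_norm)
  have "D1 (v p) (r u) + a (v p) \<le> (\<theta> + w) + K * w * norm (r u)"
    if "u \<in> {p..q}" "D1 (v u) (r u) + a (v u) \<le> \<theta>" for u
  proof -
    have "\<bar>D1 (v u) (r u) - D1 (v p) (r u)\<bar> \<le> K * norm (v u - v p) * norm (r u)"
      using D1_lipschitz[of "v p" "v u - v p" "r u"] by simp
    also have "\<dots> \<le> K * w * norm (r u)"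
      using v_osc[OF that(1)] K_nonneg by (intro mult_right_mono mult_left_mono) auto
    finally show ?thesis
      using that(2) a_osc[OF that(1)] by linarith
  qed
  with generator have "AE u\<in>{p..q} in lborel. D1 (v p) (r u) + a (v p) \<le> (\<theta> + w) + K * w * norm (r u)"
    by (elim eventually_mono) blast
  then have "(LINT u:{p..q}|lborel. D1 (v p) (r u) + a (v p)) \<le> (LINT u:{p..q}|lborel. (\<theta> + w) + K * w * norm (r u))"
    by (intro set_integral_mono_AE set_integral_add(1)[OF D1_r(1) const] set_integral_add(1)[OF const norm_r])
  then show ?thesis
    unfolding set_integral_add(2)[OF D1_r(1) const] set_integral_add(2)[OF const norm_r] D1_r(2) integral_const
    by (simp add: algebra_simps)
qed

lemma drift_increment_le:
  assumes "p \<le> q" and r: "set_integrable lborel {p..q} r"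
    and increment: "v q = v p + m + (LINT u:{p..q}|lborel. r u)"
    and generator: "AE u in lborel. u \<in> {p..q} \<longrightarrow> D1 (v u) (r u) + a (v u) \<le> \<theta>"
    and m_osc: "norm m \<le> w" and v_osc: "\<And>u. u \<in> {p..q} \<Longrightarrow> norm (v u - v p) \<le> w"
    and a_osc: "\<And>u. u \<in> {p..q} \<Longrightarrow> \<bar>a (v u) - a (v p)\<bar> \<le> w"
  shows "f (v q) - f (v p + m) + (q - p) * a (v p)
    \<le> (\<theta> + w) * (q - p) + 4 * K * w * (LINT u:{p..q}|lborel. norm (r u))"
proof -
  define x where "x = (LINT u:{p..q}|lborel. r u)"
  have "norm x \<le> norm (v q - v p) + norm m"
    using norm_triangle_ineq4[of "v q - v p" m] increment by (simp add: x_def)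
  then have "norm x \<le> 2 * w"
    using v_osc[of q] m_osc assms(1) by simp
  then have "f (v q) - f (v p + m) \<le> D1 (v p) x + 3 * K * w * norm x"
    using taylor2_displaced[OF m_osc, of x "v p"] increment by (simp add: x_def)
  also have "norm x \<le> (LINT u:{p..q}|lborel. norm (r u))"
    unfolding x_def by (rule set_integral_norm_bound[OF r])
  then have "D1 (v p) x + 3 * K * w * norm x \<le> D1 (v p) x + 3 * K * w * (LINT u:{p..q}|lborel. norm (r u))"
    using K_nonneg order_trans[OF norm_ge_zero m_osc] by (intro add_left_mono mult_left_mono) auto
  finally show ?thesis
    using generator_frozen_integral_le[OF assms(1) r generator v_osc a_osc] by (simp add: x_def algebra_simps)
qed

end

definition drift_sum :: "('b::ab_group_add \<Rightarrow> real) \<Rightarrow> ('b \<Rightarrow> real) \<Rightarrow> (real \<Rightarrow> 'b) \<Rightarrow> (real \<Rightarrow> 'b) \<Rightarrow>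
    real \<Rightarrow> real \<Rightarrow> nat \<Rightarrow> real" where
  "drift_sum f a v m s t n = (let T = uniform_grid s t n in
    \<Sum>i<n. f (v (T (Suc i))) - f (v (T i) + (m (T (Suc i)) - m (T i))) + (t - s) / real n * a (v (T i)))"

context
  fixes f :: "'b::{banach, second_countable_topology} \<Rightarrow> real" and D1 D2 D3 K
    and v m r :: "real \<Rightarrow> 'b" and a :: "'b \<Rightarrow> real" and s t \<theta> :: real
  assumes C3: "bounded_C3 f D1 D2 D3 K" and times: "s < t" and r: "set_integrable lborel {s..t} r"
    and increment: "\<And>p q. s \<le> p \<Longrightarrow> p \<le> q \<Longrightarrow> q \<le> t \<Longrightarrow> v q = v p + (m q - m p) + (LINT u:{p..q}|lborel. r u)"
    and generator: "AE u in lborel. u \<in> {s..t} \<longrightarrow> D1 (v u) (r u) + a (v u) \<le> \<theta>"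
begin

lemma drift_sum_le:
  assumes "0 < n" and oscillation: "grid_oscillation_le v s t n w" "grid_oscillation_le m s t n w"
    "grid_oscillation_le (\<lambda>u. a (v u)) s t n w"
  shows "drift_sum f a v m s t n \<le> \<theta> * (t - s) + w * ((t - s) + 4 * K * (LINT u:{s..t}|lborel. norm (r u)))"
proof -
  define T where "T = uniform_grid s t n"
  have T: "s \<le> T i" "T i \<le> T (Suc i)" "T (Suc i) \<le> t" "T (Suc i) - T i = (t - s) / real n" if "i < n" for i
    using that times \<open>0 < n\<close> uniform_grid_ge[of s t n i] uniform_grid_le[of s t n "Suc i"]
      uniform_grid_less_Suc[of s t n i] by (auto simp: T_def uniform_grid_Suc)
  have "drift_sum f a v m s t n \<le> (\<Sum>i<n. (\<theta> + w) * ((t - s) / real n)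
      + 4 * K * w * (LINT u:{T i..T (Suc i)}|lborel. norm (r u)))"
    unfolding drift_sum_def Let_def T_def[symmetric]
  proof (rule sum_mono)
    fix i assume "i \<in> {..<n}"
    then have i: "i < n" by simp
    have "AE u in lborel. u \<in> {T i..T (Suc i)} \<longrightarrow> D1 (v u) (r u) + a (v u) \<le> \<theta>"
      using generator by eventually_elim (use T[OF i] in auto)
    moreover have "set_integrable lborel {T i..T (Suc i)} r"
      using T[OF i] by (intro set_integrable_subset[OF r]) auto
    ultimately have "f (v (T (Suc i))) - f (v (T i) + (m (T (Suc i)) - m (T i))) + (T (Suc i) - T i) * a (v (T i))
      \<le> (\<theta> + w) * (T (Suc i) - T i) + 4 * K * w * (LINT u:{T i..T (Suc i)}|lborel. norm (r u))"
      using oscillation i T[OF i]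
      by (intro drift_increment_le[OF C3] increment) (auto simp: grid_oscillation_le_def T_def dist_norm)
    then show "f (v (T (Suc i))) - f (v (T i) + (m (T (Suc i)) - m (T i))) + (t - s) / real n * a (v (T i))
      \<le> (\<theta> + w) * ((t - s) / real n) + 4 * K * w * (LINT u:{T i..T (Suc i)}|lborel. norm (r u))"
      unfolding T(4)[OF i] .
  qed
  also have "\<dots> = (\<theta> + w) * (t - s) + 4 * K * w * (LINT u:{s..t}|lborel. norm (r u))"
    using \<open>0 < n\<close> sum_set_lebesgue_integral_uniform_grid[OF times \<open>0 < n\<close> set_integrable_norm[OF r]]
    by (simp add: sum.distrib T_def flip: sum_distrib_left)
  finally show ?thesis
    by (simp add: algebra_simps)
qed

lemma eventually_drift_sum_le:
  assumes a: "continuous_on UNIV a" and v: "continuous_on {s..t} v" and m: "continuous_on {s..t} m" and "0 < e"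
  shows "\<forall>\<^sub>F n in sequentially. drift_sum f a v m s t n \<le> \<theta> * (t - s) + e"
proof -
  define x where "x = (t - s) + 4 * K * (LINT u:{s..t}|lborel. norm (r u))"
  have "0 < x"
    unfolding x_def set_lebesgue_integral_def using times bounded_C3.K_nonneg[OF C3] by (intro add_pos_nonneg) auto
  then have w: "0 < e / x" "e / x * x = e"
    using \<open>0 < e\<close> by auto
  have av: "continuous_on {s..t} (\<lambda>u. a (v u))"
    using continuous_on_compose2[OF a v] by simp
  note oscillation = eventually_grid_oscillation_le[OF _ times w(1)]
  show ?thesis
    using eventually_gt_at_top[of 0] oscillation[OF v] oscillation[OF m] oscillation[OF av]
  proof eventually_elim
    case (elim n)
    then show ?case
      using drift_sum_le[OF elim] w(2) unfolding x_def by simp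
  qed
qed

end

section \<open>One-sided passage to the limit\<close>

context prob_space
begin

lemma tendsto_prob_0_of_AE_eventually_notin:
  assumes E[measurable]: "\<And>n. E n \<in> events" and "AE \<omega> in M. \<forall>\<^sub>F n in sequentially. \<omega> \<notin> E n"
  shows "(\<lambda>n. prob (E n)) \<longlonglongrightarrow> 0"
proof -
  have "(\<lambda>n. expectation (indicator (E n) :: 'a \<Rightarrow> real)) \<longlonglongrightarrow> expectation (\<lambda>\<omega>. 0)"
  proof (rule integral_dominated_convergence[where w="\<lambda>_. 1"])
    show "AE \<omega> in M. (\<lambda>n. indicator (E n) \<omega> :: real) \<longlonglongrightarrow> 0"
      using assms(2)
    proof eventually_elim
      case (elim \<omega>)
      then show ?case
        by (intro tendsto_eventually) (auto elim: eventually_mono)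
    qed
  qed (auto simp: indicator_def)
  then show ?thesis
    by (simp add: sets.Int_space_eq2)
qed

lemma tendsto_prob_greater_of_AE_eventually_le:
  fixes U :: "nat \<Rightarrow> 'a \<Rightarrow> real"
  assumes [measurable]: "\<And>n. U n \<in> borel_measurable M" and "AE \<omega> in M. \<forall>\<^sub>F n in sequentially. U n \<omega> \<le> x"
  shows "(\<lambda>n. prob {\<omega> \<in> space M. x < U n \<omega>}) \<longlonglongrightarrow> 0"
proof (rule tendsto_prob_0_of_AE_eventually_notin)
  show "AE \<omega> in M. \<forall>\<^sub>F n in sequentially. \<omega> \<notin> {\<omega> \<in> space M. x < U n \<omega>}"
    using assms(2) by eventually_elim (auto elim: eventually_mono)
qed measurable

lemma expectation_indicator_le_add_square:
  fixes U :: "'a \<Rightarrow> real"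
  assumes U[measurable]: "U \<in> borel_measurable M" and A: "A \<in> events" and U2: "integrable M (\<lambda>\<omega>. (U \<omega>)\<^sup>2)"
    and "0 < x" "0 < y"
  shows "expectation (\<lambda>\<omega>. indicator A \<omega> * U \<omega>)
    \<le> x + y * expectation (\<lambda>\<omega>. (U \<omega>)\<^sup>2) + prob {\<omega> \<in> space M. x < U \<omega>} / (4 * y)"
proof -
  define J where "J = {\<omega> \<in> space M. x < U \<omega>}"
  have [measurable]: "J \<in> events"
    by (simp add: J_def)
  have amgm: "u \<le> y * u\<^sup>2 + 1 / (4 * y)" for u :: real
  proof -
    have "0 \<le> (2 * y * u - 1)\<^sup>2 / (4 * y)"
      using \<open>0 < y\<close> by simp
    also have "\<dots> = y * u\<^sup>2 - u + 1 / (4 * y)"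
      using \<open>0 < y\<close> by (simp add: power2_eq_square field_simps)
    finally show ?thesis
      by simp
  qed
  have "indicator A \<omega> * U \<omega> \<le> x + y * (U \<omega>)\<^sup>2 + indicator J \<omega> / (4 * y)" if "\<omega> \<in> space M" for \<omega>
    using amgm[of "U \<omega>"] that \<open>0 < x\<close> \<open>0 < y\<close>
    by (cases "\<omega> \<in> J"; cases "\<omega> \<in> A") (auto simp: J_def add_increasing add_increasing2)
  moreover have "integrable M (\<lambda>\<omega>. indicator A \<omega> * U \<omega>)"
    using integrable_mult_indicator[OF A square_integrable_imp_integrable[OF U U2]] by simp
  ultimately have "expectation (\<lambda>\<omega>. indicator A \<omega> * U \<omega>)
    \<le> expectation (\<lambda>\<omega>. x + y * (U \<omega>)\<^sup>2 + indicator J \<omega> / (4 * y))"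
    using U2 by (intro integral_mono_AE AE_I2) (auto simp: emeasure_eq_measure)
  also have "\<dots> = x + y * expectation (\<lambda>\<omega>. (U \<omega>)\<^sup>2) + prob J / (4 * y)"
    using U2 by (simp add: emeasure_eq_measure prob_space sets.Int_space_eq2)
  finally show ?thesis
    by (simp add: J_def)
qed

lemma eventually_expectation_indicator_le_of_L2_bounded:
  fixes U :: "nat \<Rightarrow> 'a \<Rightarrow> real"
  assumes U[measurable]: "\<And>n. U n \<in> borel_measurable M" and A: "A \<in> events"
    and L2: "\<forall>\<^sub>F n in sequentially. integrable M (\<lambda>\<omega>. (U n \<omega>)\<^sup>2) \<and> expectation (\<lambda>\<omega>. (U n \<omega>)\<^sup>2) \<le> L"
    and limit: "AE \<omega> in M. \<forall>e>0. \<forall>\<^sub>F n in sequentially. U n \<omega> \<le> e"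
    and "0 < e"
  shows "\<forall>\<^sub>F n in sequentially. expectation (\<lambda>\<omega>. indicator A \<omega> * U n \<omega>) \<le> e"
proof -
  define x where "x = e / 3"
  define y where "y = x / (\<bar>L\<bar> + 1)"
  have pos: "0 < x" "0 < y"
    using \<open>0 < e\<close> by (auto simp: x_def y_def)
  have "L \<le> \<bar>L\<bar> + 1"
    by simp
  then have "y * L \<le> y * (\<bar>L\<bar> + 1)"
    using pos by (intro mult_left_mono) auto
  then have yL: "y * L \<le> x"
    by (simp add: y_def)
  have "AE \<omega> in M. \<forall>\<^sub>F n in sequentially. U n \<omega> \<le> x"
    using limit by (rule eventually_mono) (use pos in blast)
  then have "(\<lambda>n. prob {\<omega> \<in> space M. x < U n \<omega>}) \<longlonglongrightarrow> 0"
    by (rule tendsto_prob_greater_of_AE_eventually_le[OF U])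
  then have "\<forall>\<^sub>F n in sequentially. prob {\<omega> \<in> space M. x < U n \<omega>} < 4 * y * x"
    using pos by (intro order_tendstoD(2)) auto
  then show ?thesis
    using L2
  proof eventually_elim
    case (elim n)
    have "expectation (\<lambda>\<omega>. indicator A \<omega> * U n \<omega>)
      \<le> x + y * expectation (\<lambda>\<omega>. (U n \<omega>)\<^sup>2) + prob {\<omega> \<in> space M. x < U n \<omega>} / (4 * y)"
      using elim(2) by (intro expectation_indicator_le_add_square U A pos) auto
    also have "\<dots> \<le> x + y * L + x"
      using elim pos by (intro add_mono mult_left_mono) (auto simp: field_simps)
    also have "\<dots> \<le> e"
      using yL by (simp add: x_def)
    finally show ?case .
  qed
qed

end

section \<open>Processes with a Brownian part and a drift\<close>

locale brownian_drift_process = brownian_pair M F \<rho> B C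
  for M :: "'a measure" and F :: "real \<Rightarrow> 'a measure" and \<rho> and B C :: "real \<Rightarrow> 'a \<Rightarrow> real" +
  fixes c1 c2 :: "'b::euclidean_space" and V r :: "real \<Rightarrow> 'a \<Rightarrow> 'b"
  assumes V_adapted: "\<And>t. 0 \<le> t \<Longrightarrow> V t \<in> borel_measurable (F t)"
    and paths: "AE \<omega> in M. continuous_on {0..} (\<lambda>t. V t \<omega>) \<and>
      (\<forall>t\<ge>0. set_integrable lborel {0..t} (\<lambda>u. r u \<omega>) \<and>
        V t \<omega> = V 0 \<omega> + (B t \<omega> *\<^sub>R c1 + C t \<omega> *\<^sub>R c2) + (LINT u:{0..t}|lborel. r u \<omega>))"
begin

definition noise :: "real \<Rightarrow> 'a \<Rightarrow> 'b" where
  "noise t \<omega> = B t \<omega> *\<^sub>R c1 + C t \<omega> *\<^sub>R c2"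

definition noise_size :: real where
  "noise_size = (norm c1)\<^sup>2 + (norm c2)\<^sup>2"

lemma noise_diff: "noise t \<omega> - noise s \<omega> = incr 1 0 s t \<omega> *\<^sub>R c1 + incr 0 1 s t \<omega> *\<^sub>R c2"
  by (simp add: noise_def incr_def algebra_simps)

lemma noise_size_nonneg: "0 \<le> noise_size"
  by (simp add: noise_size_def)

lemma norm_noise_diff_square_le:
  "(norm (noise t \<omega> - noise s \<omega>))\<^sup>2 \<le> noise_size * ((incr 1 0 s t \<omega>)\<^sup>2 + (incr 0 1 s t \<omega>)\<^sup>2)"
proof -
  define b where "b = incr 1 0 s t \<omega>"
  define c where "c = incr 0 1 s t \<omega>"
  have "norm (noise t \<omega> - noise s \<omega>) \<le> norm c1 * \<bar>b\<bar> + norm c2 * \<bar>c\<bar>"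
    unfolding noise_diff b_def c_def by (rule order_trans[OF norm_triangle_ineq]) simp
  then have "(norm (noise t \<omega> - noise s \<omega>))\<^sup>2 \<le> (norm c1 * \<bar>b\<bar> + norm c2 * \<bar>c\<bar>)\<^sup>2"
    by (intro power_mono) auto
  also have "\<dots> \<le> (norm c1 * \<bar>b\<bar> + norm c2 * \<bar>c\<bar>)\<^sup>2 + (norm c1 * \<bar>c\<bar> - norm c2 * \<bar>b\<bar>)\<^sup>2"
    by simp
  also have "\<dots> = noise_size * (b\<^sup>2 + c\<^sup>2)"
    by (simp add: noise_size_def power2_sum power2_diff power_mult_distrib algebra_simps)
  finally show ?thesis
    by (simp add: b_def c_def)
qed

context
  fixes s t :: real
  assumes times: "0 \<le> s" "s < t"
begin

lemma measurable_noise_diff: "(\<lambda>\<omega>. noise t \<omega> - noise s \<omega>) \<in> borel_measurable (F t)"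
  unfolding noise_diff using times by (intro borel_measurable_add borel_measurable_scaleR measurable_incr) auto

lemma
  shows integrable_norm_noise_square: "integrable M (\<lambda>\<omega>. (norm (noise t \<omega> - noise s \<omega>))\<^sup>2)"
    and expectation_norm_noise_square_le:
      "expectation (\<lambda>\<omega>. (norm (noise t \<omega> - noise s \<omega>))\<^sup>2) \<le> 2 * noise_size * (t - s)"
    and integrable_norm_noise_fourth: "integrable M (\<lambda>\<omega>. norm (noise t \<omega> - noise s \<omega>) ^ 4)"
    and expectation_norm_noise_fourth_le:
      "expectation (\<lambda>\<omega>. norm (noise t \<omega> - noise s \<omega>) ^ 4) \<le> 12 * noise_size\<^sup>2 * (t - s)\<^sup>2"
proof -
  have [measurable]: "(\<lambda>\<omega>. noise t \<omega> - noise s \<omega>) \<in> borel_measurable M"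
    using times measurable_noise_diff by (intro measurable_filtration_imp_measurable[of t]) auto
  let ?b = "incr 1 0 s t" and ?c = "incr 0 1 s t"
  note moments = integrable_incr_power[OF times] expectation_incr_square[OF times] expectation_incr_fourth[OF times]
  show square: "integrable M (\<lambda>\<omega>. (norm (noise t \<omega> - noise s \<omega>))\<^sup>2)"
    by (rule Bochner_Integration.integrable_bound[where f="\<lambda>\<omega>. noise_size * ((?b \<omega>)\<^sup>2 + (?c \<omega>)\<^sup>2)"])
      (use moments norm_noise_diff_square_le noise_size_nonneg in auto)
  have "expectation (\<lambda>\<omega>. (norm (noise t \<omega> - noise s \<omega>))\<^sup>2) \<le> expectation (\<lambda>\<omega>. noise_size * ((?b \<omega>)\<^sup>2 + (?c \<omega>)\<^sup>2))"
    using square moments by (intro integral_mono norm_noise_diff_square_le) auto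
  then show "expectation (\<lambda>\<omega>. (norm (noise t \<omega> - noise s \<omega>))\<^sup>2) \<le> 2 * noise_size * (t - s)"
    using moments by (simp add: cov_trace_real algebra_simps)
  have fourth_le: "norm (noise t \<omega> - noise s \<omega>) ^ 4 \<le> noise_size\<^sup>2 * (2 * (?b \<omega> ^ 4 + ?c \<omega> ^ 4))" for \<omega>
  proof -
    have "norm (noise t \<omega> - noise s \<omega>) ^ 4 = ((norm (noise t \<omega> - noise s \<omega>))\<^sup>2)\<^sup>2"
      by simp
    also have "\<dots> \<le> (noise_size * ((?b \<omega>)\<^sup>2 + (?c \<omega>)\<^sup>2))\<^sup>2"
      by (intro power_mono norm_noise_diff_square_le) auto
    also have "\<dots> \<le> noise_size\<^sup>2 * (2 * (?b \<omega> ^ 4 + ?c \<omega> ^ 4))"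
      unfolding power_mult_distrib using sum_squares_bound[of "(?b \<omega>)\<^sup>2" "(?c \<omega>)\<^sup>2"]
      by (intro mult_left_mono) (auto simp: power2_sum)
    finally show ?thesis .
  qed
  show fourth: "integrable M (\<lambda>\<omega>. norm (noise t \<omega> - noise s \<omega>) ^ 4)"
    by (rule Bochner_Integration.integrable_bound[where f="\<lambda>\<omega>. noise_size\<^sup>2 * (2 * (?b \<omega> ^ 4 + ?c \<omega> ^ 4))"])
      (use moments fourth_le in auto)
  have "expectation (\<lambda>\<omega>. norm (noise t \<omega> - noise s \<omega>) ^ 4)
    \<le> expectation (\<lambda>\<omega>. noise_size\<^sup>2 * (2 * (?b \<omega> ^ 4 + ?c \<omega> ^ 4)))"
    using fourth moments by (intro integral_mono fourth_le) auto
  then show "expectation (\<lambda>\<omega>. norm (noise t \<omega> - noise s \<omega>) ^ 4) \<le> 12 * noise_size\<^sup>2 * (t - s)\<^sup>2"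
    using moments by (simp add: cov_trace_real)
qed

lemma
  shows integrable_norm_noise_cube: "integrable M (\<lambda>\<omega>. norm (noise t \<omega> - noise s \<omega>) ^ 3)"
    and expectation_norm_noise_cube_le: "expectation (\<lambda>\<omega>. norm (noise t \<omega> - noise s \<omega>) ^ 3)
      \<le> (noise_size + 6 * noise_size\<^sup>2) * (t - s) * sqrt (t - s)"
proof -
  have [measurable]: "(\<lambda>\<omega>. noise t \<omega> - noise s \<omega>) \<in> borel_measurable M"
    using times measurable_noise_diff by (intro measurable_filtration_imp_measurable[of t]) auto
  define z where "z = (\<lambda>\<omega>. norm (noise t \<omega> - noise s \<omega>))"
  define h where "h = sqrt (t - s)"
  have h: "0 < h" "h\<^sup>2 = t - s"
    using times by (auto simp: h_def)
  have cube_le: "x ^ 3 \<le> (h * x\<^sup>2 + x ^ 4 / h) / 2" for x :: real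
  proof -
    have "0 \<le> x\<^sup>2 * (x - h)\<^sup>2 / h"
      using h by simp
    also have "\<dots> = h * x\<^sup>2 + x ^ 4 / h - 2 * x ^ 3"
      using h by (simp add: field_simps eval_nat_numeral)
    finally show ?thesis
      by simp
  qed
  have dominating: "integrable M (\<lambda>\<omega>. (h * (z \<omega>)\<^sup>2 + z \<omega> ^ 4 / h) / 2)"
    using integrable_norm_noise_square integrable_norm_noise_fourth by (simp add: z_def)
  show cube: "integrable M (\<lambda>\<omega>. norm (noise t \<omega> - noise s \<omega>) ^ 3)"
    by (rule Bochner_Integration.integrable_bound[OF dominating]) (use cube_le h in \<open>auto simp: z_def\<close>)
  have "expectation (\<lambda>\<omega>. z \<omega> ^ 3) \<le> expectation (\<lambda>\<omega>. (h * (z \<omega>)\<^sup>2 + z \<omega> ^ 4 / h) / 2)"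
    using cube dominating by (intro integral_mono cube_le) (auto simp: z_def)
  also have "\<dots> = (h * expectation (\<lambda>\<omega>. (z \<omega>)\<^sup>2) + expectation (\<lambda>\<omega>. z \<omega> ^ 4) / h) / 2"
    using integrable_norm_noise_square integrable_norm_noise_fourth by (simp add: z_def)
  also have "\<dots> \<le> (h * (2 * noise_size * h\<^sup>2) + 12 * noise_size\<^sup>2 * (h\<^sup>2)\<^sup>2 / h) / 2"
    unfolding h(2) using h(1) expectation_norm_noise_square_le expectation_norm_noise_fourth_le
    by (intro divide_right_mono add_mono mult_left_mono) (auto simp: z_def)
  also have "\<dots> = (noise_size + 6 * noise_size\<^sup>2) * h\<^sup>2 * h"
    using h(1) by (simp add: field_simps eval_nat_numeral)
  finally show "expectation (\<lambda>\<omega>. norm (noise t \<omega> - noise s \<omega>) ^ 3)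
      \<le> (noise_size + 6 * noise_size\<^sup>2) * (t - s) * sqrt (t - s)"
    by (simp add: z_def h(2)) (simp add: h_def)
qed

end

end

section \<open>The supermartingale inequality\<close>

locale brownian_drift_test = brownian_drift_process M F \<rho> B C c1 c2 V r + bounded_C3 f D1 D2 D3 K
  for M :: "'a measure" and F :: "real \<Rightarrow> 'a measure" and \<rho> and B C :: "real \<Rightarrow> 'a \<Rightarrow> real"
    and c1 c2 :: "'b::euclidean_space" and V r :: "real \<Rightarrow> 'a \<Rightarrow> 'b"
    and f :: "'b \<Rightarrow> real" and D1 D2 D3 K +
  fixes \<theta> k :: real
  assumes generator: "AE \<omega> in M. AE u in lborel. 0 \<le> u \<longrightarrow>
      D1 (V u \<omega>) (r u \<omega>) + cov_trace \<rho> c1 c2 (D2 (V u \<omega>)) / 2 \<le> \<theta>"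
    and f_bounded: "\<And>v. \<bar>f v\<bar> \<le> k"
begin

definition half_trace :: "'b \<Rightarrow> real" where
  "half_trace v = cov_trace \<rho> c1 c2 (D2 v) / 2"

lemma continuous_on_half_trace: "continuous_on UNIV half_trace"
  unfolding half_trace_def cov_trace_def by (intro continuous_intros continuous_on_D2) simp

lemma [measurable]:
  shows measurable_f: "f \<in> borel_measurable borel"
    and measurable_D1: "(\<lambda>v. D1 v a) \<in> borel_measurable borel"
    and measurable_D2: "(\<lambda>v. D2 v a b) \<in> borel_measurable borel"
    and measurable_half_trace: "half_trace \<in> borel_measurable borel"
  by (intro borel_measurable_continuous_onI continuous_on_f continuous_on_D1 continuous_on_D2
      continuous_on_half_trace)+

lemma half_trace_bounded: "\<bar>half_trace v\<bar> \<le> K * noise_size"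
proof -
  have "\<bar>\<rho> * (D2 v c1 c2 + D2 v c2 c1)\<bar> \<le> 1 * (2 * (K * norm c1 * norm c2))"
    unfolding abs_mult using correlation D2_bound[of v c1 c2] D2_bound[of v c2 c1]
    by (intro mult_mono) (auto simp: ac_simps)
  also have "\<dots> \<le> K * noise_size"
    using mult_left_mono[OF sum_squares_bound[of "norm c1" "norm c2"] K_nonneg] by (simp add: noise_size_def ac_simps)
  finally show ?thesis
    using D2_bound[of v c1 c1] D2_bound[of v c2 c2]
    unfolding half_trace_def cov_trace_def by (simp add: noise_size_def power2_eq_square distrib_left mult.assoc)
qed

lemma V_measurable: "0 \<le> t \<Longrightarrow> V t \<in> borel_measurable M"
  using V_adapted by (rule measurable_filtration_imp_measurable[rotated])

lemma D1_noise: "D1 v (noise q \<omega> - noise p \<omega>) = D1 v c1 * incr 1 0 p q \<omega> + D1 v c2 * incr 0 1 p q \<omega>"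
  unfolding noise_diff by (simp add: linear_add[OF linear_D1] linear_scale[OF linear_D1])

lemma D2_noise: "D2 v (noise q \<omega> - noise p \<omega>) (noise q \<omega> - noise p \<omega>)
  = D2 v c1 c1 * (incr 1 0 p q \<omega>)\<^sup>2 + D2 v c2 c2 * (incr 0 1 p q \<omega>)\<^sup>2
    + (D2 v c1 c2 + D2 v c2 c1) * (incr 1 0 p q \<omega> * incr 0 1 p q \<omega>)"
  unfolding noise_diff
  by (simp add: linear_add[OF linear_D2_left] linear_scale[OF linear_D2_left]
      linear_add[OF linear_D2_right] linear_scale[OF linear_D2_right] power2_eq_square algebra_simps)

context
  fixes p q :: real
  assumes times: "0 \<le> p" "p < q"
begin

lemma measurable_indicator_compose_V:
  assumes [measurable]: "g \<in> borel_measurable borel" "A \<in> sets (F p)"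
  shows "(\<lambda>\<omega>. indicator A \<omega> * g (V p \<omega>) :: real) \<in> borel_measurable (F p)"
proof -
  note [measurable] = V_adapted[OF times(1)]
  show ?thesis
    by measurable
qed

lemma
  assumes A: "A \<in> sets (F p)"
  shows integrable_indicator_D1_noise: "integrable M (\<lambda>\<omega>. indicator A \<omega> * D1 (V p \<omega>) (noise q \<omega> - noise p \<omega>))"
    and expectation_indicator_D1_noise:
      "expectation (\<lambda>\<omega>. indicator A \<omega> * D1 (V p \<omega>) (noise q \<omega> - noise p \<omega>)) = 0"
proof -
  have bound: "\<bar>indicator A \<omega> * D1 (V p \<omega>) a\<bar> \<le> K * norm a" for \<omega> a
    using D1_bound[of "V p \<omega>" a] by (auto simp: indicator_def intro: order_trans[OF abs_ge_zero])
  note D1_measurable = measurable_indicator_compose_V[OF measurable_D1 A]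
  have split: "indicator A \<omega> * D1 (V p \<omega>) (noise q \<omega> - noise p \<omega>)
    = indicator A \<omega> * D1 (V p \<omega>) c1 * incr 1 0 p q \<omega> + indicator A \<omega> * D1 (V p \<omega>) c2 * incr 0 1 p q \<omega>" for \<omega>
    by (simp add: D1_noise distrib_left mult.assoc)
  note integrable = integrable_mult_incr[OF times D1_measurable bound]
  show "integrable M (\<lambda>\<omega>. indicator A \<omega> * D1 (V p \<omega>) (noise q \<omega> - noise p \<omega>))"
    unfolding split by (intro Bochner_Integration.integrable_add integrable)
  show "expectation (\<lambda>\<omega>. indicator A \<omega> * D1 (V p \<omega>) (noise q \<omega> - noise p \<omega>)) = 0"
    unfolding split Bochner_Integration.integral_add[OF integrable integrable]
    by (simp add: expectation_mult_incr[OF times D1_measurable bound])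
qed

lemma
  assumes A: "A \<in> sets (F p)"
  shows integrable_indicator_D2_noise:
      "integrable M (\<lambda>\<omega>. indicator A \<omega> * D2 (V p \<omega>) (noise q \<omega> - noise p \<omega>) (noise q \<omega> - noise p \<omega>))"
    and expectation_indicator_D2_noise:
      "expectation (\<lambda>\<omega>. indicator A \<omega> * D2 (V p \<omega>) (noise q \<omega> - noise p \<omega>) (noise q \<omega> - noise p \<omega>))
        = 2 * (q - p) * expectation (\<lambda>\<omega>. indicator A \<omega> * half_trace (V p \<omega>))"
proof -
  define G where "G = (\<lambda>a b \<omega>. indicator A \<omega> * D2 (V p \<omega>) a b)"
  have bound: "\<bar>G a b \<omega>\<bar> \<le> K * norm a * norm b" for \<omega> a b
    using D2_bound[of "V p \<omega>" a b] by (auto simp: G_def indicator_def intro: order_trans[OF abs_ge_zero])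
  have measurable: "G a b \<in> borel_measurable (F p)" for a b
    unfolding G_def by (rule measurable_indicator_compose_V[OF measurable_D2 A])
  have G: "integrable M (G a b)" for a b
    using bound measurable_filtration_imp_measurable[OF times(1) measurable]
    by (intro integrable_const_bound[where B="K * norm a * norm b"]) auto
  have split: "indicator A \<omega> * D2 (V p \<omega>) (noise q \<omega> - noise p \<omega>) (noise q \<omega> - noise p \<omega>)
    = G c1 c1 \<omega> * (incr 1 0 p q \<omega>)\<^sup>2 + G c2 c2 \<omega> * (incr 0 1 p q \<omega>)\<^sup>2
      + (G c1 c2 \<omega> * (incr 1 0 p q \<omega> * incr 0 1 p q \<omega>) + G c2 c1 \<omega> * (incr 1 0 p q \<omega> * incr 0 1 p q \<omega>))" for \<omega>
    by (simp add: D2_noise G_def algebra_simps)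
  note integrable = integrable_mult_incr_power[OF times measurable bound, of _ _ _ _ 2]
    integrable_mult_incr_product[OF times measurable bound]
  show "integrable M (\<lambda>\<omega>. indicator A \<omega> * D2 (V p \<omega>) (noise q \<omega> - noise p \<omega>) (noise q \<omega> - noise p \<omega>))"
    unfolding split by (intro Bochner_Integration.integrable_add integrable)
  have trace: "(\<lambda>\<omega>. indicator A \<omega> * half_trace (V p \<omega>))
    = (\<lambda>\<omega>. (G c1 c1 \<omega> + \<rho> * (G c1 c2 \<omega> + G c2 c1 \<omega>) + G c2 c2 \<omega>) / 2)"
    by (auto simp: half_trace_def cov_trace_def G_def algebra_simps)
  show "expectation (\<lambda>\<omega>. indicator A \<omega> * D2 (V p \<omega>) (noise q \<omega> - noise p \<omega>) (noise q \<omega> - noise p \<omega>))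
    = 2 * (q - p) * expectation (\<lambda>\<omega>. indicator A \<omega> * half_trace (V p \<omega>))"
    unfolding split trace using integrable G
    by (simp add: expectation_mult_incr_square[OF times measurable bound] cov_trace_real
        expectation_mult_incr_product[OF times measurable bound] field_simps)
qed

lemma measurable_f_noise: "(\<lambda>\<omega>. f (V p \<omega> + (noise q \<omega> - noise p \<omega>))) \<in> borel_measurable M"
proof -
  have [measurable]: "(\<lambda>\<omega>. noise q \<omega> - noise p \<omega>) \<in> borel_measurable M" "V p \<in> borel_measurable M"
    using times by (auto intro!: measurable_filtration_imp_measurable[OF _ measurable_noise_diff] V_measurable)
  show ?thesis
    by measurable
qed

lemma noise_step_le:
  assumes A: "A \<in> sets (F p)"
  shows "expectation (\<lambda>\<omega>. indicator A \<omega> * (f (V p \<omega> + (noise q \<omega> - noise p \<omega>)) - f (V p \<omega>)))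
    \<le> (q - p) * expectation (\<lambda>\<omega>. indicator A \<omega> * half_trace (V p \<omega>))
      + K * (noise_size + 6 * noise_size\<^sup>2) * (q - p) * sqrt (q - p)"
proof -
  define x where "x = (\<lambda>\<omega>. noise q \<omega> - noise p \<omega>)"
  define taylor where "taylor = (\<lambda>\<omega>. indicator A \<omega> * D1 (V p \<omega>) (x \<omega>) + indicator A \<omega> * D2 (V p \<omega>) (x \<omega>) (x \<omega>) / 2)"
  note first_order = integrable_indicator_D1_noise[OF A, folded x_def] expectation_indicator_D1_noise[OF A, folded x_def]
  note second_order = integrable_indicator_D2_noise[OF A, folded x_def] expectation_indicator_D2_noise[OF A, folded x_def]
  note third_order = integrable_norm_noise_cube[OF times, folded x_def] expectation_norm_noise_cube_le[OF times, folded x_def]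
  have [measurable]: "A \<in> events" "V p \<in> borel_measurable M" "(\<lambda>\<omega>. f (V p \<omega> + x \<omega>)) \<in> borel_measurable M"
    using filtration_event[OF times(1) A] V_measurable[OF times(1)] measurable_f_noise by (auto simp: x_def)
  have "expectation (\<lambda>\<omega>. indicator A \<omega> * (f (V p \<omega> + x \<omega>) - f (V p \<omega>))) \<le> expectation (\<lambda>\<omega>. taylor \<omega> + K * norm (x \<omega>) ^ 3)"
  proof (rule integral_mono)
    show "integrable M (\<lambda>\<omega>. indicator A \<omega> * (f (V p \<omega> + x \<omega>) - f (V p \<omega>)))"
    proof (rule integrable_const_bound[where B="2 * k"])
      have "norm (indicator A \<omega> * (f (V p \<omega> + x \<omega>) - f (V p \<omega>))) \<le> 2 * k" for \<omega>
        using f_bounded[of "V p \<omega> + x \<omega>"] f_bounded[of "V p \<omega>"] by (auto simp: indicator_def)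
      then show "AE \<omega> in M. norm (indicator A \<omega> * (f (V p \<omega> + x \<omega>) - f (V p \<omega>))) \<le> 2 * k"
        by simp
    qed measurable
    show "integrable M (\<lambda>\<omega>. taylor \<omega> + K * norm (x \<omega>) ^ 3)"
      using first_order(1) second_order(1) third_order(1) by (simp add: taylor_def x_def)
    show "indicator A \<omega> * (f (V p \<omega> + x \<omega>) - f (V p \<omega>)) \<le> taylor \<omega> + K * norm (x \<omega>) ^ 3" for \<omega>
      using taylor3[of "V p \<omega>" "x \<omega>"] K_nonneg by (cases "\<omega> \<in> A") (auto simp: taylor_def)
  qed
  also have "\<dots> = (q - p) * expectation (\<lambda>\<omega>. indicator A \<omega> * half_trace (V p \<omega>)) + K * expectation (\<lambda>\<omega>. norm (x \<omega>) ^ 3)"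
    using first_order second_order third_order(1) by (simp add: taylor_def x_def)
  also have "\<dots> \<le> (q - p) * expectation (\<lambda>\<omega>. indicator A \<omega> * half_trace (V p \<omega>))
      + K * ((noise_size + 6 * noise_size\<^sup>2) * (q - p) * sqrt (q - p))"
    using third_order(2) K_nonneg by (intro add_left_mono mult_left_mono) (auto simp: x_def)
  finally show ?thesis
    by (simp add: x_def mult.assoc)
qed

lemma measurable_D1_noise: "(\<lambda>\<omega>. D1 (V p \<omega>) (noise q \<omega> - noise p \<omega>)) \<in> borel_measurable (F q)"
proof -
  have [measurable]: "V p \<in> borel_measurable (F q)" "incr u v p q \<in> borel_measurable (F q)" for u v
    using times by (auto intro!: measurable_filtration_mono[OF _ _ V_adapted] measurable_incr)
  show ?thesis
    unfolding D1_noise by measurable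
qed

lemma
  shows integrable_D1_noise_square: "integrable M (\<lambda>\<omega>. (D1 (V p \<omega>) (noise q \<omega> - noise p \<omega>))\<^sup>2)"
    and expectation_D1_noise_square_le:
      "expectation (\<lambda>\<omega>. (D1 (V p \<omega>) (noise q \<omega> - noise p \<omega>))\<^sup>2) \<le> 2 * K\<^sup>2 * noise_size * (q - p)"
proof -
  have [measurable]: "(\<lambda>\<omega>. D1 (V p \<omega>) (noise q \<omega> - noise p \<omega>)) \<in> borel_measurable M"
    using times by (intro measurable_filtration_imp_measurable[OF _ measurable_D1_noise]) auto
  have square_le: "(D1 v x)\<^sup>2 \<le> K\<^sup>2 * (norm x)\<^sup>2" for v x
    using power_mono[OF D1_bound[of v x] abs_ge_zero, of 2] by (simp add: power_mult_distrib)
  note norm_square = integrable_norm_noise_square[OF times] expectation_norm_noise_square_le[OF times]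
  show square: "integrable M (\<lambda>\<omega>. (D1 (V p \<omega>) (noise q \<omega> - noise p \<omega>))\<^sup>2)"
    by (rule Bochner_Integration.integrable_bound[where f="\<lambda>\<omega>. K\<^sup>2 * (norm (noise q \<omega> - noise p \<omega>))\<^sup>2"])
      (use norm_square(1) square_le in auto)
  have "expectation (\<lambda>\<omega>. (D1 (V p \<omega>) (noise q \<omega> - noise p \<omega>))\<^sup>2)
    \<le> expectation (\<lambda>\<omega>. K\<^sup>2 * (norm (noise q \<omega> - noise p \<omega>))\<^sup>2)"
    using square norm_square(1) by (intro integral_mono square_le) auto
  also have "\<dots> \<le> K\<^sup>2 * (2 * noise_size * (q - p))"
    using norm_square by (simp add: mult_left_mono)
  finally show "expectation (\<lambda>\<omega>. (D1 (V p \<omega>) (noise q \<omega> - noise p \<omega>))\<^sup>2) \<le> 2 * K\<^sup>2 * noise_size * (q - p)"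
    by (simp add: ac_simps)
qed

end

definition grid_noise :: "real \<Rightarrow> real \<Rightarrow> nat \<Rightarrow> nat \<Rightarrow> 'a \<Rightarrow> 'b" where
  "grid_noise s t n i \<omega> = noise (uniform_grid s t n (Suc i)) \<omega> - noise (uniform_grid s t n i) \<omega>"

abbreviation path_drift_sum :: "real \<Rightarrow> real \<Rightarrow> nat \<Rightarrow> 'a \<Rightarrow> real" where
  "path_drift_sum s t n \<omega> \<equiv> drift_sum f half_trace (\<lambda>u. V u \<omega>) (\<lambda>u. noise u \<omega>) s t n"

abbreviation D1_grid_noise :: "real \<Rightarrow> real \<Rightarrow> nat \<Rightarrow> nat \<Rightarrow> 'a \<Rightarrow> real" where
  "D1_grid_noise s t n i \<omega> \<equiv> D1 (V (uniform_grid s t n i) \<omega>) (grid_noise s t n i \<omega>)"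

lemma path_drift_sum_eq: "path_drift_sum s t n \<omega>
  = (\<Sum>i<n. f (V (uniform_grid s t n (Suc i)) \<omega>) - f (V (uniform_grid s t n i) \<omega> + grid_noise s t n i \<omega>)
      + (t - s) / real n * half_trace (V (uniform_grid s t n i) \<omega>))"
  by (simp add: drift_sum_def Let_def grid_noise_def)

context
  fixes s t :: real and n :: nat
  assumes times: "0 \<le> s" "s < t" and n: "0 < n"
begin

lemma grid_times: "0 \<le> uniform_grid s t n i" "uniform_grid s t n i < uniform_grid s t n (Suc i)"
  using times n uniform_grid_ge[of s t n i] uniform_grid_less_Suc[of s t n i] by auto

lemma measurable_V_grid: "V (uniform_grid s t n i) \<in> borel_measurable M"
  by (rule V_measurable[OF grid_times(1)])

lemma measurable_grid_noise: "grid_noise s t n i \<in> borel_measurable M"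
  unfolding grid_noise_def
  by (rule measurable_filtration_imp_measurable[OF grid_times(1) measurable_noise_diff[OF grid_times]])

lemma expectation_D1_grid_noise_mult:
  assumes "i < j"
  shows "expectation (\<lambda>\<omega>. D1_grid_noise s t n i \<omega> * D1_grid_noise s t n j \<omega>) = 0"
proof -
  have "uniform_grid s t n (Suc i) \<le> uniform_grid s t n j"
    using times assms by (intro uniform_grid_mono) auto
  then have D_i: "D1_grid_noise s t n i \<in> borel_measurable (F (uniform_grid s t n j))"
    unfolding grid_noise_def
    by (intro measurable_filtration_mono[OF _ _ measurable_D1_noise[OF grid_times]] grid_times)
  have D_measurable: "D1_grid_noise s t n i \<in> borel_measurable M" for i
    unfolding grid_noise_def
    by (rule measurable_filtration_imp_measurable[OF grid_times(1) measurable_D1_noise[OF grid_times]])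
  have D_square: "integrable M (\<lambda>\<omega>. (D1_grid_noise s t n i \<omega>)\<^sup>2)" for i
    unfolding grid_noise_def by (rule integrable_D1_noise_square[OF grid_times])
  have "expectation (\<lambda>\<omega>. D1_grid_noise s t n i \<omega> * D1_grid_noise s t n j \<omega>) = expectation (D1_grid_noise s t n i) * 0"
  proof (rule expectation_mult_eq_of_events[OF subalgebra_filtration[OF grid_times(1)] _ _ D_i])
    show "integrable M (D1_grid_noise s t n j)"
      by (rule square_integrable_imp_integrable[OF D_measurable D_square])
    show "expectation (\<lambda>\<omega>. indicator A \<omega> * D1_grid_noise s t n j \<omega>) = prob A * 0"
      if "A \<in> sets (F (uniform_grid s t n j))" for A
      using expectation_indicator_D1_noise[OF grid_times that] by (simp add: grid_noise_def)
    show "integrable M (\<lambda>\<omega>. D1_grid_noise s t n i \<omega> * D1_grid_noise s t n j \<omega>)"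
      by (intro integrable_mult_of_square_integrable D_measurable D_square)
  qed
  then show ?thesis
    by simp
qed

lemma
  shows integrable_sum_D1_grid_noise_square: "integrable M (\<lambda>\<omega>. (\<Sum>i<n. D1_grid_noise s t n i \<omega>)\<^sup>2)"
    and expectation_sum_D1_grid_noise_square_le:
      "expectation (\<lambda>\<omega>. (\<Sum>i<n. D1_grid_noise s t n i \<omega>)\<^sup>2) \<le> 2 * K\<^sup>2 * noise_size * (t - s)"
proof -
  have "D1_grid_noise s t n i \<in> borel_measurable M" "integrable M (\<lambda>\<omega>. (D1_grid_noise s t n i \<omega>)\<^sup>2)" for i
    unfolding grid_noise_def using integrable_D1_noise_square[OF grid_times]
    by (auto intro: measurable_filtration_imp_measurable[OF grid_times(1) measurable_D1_noise[OF grid_times]])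
  moreover have "expectation (\<lambda>\<omega>. D1_grid_noise s t n i \<omega> * D1_grid_noise s t n j \<omega>) = 0" if "i \<noteq> j" for i j
    using expectation_D1_grid_noise_mult[of i j] expectation_D1_grid_noise_mult[of j i] that
    by (cases i j rule: linorder_cases) (auto simp: mult.commute)
  ultimately have orthogonal: "integrable M (\<lambda>\<omega>. (\<Sum>i<n. D1_grid_noise s t n i \<omega>)\<^sup>2)"
    "expectation (\<lambda>\<omega>. (\<Sum>i<n. D1_grid_noise s t n i \<omega>)\<^sup>2) = (\<Sum>i<n. expectation (\<lambda>\<omega>. (D1_grid_noise s t n i \<omega>)\<^sup>2))"
    by (auto intro!: expectation_square_sum_orthogonal)
  show "integrable M (\<lambda>\<omega>. (\<Sum>i<n. D1_grid_noise s t n i \<omega>)\<^sup>2)"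
    by (fact orthogonal(1))
  have "(\<Sum>i<n. expectation (\<lambda>\<omega>. (D1_grid_noise s t n i \<omega>)\<^sup>2)) \<le> (\<Sum>i<n. 2 * K\<^sup>2 * noise_size * ((t - s) / real n))"
  proof (rule sum_mono)
    show "expectation (\<lambda>\<omega>. (D1_grid_noise s t n i \<omega>)\<^sup>2) \<le> 2 * K\<^sup>2 * noise_size * ((t - s) / real n)" for i
      using expectation_D1_noise_square_le[OF grid_times[of i]] by (simp add: grid_noise_def uniform_grid_Suc)
  qed
  then show "expectation (\<lambda>\<omega>. (\<Sum>i<n. D1_grid_noise s t n i \<omega>)\<^sup>2) \<le> 2 * K\<^sup>2 * noise_size * (t - s)"
    using n by (simp add: orthogonal(2))
qed

lemma
  shows integrable_sum_grid_noise_square: "integrable M (\<lambda>\<omega>. (\<Sum>i<n. (norm (grid_noise s t n i \<omega>))\<^sup>2)\<^sup>2)"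
    and expectation_sum_grid_noise_square_le:
      "expectation (\<lambda>\<omega>. (\<Sum>i<n. (norm (grid_noise s t n i \<omega>))\<^sup>2)\<^sup>2) \<le> 12 * noise_size\<^sup>2 * (t - s)\<^sup>2"
proof -
  note [measurable] = measurable_grid_noise
  have fourth: "integrable M (\<lambda>\<omega>. norm (grid_noise s t n i \<omega>) ^ 4)"
    "expectation (\<lambda>\<omega>. norm (grid_noise s t n i \<omega>) ^ 4) \<le> 12 * noise_size\<^sup>2 * ((t - s) / real n)\<^sup>2" for i
    using integrable_norm_noise_fourth[OF grid_times[of i]] expectation_norm_noise_fourth_le[OF grid_times[of i]]
    by (simp_all add: grid_noise_def uniform_grid_Suc)
  have cauchy_schwarz: "(\<Sum>i<n. (norm (grid_noise s t n i \<omega>))\<^sup>2)\<^sup>2 \<le> real n * (\<Sum>i<n. norm (grid_noise s t n i \<omega>) ^ 4)" for \<omega>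
    using Cauchy_Schwarz_ineq_sum[of "\<lambda>i. (norm (grid_noise s t n i \<omega>))\<^sup>2" "\<lambda>_. 1" "{..<n}"] by (simp add: mult.commute)
  have dominating: "integrable M (\<lambda>\<omega>. real n * (\<Sum>i<n. norm (grid_noise s t n i \<omega>) ^ 4))"
    using fourth(1) by simp
  show square: "integrable M (\<lambda>\<omega>. (\<Sum>i<n. (norm (grid_noise s t n i \<omega>))\<^sup>2)\<^sup>2)"
    by (rule Bochner_Integration.integrable_bound[OF dominating]) (use cauchy_schwarz in \<open>auto simp: sum_nonneg\<close>)
  have "expectation (\<lambda>\<omega>. (\<Sum>i<n. (norm (grid_noise s t n i \<omega>))\<^sup>2)\<^sup>2)
    \<le> expectation (\<lambda>\<omega>. real n * (\<Sum>i<n. norm (grid_noise s t n i \<omega>) ^ 4))"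
    by (rule integral_mono[OF square dominating cauchy_schwarz])
  also have "\<dots> = real n * (\<Sum>i<n. expectation (\<lambda>\<omega>. norm (grid_noise s t n i \<omega>) ^ 4))"
    using fourth(1) by simp
  also have "\<dots> \<le> real n * (\<Sum>i<n. 12 * noise_size\<^sup>2 * ((t - s) / real n)\<^sup>2)"
    using fourth(2) by (intro mult_left_mono sum_mono) auto
  also have "\<dots> = 12 * noise_size\<^sup>2 * (t - s)\<^sup>2"
    using n by (simp add: power2_eq_square)
  finally show "expectation (\<lambda>\<omega>. (\<Sum>i<n. (norm (grid_noise s t n i \<omega>))\<^sup>2)\<^sup>2) \<le> 12 * noise_size\<^sup>2 * (t - s)\<^sup>2" .
qed

lemma measurable_f_grid_noise:
  "(\<lambda>\<omega>. f (V (uniform_grid s t n i) \<omega> + grid_noise s t n i \<omega>)) \<in> borel_measurable M"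
  unfolding grid_noise_def by (rule measurable_f_noise[OF grid_times])

lemma measurable_path_drift_sum: "path_drift_sum s t n \<in> borel_measurable M"
proof -
  note [measurable] = measurable_V_grid measurable_f_grid_noise
  show ?thesis
    unfolding path_drift_sum_eq by measurable
qed

lemma abs_path_drift_sum_le:
  "\<bar>path_drift_sum s t n \<omega>\<bar> \<le> (2 * k + K * noise_size * (t - s))
    + \<bar>\<Sum>i<n. D1_grid_noise s t n i \<omega>\<bar> + K * (\<Sum>i<n. (norm (grid_noise s t n i \<omega>))\<^sup>2)"
proof -
  define v where "v = (\<lambda>i. V (uniform_grid s t n i) \<omega>)"
  define x where "x = (\<lambda>i. grid_noise s t n i \<omega>)"
  define remainder where "remainder = (\<lambda>i. f (v i + x i) - f (v i) - D1 (v i) (x i))"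
  have "path_drift_sum s t n \<omega>
    = (\<Sum>i<n. (f (v (Suc i)) - f (v i)) + (t - s) / real n * half_trace (v i) - D1 (v i) (x i) - remainder i)"
    unfolding path_drift_sum_eq remainder_def v_def x_def by (intro sum.cong) auto
  also have "\<dots> = (f (v n) - f (v 0)) + (\<Sum>i<n. (t - s) / real n * half_trace (v i))
      - (\<Sum>i<n. D1 (v i) (x i)) - (\<Sum>i<n. remainder i)"
    using sum_lessThan_telescope[of "\<lambda>i. f (v i)" n] by (simp add: sum.distrib sum_subtractf)
  finally have "\<bar>path_drift_sum s t n \<omega>\<bar> \<le> (\<bar>f (v n)\<bar> + \<bar>f (v 0)\<bar>)
      + \<bar>\<Sum>i<n. (t - s) / real n * half_trace (v i)\<bar> + \<bar>\<Sum>i<n. D1 (v i) (x i)\<bar> + \<bar>\<Sum>i<n. remainder i\<bar>"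
    by linarith
  moreover have "\<bar>\<Sum>i<n. (t - s) / real n * half_trace (v i)\<bar> \<le> K * noise_size * (t - s)"
  proof -
    have "\<bar>\<Sum>i<n. (t - s) / real n * half_trace (v i)\<bar> \<le> (\<Sum>i<n. (t - s) / real n * (K * noise_size))"
      using times half_trace_bounded
      by (intro order_trans[OF sum_abs] sum_mono) (auto simp: abs_mult intro!: divide_right_mono mult_left_mono)
    then show ?thesis
      using n by (simp add: mult.commute)
  qed
  moreover have "\<bar>\<Sum>i<n. remainder i\<bar> \<le> K * (\<Sum>i<n. (norm (x i))\<^sup>2)"
    unfolding sum_distrib_left remainder_def by (intro order_trans[OF sum_abs] sum_mono taylor2)
  ultimately show ?thesis
    using f_bounded[of "v n"] f_bounded[of "v 0"] by (simp add: v_def x_def)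
qed

lemma path_drift_sum_diff_square_le:
  fixes z :: real
  defines "x \<equiv> 2 * k + K * noise_size * (t - s) + \<bar>z\<bar>"
  shows "(path_drift_sum s t n \<omega> - z)\<^sup>2
    \<le> 3 * (x\<^sup>2 + (\<Sum>i<n. D1_grid_noise s t n i \<omega>)\<^sup>2 + K\<^sup>2 * (\<Sum>i<n. (norm (grid_noise s t n i \<omega>))\<^sup>2)\<^sup>2)"
proof -
  define y where "y = \<bar>\<Sum>i<n. D1_grid_noise s t n i \<omega>\<bar>"
  define q where "q = K * (\<Sum>i<n. (norm (grid_noise s t n i \<omega>))\<^sup>2)"
  have "\<bar>path_drift_sum s t n \<omega> - z\<bar> \<le> x + y + q"
    using abs_path_drift_sum_le[of \<omega>] by (simp add: x_def y_def q_def)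
  then have "(path_drift_sum s t n \<omega> - z)\<^sup>2 \<le> (x + y + q)\<^sup>2"
    using power_mono[of "\<bar>path_drift_sum s t n \<omega> - z\<bar>" _ 2] by simp
  also have "\<dots> \<le> (x + y + q)\<^sup>2 + ((x - y)\<^sup>2 + (x - q)\<^sup>2 + (y - q)\<^sup>2)"
    by simp
  also have "\<dots> = 3 * (x\<^sup>2 + y\<^sup>2 + q\<^sup>2)"
    by (simp add: power2_eq_square algebra_simps)
  finally show ?thesis
    by (simp add: y_def q_def power_mult_distrib)
qed

lemma
  fixes z :: real
  defines "x \<equiv> 2 * k + K * noise_size * (t - s) + \<bar>z\<bar>"
  shows integrable_path_drift_sum_diff_square: "integrable M (\<lambda>\<omega>. (path_drift_sum s t n \<omega> - z)\<^sup>2)"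
    and expectation_path_drift_sum_diff_square_le: "expectation (\<lambda>\<omega>. (path_drift_sum s t n \<omega> - z)\<^sup>2)
      \<le> 3 * (x\<^sup>2 + 2 * K\<^sup>2 * noise_size * (t - s) + K\<^sup>2 * (12 * noise_size\<^sup>2 * (t - s)\<^sup>2))"
proof -
  let ?U = "\<lambda>\<omega>. path_drift_sum s t n \<omega> - z"
  let ?S = "\<lambda>\<omega>. \<Sum>i<n. D1_grid_noise s t n i \<omega>" and ?Q = "\<lambda>\<omega>. \<Sum>i<n. (norm (grid_noise s t n i \<omega>))\<^sup>2"
  have [measurable]: "?U \<in> borel_measurable M"
    using measurable_path_drift_sum by measurable
  note linear_part = integrable_sum_D1_grid_noise_square expectation_sum_D1_grid_noise_square_le
  note quadratic_part = integrable_sum_grid_noise_square expectation_sum_grid_noise_square_le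
  have dominating: "integrable M (\<lambda>\<omega>. 3 * (x\<^sup>2 + (?S \<omega>)\<^sup>2 + K\<^sup>2 * (?Q \<omega>)\<^sup>2))"
    using linear_part(1) quadratic_part(1) by simp
  show square: "integrable M (\<lambda>\<omega>. (?U \<omega>)\<^sup>2)"
  proof (rule Bochner_Integration.integrable_bound[OF dominating])
    show "AE \<omega> in M. norm ((?U \<omega>)\<^sup>2) \<le> norm (3 * (x\<^sup>2 + (?S \<omega>)\<^sup>2 + K\<^sup>2 * (?Q \<omega>)\<^sup>2))"
      using path_drift_sum_diff_square_le[of _ z, folded x_def]
      by (intro AE_I2) (simp only: real_norm_def abs_of_nonneg[OF zero_le_power2] order_trans[OF _ abs_ge_self])
  qed measurable
  have "expectation (\<lambda>\<omega>. (?U \<omega>)\<^sup>2) \<le> expectation (\<lambda>\<omega>. 3 * (x\<^sup>2 + (?S \<omega>)\<^sup>2 + K\<^sup>2 * (?Q \<omega>)\<^sup>2))"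
    unfolding x_def by (rule integral_mono[OF square dominating[unfolded x_def] path_drift_sum_diff_square_le])
  also have "\<dots> = 3 * (x\<^sup>2 + expectation (\<lambda>\<omega>. (?S \<omega>)\<^sup>2) + K\<^sup>2 * expectation (\<lambda>\<omega>. (?Q \<omega>)\<^sup>2))"
    using linear_part(1) quadratic_part(1) by (simp add: prob_space)
  also have "\<dots> \<le> 3 * (x\<^sup>2 + 2 * K\<^sup>2 * noise_size * (t - s) + K\<^sup>2 * (12 * noise_size\<^sup>2 * (t - s)\<^sup>2))"
    using linear_part(2) quadratic_part(2) by (intro mult_left_mono add_mono) auto
  finally show "expectation (\<lambda>\<omega>. (?U \<omega>)\<^sup>2)
    \<le> 3 * (x\<^sup>2 + 2 * K\<^sup>2 * noise_size * (t - s) + K\<^sup>2 * (12 * noise_size\<^sup>2 * (t - s)\<^sup>2))" .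
qed

context
  fixes A :: "'a set" and T :: "nat \<Rightarrow> real" and f_V f_noise trace :: "nat \<Rightarrow> real"
  assumes A: "A \<in> sets (F s)"
  defines "T \<equiv> uniform_grid s t n"
    and "f_V \<equiv> \<lambda>i. expectation (\<lambda>\<omega>. indicator A \<omega> * f (V (T i) \<omega>))"
    and "f_noise \<equiv> \<lambda>i. expectation (\<lambda>\<omega>. indicator A \<omega> * f (V (T i) \<omega> + grid_noise s t n i \<omega>))"
    and "trace \<equiv> \<lambda>i. expectation (\<lambda>\<omega>. indicator A \<omega> * half_trace (V (T i) \<omega>))"
begin

lemma
  shows integrable_indicator_f_V: "integrable M (\<lambda>\<omega>. indicator A \<omega> * f (V (T i) \<omega>))"
    and integrable_indicator_f_grid_noise: "integrable M (\<lambda>\<omega>. indicator A \<omega> * f (V (T i) \<omega> + grid_noise s t n i \<omega>))"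
    and integrable_indicator_half_trace: "integrable M (\<lambda>\<omega>. indicator A \<omega> * half_trace (V (T i) \<omega>))"
proof -
  have [measurable]: "A \<in> events" "V (T i) \<in> borel_measurable M"
    using filtration_event[OF times(1) A] measurable_V_grid by (auto simp: T_def)
  show "integrable M (\<lambda>\<omega>. indicator A \<omega> * f (V (T i) \<omega>))"
    "integrable M (\<lambda>\<omega>. indicator A \<omega> * f (V (T i) \<omega> + grid_noise s t n i \<omega>))"
    "integrable M (\<lambda>\<omega>. indicator A \<omega> * half_trace (V (T i) \<omega>))"
    using f_bounded half_trace_bounded measurable_f_grid_noise[folded T_def]
    by (auto intro!: integrable_indicator_mult_bounded)
qed

lemma expectation_indicator_path_drift_sum: "expectation (\<lambda>\<omega>. indicator A \<omega> * path_drift_sum s t n \<omega>)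
  = (\<Sum>i<n. f_V (Suc i) - f_noise i + (t - s) / real n * trace i)"
proof -
  have "indicator A \<omega> * path_drift_sum s t n \<omega> = (\<Sum>i<n. indicator A \<omega> * f (V (T (Suc i)) \<omega>)
      - indicator A \<omega> * f (V (T i) \<omega> + grid_noise s t n i \<omega>) + (t - s) / real n * (indicator A \<omega> * half_trace (V (T i) \<omega>)))" for \<omega>
    unfolding path_drift_sum_eq sum_distrib_left
    by (simp add: T_def distrib_left right_diff_distrib ac_simps)
  then show ?thesis
    using integrable_indicator_f_V integrable_indicator_f_grid_noise integrable_indicator_half_trace
    by (simp add: f_V_def f_noise_def trace_def)
qed

lemma grid_noise_step_le: "f_noise i - f_V i
  \<le> (t - s) / real n * trace i + K * (noise_size + 6 * noise_size\<^sup>2) * ((t - s) / real n) * sqrt ((t - s) / real n)"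
proof -
  have "A \<in> sets (F (T i))"
    using A sets_filtration_mono[OF times(1), of "T i"] uniform_grid_ge[of s t n i] times by (auto simp: T_def)
  from noise_step_le[OF grid_times[of i] this[unfolded T_def]] show ?thesis
    using integrable_indicator_f_V[of i] integrable_indicator_f_grid_noise[of i]
    by (simp add: f_noise_def f_V_def trace_def T_def grid_noise_def uniform_grid_Suc right_diff_distrib)
qed

lemma expectation_increment_le_path_drift_sum:
  "expectation (\<lambda>\<omega>. indicator A \<omega> * f (V t \<omega>)) - expectation (\<lambda>\<omega>. indicator A \<omega> * f (V s \<omega>))
    \<le> expectation (\<lambda>\<omega>. indicator A \<omega> * path_drift_sum s t n \<omega>)
      + K * (noise_size + 6 * noise_size\<^sup>2) * (t - s) * sqrt ((t - s) / real n)"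
proof -
  define h where "h = (t - s) / real n"
  have "f_V n - f_V 0 = (\<Sum>i<n. (f_V (Suc i) - f_noise i) + (f_noise i - f_V i))"
    using sum_lessThan_telescope[of f_V n] by simp
  also have "\<dots> \<le> (\<Sum>i<n. (f_V (Suc i) - f_noise i)
      + (h * trace i + K * (noise_size + 6 * noise_size\<^sup>2) * h * sqrt h))"
    unfolding h_def by (intro sum_mono add_left_mono grid_noise_step_le)
  also have "\<dots> = expectation (\<lambda>\<omega>. indicator A \<omega> * path_drift_sum s t n \<omega>)
      + real n * (K * (noise_size + 6 * noise_size\<^sup>2) * h * sqrt h)"
    by (simp add: expectation_indicator_path_drift_sum h_def sum.distrib)
  also have "real n * (K * (noise_size + 6 * noise_size\<^sup>2) * h * sqrt h)
      = K * (noise_size + 6 * noise_size\<^sup>2) * (t - s) * sqrt h"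
    using n by (simp add: h_def)
  finally show ?thesis
    by (simp add: f_V_def T_def h_def uniform_grid_0 uniform_grid_last[OF n])
qed

end

end

lemma AE_eventually_path_drift_sum_le:
  assumes "0 \<le> s" "s < t"
  shows "AE \<omega> in M. \<forall>e>0. \<forall>\<^sub>F n in sequentially.
    path_drift_sum s t n \<omega> \<le> \<theta> * (t - s) + e"
proof -
  have "AE \<omega> in M. continuous_on {0..} (\<lambda>u. B u \<omega>) \<and> continuous_on {0..} (\<lambda>u. C u \<omega>)"
    using brownian[unfolded corr_brownian_def, THEN conjunct2, THEN conjunct2, THEN conjunct1]
    by eventually_elim auto
  with paths generator show ?thesis
  proof eventually_elim
    case (elim \<omega>)
    have path: "V q \<omega> = V 0 \<omega> + noise q \<omega> + (LINT u:{0..q}|lborel. r u \<omega>)" if "0 \<le> q" for q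
      unfolding noise_def using elim(1) that by blast
    have r: "set_integrable lborel {0..q} (\<lambda>u. r u \<omega>)" if "0 \<le> q" for q
      using elim(1) that by blast
    have "continuous_on {0..} (\<lambda>u. noise u \<omega>)"
      unfolding noise_def using elim(3) by (intro continuous_intros) auto
    then have continuous: "continuous_on {s..t} (\<lambda>u. V u \<omega>)" "continuous_on {s..t} (\<lambda>u. noise u \<omega>)"
      using elim(1)[THEN conjunct1] \<open>0 \<le> s\<close> by (auto intro: continuous_on_subset)
    have increment: "V q \<omega> = V p \<omega> + (noise q \<omega> - noise p \<omega>) + (LINT u:{p..q}|lborel. r u \<omega>)"
      if "s \<le> p" "p \<le> q" for p q
      using path[of p] path[of q] set_lebesgue_integral_Icc_split[of 0 p q, OF _ _ r] that \<open>0 \<le> s\<close> by simp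
    have generator_path: "AE u in lborel. u \<in> {s..t} \<longrightarrow> D1 (V u \<omega>) (r u \<omega>) + half_trace (V u \<omega>) \<le> \<theta>"
      using elim(2) by eventually_elim (use \<open>0 \<le> s\<close> in \<open>auto simp: half_trace_def\<close>)
    have "set_integrable lborel {s..t} (\<lambda>u. r u \<omega>)"
      using assms by (intro set_integrable_subset[OF r[of t]]) auto
    from eventually_drift_sum_le[OF bounded_C3_axioms \<open>s < t\<close> this _ generator_path continuous_on_half_trace continuous]
    show ?case
      using increment by blast
  qed
qed

lemma eventually_expectation_path_drift_sum_le:
  assumes times: "0 \<le> s" "s < t" and A: "A \<in> events" and "0 < e"
  shows "\<forall>\<^sub>F n in sequentially.
    expectation (\<lambda>\<omega>. indicator A \<omega> * path_drift_sum s t n \<omega>)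
      \<le> \<theta> * (t - s) * prob A + e"
proof -
  define z where "z = \<theta> * (t - s)"
  define S where "S = path_drift_sum s t"
  have S_measurable: "S n \<in> borel_measurable M" for n
    unfolding S_def using measurable_path_drift_sum[OF times, of n] by (cases "n = 0") (simp_all add: drift_sum_def)
  obtain L where L: "integrable M (\<lambda>\<omega>. (S n \<omega> - z)\<^sup>2) \<and> expectation (\<lambda>\<omega>. (S n \<omega> - z)\<^sup>2) \<le> L" if "0 < n" for n
    unfolding S_def using integrable_path_drift_sum_diff_square[OF times, of _ z]
      expectation_path_drift_sum_diff_square_le[OF times, of _ z] by blast
  then have S_L2: "\<forall>\<^sub>F n in sequentially. integrable M (\<lambda>\<omega>. (S n \<omega> - z)\<^sup>2) \<and> expectation (\<lambda>\<omega>. (S n \<omega> - z)\<^sup>2) \<le> L"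
    by (rule eventually_mono[OF eventually_gt_at_top[of 0]])
  have S_le: "AE \<omega> in M. \<forall>e>0. \<forall>\<^sub>F n in sequentially. S n \<omega> - z \<le> e"
    using AE_eventually_path_drift_sum_le[OF times]
    by eventually_elim (simp add: S_def z_def diff_le_eq add.commute)
  have "\<forall>\<^sub>F n in sequentially. expectation (\<lambda>\<omega>. indicator A \<omega> * (S n \<omega> - z)) \<le> e"
    by (rule eventually_expectation_indicator_le_of_L2_bounded[OF borel_measurable_diff[OF S_measurable borel_measurable_const]
          A S_L2 S_le \<open>0 < e\<close>])
  with eventually_gt_at_top[of 0] show ?thesis
  proof eventually_elim
    case (elim n)
    have "integrable M (\<lambda>\<omega>. S n \<omega> - z)"
      by (rule square_integrable_imp_integrable[OF borel_measurable_diff[OF S_measurable borel_measurable_const]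
            L[OF elim(1), THEN conjunct1]])
    then have integrable: "integrable M (\<lambda>\<omega>. indicator A \<omega> * (S n \<omega> - z))" "integrable M (\<lambda>\<omega>. indicator A \<omega> * z)"
      by (intro integrable_indicator_mult[OF A]; simp)+
    have "expectation (\<lambda>\<omega>. indicator A \<omega> * S n \<omega>) = expectation (\<lambda>\<omega>. indicator A \<omega> * (S n \<omega> - z) + indicator A \<omega> * z)"
      by (intro Bochner_Integration.integral_cong) (simp_all add: algebra_simps)
    also have "\<dots> = expectation (\<lambda>\<omega>. indicator A \<omega> * (S n \<omega> - z)) + expectation (\<lambda>\<omega>. indicator A \<omega> * z)"
      by (rule Bochner_Integration.integral_add[OF integrable])
    also have "expectation (\<lambda>\<omega>. indicator A \<omega> * z) = z * prob A"
      using A by (simp add: sets.Int_space_eq2)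
    finally show ?case
      using elim(2) unfolding S_def z_def by linarith
  qed
qed

theorem supermartingale_inequality:
  assumes times: "0 \<le> s" "s < t" and A: "A \<in> sets (F s)"
  shows "expectation (\<lambda>\<omega>. indicator A \<omega> * f (V t \<omega>))
    \<le> expectation (\<lambda>\<omega>. indicator A \<omega> * f (V s \<omega>)) + \<theta> * (t - s) * prob A"
proof -
  define x where "x = K * (noise_size + 6 * noise_size\<^sup>2) * (t - s)"
  have "expectation (\<lambda>\<omega>. indicator A \<omega> * f (V t \<omega>)) - expectation (\<lambda>\<omega>. indicator A \<omega> * f (V s \<omega>))
    \<le> \<theta> * (t - s) * prob A + e" if "0 < e" for e
  proof -
    have "(\<lambda>n. x * sqrt ((t - s) * (1 / real n))) \<longlonglongrightarrow> x * sqrt ((t - s) * 0)"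
      by (intro tendsto_intros lim_1_over_n)
    then have "\<forall>\<^sub>F n in sequentially. x * sqrt ((t - s) / real n) < e / 2"
      using \<open>0 < e\<close> by (intro order_tendstoD(2)) auto
    moreover have "\<forall>\<^sub>F n in sequentially.
        expectation (\<lambda>\<omega>. indicator A \<omega> * path_drift_sum s t n \<omega>)
          \<le> \<theta> * (t - s) * prob A + e / 2"
      using \<open>0 < e\<close> by (intro eventually_expectation_path_drift_sum_le[OF times filtration_event[OF times(1) A]]) simp
    ultimately have "\<forall>\<^sub>F n in sequentially. expectation (\<lambda>\<omega>. indicator A \<omega> * f (V t \<omega>))
        - expectation (\<lambda>\<omega>. indicator A \<omega> * f (V s \<omega>)) \<le> \<theta> * (t - s) * prob A + e"
      using eventually_gt_at_top[of 0]
    proof eventually_elim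
      case (elim n)
      show ?case
        using expectation_increment_le_path_drift_sum[OF times elim(3) A] elim(1,2) unfolding x_def by linarith
    qed
    then show ?thesis
      by (simp add: eventually_const[OF sequentially_bot])
  qed
  then have "expectation (\<lambda>\<omega>. indicator A \<omega> * f (V t \<omega>)) - expectation (\<lambda>\<omega>. indicator A \<omega> * f (V s \<omega>))
    \<le> \<theta> * (t - s) * prob A"
    by (rule field_le_epsilon)
  then show ?thesis
    by simp
qed

end

section \<open>Maximal inequalities\<close>

lemma Icc_subset_UN_consecutive:
  fixes T :: "nat \<Rightarrow> 'a::linorder"
  assumes "0 < n"
  shows "{T 0..T n} \<subseteq> (\<Union>i<n. {T i..T (Suc i)})"
  using assms
proof (induction n rule: nat_induct_non_zero)
  case (Suc n)
  have "{T 0..T (Suc n)} \<subseteq> {T 0..T n} \<union> {T n..T (Suc n)}"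
    by auto
  with Suc show ?case
    by (fastforce simp: lessThan_Suc)
qed auto

lemma eventually_uniform_grid_ge:
  fixes z :: "real \<Rightarrow> real"
  assumes z: "continuous_on {s..t} z" and "s < t" and u: "u \<in> {s..t}" and "l < z u"
  shows "\<forall>\<^sub>F n in sequentially. \<exists>i\<le>n. l \<le> z (uniform_grid s t n i)"
proof -
  have "0 < z u - l"
    using \<open>l < z u\<close> by simp
  from eventually_grid_oscillation_le[OF z \<open>s < t\<close> this] eventually_gt_at_top[of 0] show ?thesis
  proof eventually_elim
    case (elim n)
    have "u \<in> {uniform_grid s t n 0..uniform_grid s t n n}"
      using u elim(2) by (simp add: uniform_grid_0 uniform_grid_last)
    then obtain i where "i < n" "u \<in> {uniform_grid s t n i..uniform_grid s t n (Suc i)}"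
      using Icc_subset_UN_consecutive[OF elim(2)] by blast
    with elim(1) have "dist (z u) (z (uniform_grid s t n i)) \<le> z u - l"
      unfolding grid_oscillation_le_def by blast
    then show ?case
      using \<open>i < n\<close> by (intro exI[of _ i]) (auto simp: dist_real_def)
  qed
qed

definition stays_below :: "'a set \<Rightarrow> (nat \<Rightarrow> 'a \<Rightarrow> real) \<Rightarrow> real \<Rightarrow> nat \<Rightarrow> 'a set" where
  "stays_below A S l i = {\<omega> \<in> A. \<forall>j<i. S j \<omega> < l}"

lemma stays_below_0: "stays_below A S l 0 = A"
  by (simp add: stays_below_def)

context prob_space
begin

lemma expectation_indicator_ge_split:
  fixes S :: "'a \<Rightarrow> real"
  assumes events: "E \<in> events" "N \<in> events" and "E \<subseteq> N" and S: "integrable M S"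
    and ge: "\<And>\<omega>. \<omega> \<in> N - E \<Longrightarrow> l \<le> S \<omega>"
  shows "expectation (\<lambda>\<omega>. indicator E \<omega> * S \<omega>) + l * prob (N - E) \<le> expectation (\<lambda>\<omega>. indicator N \<omega> * S \<omega>)"
proof -
  have inside: "integrable M (\<lambda>\<omega>. indicator E \<omega> * S \<omega>)"
    by (rule integrable_indicator_mult[OF events(1) S])
  have outside: "integrable M (\<lambda>\<omega>. l * indicator (N - E) \<omega>)"
    using events by (simp add: emeasure_eq_measure)
  have "expectation (\<lambda>\<omega>. indicator E \<omega> * S \<omega> + l * indicator (N - E) \<omega>) \<le> expectation (\<lambda>\<omega>. indicator N \<omega> * S \<omega>)"
  proof (rule integral_mono[OF Bochner_Integration.integrable_add[OF inside outside]
        integrable_indicator_mult[OF events(2) S]])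
    show "indicator E \<omega> * S \<omega> + l * indicator (N - E) \<omega> \<le> indicator N \<omega> * S \<omega>" for \<omega>
      using ge[of \<omega>] \<open>E \<subseteq> N\<close> by (auto simp: indicator_def)
  qed
  moreover have "expectation (\<lambda>\<omega>. l * indicator (N - E) \<omega>) = l * prob (N - E)"
    using events by (simp add: sets.Int_space_eq2 sets.Diff)
  moreover note Bochner_Integration.integral_add[OF inside outside]
  ultimately show ?thesis
    by linarith
qed

context
  fixes S :: "nat \<Rightarrow> 'a \<Rightarrow> real" and G :: "nat \<Rightarrow> 'a measure" and a :: "nat \<Rightarrow> real" and A :: "'a set" and l :: real
  assumes subalgebra: "\<And>i. subalgebra M (G i)" and mono: "\<And>i. sets (G i) \<subseteq> sets (G (Suc i))"
    and adapted: "\<And>i. S i \<in> borel_measurable (G i)" and integrable: "\<And>i. integrable M (S i)"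
    and increment_le: "\<And>i E. E \<in> sets (G i) \<Longrightarrow>
      expectation (\<lambda>\<omega>. indicator E \<omega> * S (Suc i) \<omega>) \<le> expectation (\<lambda>\<omega>. indicator E \<omega> * S i \<omega>) + a i"
    and A: "A \<in> sets (G 0)"
begin

lemma sets_stays_below:
  shows "stays_below A S l i \<in> sets (G i)" and "stays_below A S l (Suc i) \<in> sets (G i)"
proof -
  have Suc_eq: "stays_below A S l (Suc i) = stays_below A S l i \<inter> {\<omega> \<in> space (G i). S i \<omega> < l}"
    if "stays_below A S l i \<in> sets (G i)" for i
    using sets.sets_into_space[OF that] by (auto simp: stays_below_def less_Suc_eq)
  have "stays_below A S l i \<in> sets (G i) \<and> stays_below A S l (Suc i) \<in> sets (G i)"
  proof (induction i)
    case 0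
    then show ?case
      using A adapted[of 0] by (simp add: Suc_eq stays_below_0)
  next
    case (Suc i)
    then have "stays_below A S l (Suc i) \<in> sets (G (Suc i))"
      using mono by blast
    then show ?case
      using adapted[of "Suc i"] by (simp add: Suc_eq)
  qed
  then show "stays_below A S l i \<in> sets (G i)" "stays_below A S l (Suc i) \<in> sets (G i)"
    by auto
qed

lemma stays_below_event: "stays_below A S l i \<in> events"
  using sets_stays_below(1)[of i] subalgebra[of i] by (auto simp: subalgebra_def)

lemma expectation_stays_below_le:
  "expectation (\<lambda>\<omega>. indicator (stays_below A S l (Suc n)) \<omega> * S n \<omega>) + l * prob (A - stays_below A S l (Suc n))
    \<le> expectation (\<lambda>\<omega>. indicator A \<omega> * S 0 \<omega>) + (\<Sum>i<n. a i)"
proof -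
  have exit_le: "expectation (\<lambda>\<omega>. indicator (stays_below A S l (Suc i)) \<omega> * S i \<omega>)
      + l * prob (stays_below A S l i - stays_below A S l (Suc i))
    \<le> expectation (\<lambda>\<omega>. indicator (stays_below A S l i) \<omega> * S i \<omega>)" for i
    by (rule expectation_indicator_ge_split[OF stays_below_event stays_below_event _ integrable])
      (auto simp: stays_below_def less_Suc_eq)
  show ?thesis
  proof (induction n)
    case 0
    show ?case
      using exit_le[of 0] by (simp add: stays_below_0)
  next
    case (Suc n)
    let ?N = "stays_below A S l"
    have "A - ?N (Suc (Suc n)) = (A - ?N (Suc n)) \<union> (?N (Suc n) - ?N (Suc (Suc n)))"
      by (auto simp: stays_below_def)
    then have "prob (A - ?N (Suc (Suc n))) = prob (A - ?N (Suc n)) + prob (?N (Suc n) - ?N (Suc (Suc n)))"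
      using stays_below_event[of 0] stays_below_event by (subst finite_measure_Union[symmetric]) (auto simp: stays_below_0)
    then show ?case
      using exit_le[of "Suc n"] increment_le[OF sets_stays_below(2)[of n]] Suc by (simp add: distrib_left)
  qed
qed

lemma maximal_inequality:
  assumes nonneg: "\<And>\<omega>. 0 \<le> S n \<omega>"
  shows "l * prob {\<omega> \<in> A. \<exists>i\<le>n. l \<le> S i \<omega>} \<le> expectation (\<lambda>\<omega>. indicator A \<omega> * S 0 \<omega>) + (\<Sum>i<n. a i)"
proof -
  have "0 \<le> expectation (\<lambda>\<omega>. indicator (stays_below A S l (Suc n)) \<omega> * S n \<omega>)"
    using nonneg by simp
  moreover have "A - stays_below A S l (Suc n) = {\<omega> \<in> A. \<exists>i\<le>n. l \<le> S i \<omega>}"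
    by (auto simp: stays_below_def not_less less_Suc_eq_le)
  ultimately show ?thesis
    using expectation_stays_below_le[of n] by simp
qed

end

lemma
  fixes E :: "nat \<Rightarrow> 'a set"
  assumes "\<And>n. E n \<in> events" and "\<And>n. prob (E n) \<le> x"
  shows eventually_in_event: "(\<Union>m. \<Inter>n\<in>{m..}. E n) \<in> events"
    and prob_eventually_in_le: "prob (\<Union>m. \<Inter>n\<in>{m..}. E n) \<le> x"
proof -
  have inter: "(\<Inter>n\<in>{m..}. E n) \<in> events" for m
    using assms(1) by (intro sets.countable_INT) auto
  then show "(\<Union>m. \<Inter>n\<in>{m..}. E n) \<in> events"
    by blast
  have "incseq (\<lambda>m. \<Inter>n\<in>{m..}. E n)"
    by (auto simp: incseq_def)
  then have "(\<lambda>m. prob (\<Inter>n\<in>{m..}. E n)) \<longlonglongrightarrow> prob (\<Union>m. \<Inter>n\<in>{m..}. E n)"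
    using inter by (intro finite_Lim_measure_incseq) auto
  moreover have "prob (\<Inter>n\<in>{m..}. E n) \<le> x" for m
    using finite_measure_mono[OF _ assms(1)[of m], of "\<Inter>n\<in>{m..}. E n"] assms(2)[of m] by force
  ultimately show "prob (\<Union>m. \<Inter>n\<in>{m..}. E n) \<le> x"
    by (intro LIMSEQ_le_const2) auto
qed

lemma AE_not_of_small_covers:
  assumes "\<And>e. 0 < e \<Longrightarrow> \<exists>H\<in>events. prob H \<le> e \<and> (AE \<omega> in M. P \<omega> \<longrightarrow> \<omega> \<in> H)"
  shows "AE \<omega> in M. \<not> P \<omega>"
proof -
  have "\<exists>H. H \<in> events \<and> prob H \<le> 1 / real (Suc j) \<and> (AE \<omega> in M. P \<omega> \<longrightarrow> \<omega> \<in> H)" for j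
    using assms[of "1 / real (Suc j)"] by auto
  then obtain H where H: "\<And>j. H j \<in> events" "\<And>j. prob (H j) \<le> 1 / real (Suc j)"
      "\<And>j. AE \<omega> in M. P \<omega> \<longrightarrow> \<omega> \<in> H j"
    by metis
  have "prob (\<Inter>j. H j) \<le> 1 / real (Suc j)" for j
    using finite_measure_mono[of "\<Inter>j. H j" "H j"] H(1,2)[of j] by (meson INF_lower UNIV_I order_trans)
  then have "prob (\<Inter>j. H j) \<le> 0"
    by (intro LIMSEQ_le_const[OF LIMSEQ_Suc[OF lim_1_over_n]]) auto
  then have "AE \<omega> in M. \<omega> \<notin> (\<Inter>j. H j)"
    using H(1) by (subst prob_eq_0[symmetric]) (auto intro: antisym)
  moreover have "AE \<omega> in M. \<forall>j. P \<omega> \<longrightarrow> \<omega> \<in> H j"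
    using H(3) unfolding AE_all_countable by blast
  ultimately show ?thesis
    by eventually_elim auto
qed

end

context filtered_prob_space
begin

context
  fixes Z :: "real \<Rightarrow> 'a \<Rightarrow> real" and \<theta> :: real
  assumes adapted: "\<And>u. 0 \<le> u \<Longrightarrow> Z u \<in> borel_measurable (F u)" and nonneg: "\<And>u \<omega>. 0 \<le> Z u \<omega>"
    and integrable: "\<And>u. 0 \<le> u \<Longrightarrow> integrable M (Z u)"
    and increment_le: "\<And>p q E. 0 \<le> p \<Longrightarrow> p < q \<Longrightarrow> E \<in> sets (F p) \<Longrightarrow>
      expectation (\<lambda>\<omega>. indicator E \<omega> * Z q \<omega>) \<le> expectation (\<lambda>\<omega>. indicator E \<omega> * Z p \<omega>) + \<theta> * (q - p)"
begin

lemma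
  assumes times: "0 \<le> s" "s < t" and A: "A \<in> sets (F s)" and "0 < n"
  shows grid_exceedance_event: "{\<omega> \<in> A. \<exists>i\<le>n. l \<le> Z (uniform_grid s t n i) \<omega>} \<in> events"
    and grid_maximal_inequality: "l * prob {\<omega> \<in> A. \<exists>i\<le>n. l \<le> Z (uniform_grid s t n i) \<omega>}
      \<le> expectation (\<lambda>\<omega>. indicator A \<omega> * Z s \<omega>) + \<theta> * (t - s)"
proof -
  define T where "T = uniform_grid s t n"
  have T: "0 \<le> T i" "T i < T (Suc i)" for i
    using times \<open>0 < n\<close> uniform_grid_ge[of s t n i] uniform_grid_less_Suc[of s t n i] by (auto simp: T_def)
  have T_0: "T 0 = s" and T_step: "T (Suc i) - T i = (t - s) / real n" for i
    by (simp_all add: T_def uniform_grid_0 uniform_grid_Suc)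
  have A_event: "A \<in> events"
    using filtration_event[OF times(1) A] .
  have [measurable]: "Z (T i) \<in> borel_measurable M" for i
    using integrable[OF T(1)] by (rule borel_measurable_integrable)
  have "{\<omega> \<in> A. \<exists>i\<le>n. l \<le> Z (T i) \<omega>} = A \<inter> (\<Union>i\<le>n. {\<omega> \<in> space M. l \<le> Z (T i) \<omega>})"
    using sets.sets_into_space[OF A_event] by auto
  also have "\<dots> \<in> events"
    using A_event by (intro sets.Int sets.finite_UN) auto
  finally show "{\<omega> \<in> A. \<exists>i\<le>n. l \<le> Z (uniform_grid s t n i) \<omega>} \<in> events"
    unfolding T_def .
  have "l * prob {\<omega> \<in> A. \<exists>i\<le>n. l \<le> Z (T i) \<omega>}
    \<le> expectation (\<lambda>\<omega>. indicator A \<omega> * Z (T 0) \<omega>) + (\<Sum>i<n. \<theta> * ((t - s) / real n))"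
  proof (rule maximal_inequality[where G="\<lambda>i. F (T i)"])
    show "sets (F (T i)) \<subseteq> sets (F (T (Suc i)))" for i
      using T by (intro sets_filtration_mono) (auto intro: less_imp_le)
    show "expectation (\<lambda>\<omega>. indicator E \<omega> * Z (T (Suc i)) \<omega>)
      \<le> expectation (\<lambda>\<omega>. indicator E \<omega> * Z (T i) \<omega>) + \<theta> * ((t - s) / real n)"
      if "E \<in> sets (F (T i))" for i E
      using increment_le[OF T that] unfolding T_step .
  qed (use T(1) T_0 A in \<open>auto intro: subalgebra_filtration adapted nonneg integrable\<close>)
  then show "l * prob {\<omega> \<in> A. \<exists>i\<le>n. l \<le> Z (uniform_grid s t n i) \<omega>}
      \<le> expectation (\<lambda>\<omega>. indicator A \<omega> * Z s \<omega>) + \<theta> * (t - s)"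
    using \<open>0 < n\<close> unfolding T_0 by (simp add: T_def)
qed

lemma continuous_maximal_inequality:
  assumes times: "0 \<le> s" "s < t" and A: "A \<in> sets (F s)" and "0 < l"
    and continuous: "AE \<omega> in M. continuous_on {s..t} (\<lambda>u. Z u \<omega>)"
  obtains H where "H \<in> events" "l * prob H \<le> expectation (\<lambda>\<omega>. indicator A \<omega> * Z s \<omega>) + \<theta> * (t - s)"
    "AE \<omega> in M. \<omega> \<in> A \<and> (\<exists>u\<in>{s..t}. l < Z u \<omega>) \<longrightarrow> \<omega> \<in> H"
proof -
  define E where "E = (\<lambda>n. {\<omega> \<in> A. \<exists>i\<le>Suc n. l \<le> Z (uniform_grid s t (Suc n) i) \<omega>})"
  define x where "x = (expectation (\<lambda>\<omega>. indicator A \<omega> * Z s \<omega>) + \<theta> * (t - s)) / l"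
  have E_event: "E n \<in> events" for n
    unfolding E_def by (rule grid_exceedance_event[OF times A zero_less_Suc])
  have E_prob: "prob (E n) \<le> x" for n
    using grid_maximal_inequality[OF times A zero_less_Suc, of l n] \<open>0 < l\<close>
    by (simp add: E_def x_def pos_le_divide_eq mult.commute)
  show ?thesis
  proof (rule that)
    show "(\<Union>m. \<Inter>n\<in>{m..}. E n) \<in> events"
      by (rule eventually_in_event[OF E_event E_prob])
    show "l * prob (\<Union>m. \<Inter>n\<in>{m..}. E n) \<le> expectation (\<lambda>\<omega>. indicator A \<omega> * Z s \<omega>) + \<theta> * (t - s)"
      using prob_eventually_in_le[OF E_event E_prob] \<open>0 < l\<close> by (simp add: x_def field_simps)
    show "AE \<omega> in M. \<omega> \<in> A \<and> (\<exists>u\<in>{s..t}. l < Z u \<omega>) \<longrightarrow> \<omega> \<in> (\<Union>m. \<Inter>n\<in>{m..}. E n)"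
      using continuous
    proof eventually_elim
      case (elim \<omega>)
      show ?case
      proof (intro impI, elim conjE bexE)
        fix u assume "\<omega> \<in> A" and u: "u \<in> {s..t}" "l < Z u \<omega>"
        then have "\<forall>\<^sub>F n in sequentially. \<exists>i\<le>n. l \<le> Z (uniform_grid s t n i) \<omega>"
          by (intro eventually_uniform_grid_ge[OF elim times(2)])
        then have "\<forall>\<^sub>F n in sequentially. \<exists>i\<le>Suc n. l \<le> Z (uniform_grid s t (Suc n) i) \<omega>"
          by (rule eventually_sequentially_Suc[THEN iffD2])
        then have "\<forall>\<^sub>F n in sequentially. \<omega> \<in> E n"
          by eventually_elim (use \<open>\<omega> \<in> A\<close> in \<open>simp add: E_def\<close>)
        then show "\<omega> \<in> (\<Union>m. \<Inter>n\<in>{m..}. E n)"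
          by (auto simp: eventually_sequentially)
      qed
    qed
  qed
qed

end

end

lemma (in brownian_drift_test) test_function_maximal_inequality:
  assumes nonneg: "\<And>v. 0 \<le> f v" and \<theta>: "0 \<le> \<theta>"
    and times: "0 \<le> s" "s < t" and "0 < l" and A: "A \<in> sets (F s)"
  obtains H where "H \<in> events" "l * prob H \<le> expectation (\<lambda>\<omega>. indicator A \<omega> * f (V s \<omega>)) + \<theta> * (t - s)"
    "AE \<omega> in M. \<omega> \<in> A \<and> (\<exists>u\<in>{s..t}. l < f (V u \<omega>)) \<longrightarrow> \<omega> \<in> H"
proof -
  have f_V_measurable: "(\<lambda>\<omega>. f (V u \<omega>)) \<in> borel_measurable (F u)" if "0 \<le> u" for u
    by (rule measurable_compose[OF V_adapted[OF that] measurable_f])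
  have f_V_integrable: "integrable M (\<lambda>\<omega>. f (V u \<omega>))" if "0 \<le> u" for u
    using f_bounded measurable_filtration_imp_measurable[OF that f_V_measurable[OF that]]
    by (intro integrable_const_bound[where B=k]) auto
  have continuous: "AE \<omega> in M. continuous_on {s..t} (\<lambda>u. f (V u \<omega>))"
    using paths
  proof eventually_elim
    case (elim \<omega>)
    have "continuous_on {s..t} (\<lambda>u. V u \<omega>)"
      using elim[THEN conjunct1] times(1) by (auto intro: continuous_on_subset)
    then show ?case
      using continuous_on_compose2[OF continuous_on_f] by simp
  qed
  have increment_le: "expectation (\<lambda>\<omega>. indicator E \<omega> * f (V q \<omega>))
    \<le> expectation (\<lambda>\<omega>. indicator E \<omega> * f (V p \<omega>)) + \<theta> * (q - p)"
    if "0 \<le> p" "p < q" "E \<in> sets (F p)" for p q E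
  proof -
    have "\<theta> * (q - p) * prob E \<le> \<theta> * (q - p) * 1"
      using \<theta> that by (intro mult_left_mono) auto
    with supermartingale_inequality[OF that] show ?thesis
      by linarith
  qed
  show ?thesis
    by (rule continuous_maximal_inequality[where Z="\<lambda>u \<omega>. f (V u \<omega>)",
          OF f_V_measurable nonneg f_V_integrable increment_le times A \<open>0 < l\<close> continuous that])
qed

section \<open>Processes avoiding the origin\<close>

context brownian_drift_process
begin

context
  fixes \<theta> :: real
  assumes \<theta>: "0 \<le> \<theta>"
    and dispersion_drift: "AE \<omega> in M. AE u in lborel. 0 \<le> u \<longrightarrow>
      cov_trace \<rho> c1 c2 (\<lambda>a b. (V u \<omega> \<bullet> a) * (V u \<omega> \<bullet> b)) \<le> \<theta> * (V u \<omega> \<bullet> V u \<omega>) \<and>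
      2 * \<theta> \<le> 2 * (V u \<omega> \<bullet> r u \<omega>) + cov_trace \<rho> c1 c2 (\<bullet>)"
begin

lemma brownian_drift_test_log_ratio:
  assumes \<epsilon>: "0 < \<epsilon>"
  shows "brownian_drift_test M F \<rho> B C c1 c2 V r (\<lambda>v. log_ratio \<epsilon> (v \<bullet> v))
    (log_ratio_D1 \<epsilon>) (log_ratio_D2 \<epsilon>) (log_ratio_D3 \<epsilon>) (log_ratio_D_bound \<epsilon>) (2 * \<theta>) (ln (1 + 1 / \<epsilon>))"
proof (intro brownian_drift_test.intro brownian_drift_test_axioms.intro brownian_drift_process_axioms
    bounded_C3_log_ratio \<epsilon>)
  show "AE \<omega> in M. AE u in lborel. 0 \<le> u \<longrightarrow>
    log_ratio_D1 \<epsilon> (V u \<omega>) (r u \<omega>) + cov_trace \<rho> c1 c2 (log_ratio_D2 \<epsilon> (V u \<omega>)) / 2 \<le> 2 * \<theta>"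
    using dispersion_drift by (elim eventually_mono) (blast intro: log_ratio_generator_le[OF \<epsilon> \<theta>])
  show "\<bar>log_ratio \<epsilon> (v \<bullet> v)\<bar> \<le> ln (1 + 1 / \<epsilon>)" for v :: 'b
    using log_ratio_nonneg[OF \<epsilon>, of "v \<bullet> v"] log_ratio_le[OF \<epsilon>, of "v \<bullet> v" \<epsilon>] \<epsilon> by simp
qed

lemma origin_hitting_cover:
  assumes times: "0 \<le> s" "s < t" and \<epsilon>: "0 < \<epsilon>" "\<epsilon> < 1" and "0 < \<kappa>"
  obtains H where "H \<in> events" "- ln \<epsilon> * prob H \<le> ln (1 + 1 / \<kappa>) + 2 * \<theta> * (t - s)"
    "AE \<omega> in M. \<kappa> \<le> V s \<omega> \<bullet> V s \<omega> \<and> (\<exists>u\<in>{s..t}. V u \<omega> = 0) \<longrightarrow> \<omega> \<in> H"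
proof -
  define A where "A = {\<omega> \<in> space M. \<kappa> \<le> V s \<omega> \<bullet> V s \<omega>}"
  note [measurable] = V_adapted[OF times(1)]
  have A: "A \<in> sets (F s)"
    unfolding A_def space_filtration[OF times(1), symmetric] by measurable
  have "0 < - ln \<epsilon>" "0 \<le> 2 * \<theta>" "0 \<le> log_ratio \<epsilon> (v \<bullet> v)" for v :: 'b
    using \<epsilon> \<theta> log_ratio_nonneg[OF \<epsilon>(1)] by simp_all
  from brownian_drift_test.test_function_maximal_inequality[OF brownian_drift_test_log_ratio[OF \<epsilon>(1)] this(3,2) times this(1) A]
  obtain H where H: "H \<in> events"
      "- ln \<epsilon> * prob H \<le> expectation (\<lambda>\<omega>. indicator A \<omega> * log_ratio \<epsilon> (V s \<omega> \<bullet> V s \<omega>)) + 2 * \<theta> * (t - s)"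
    and cover: "AE \<omega> in M. \<omega> \<in> A \<and> (\<exists>u\<in>{s..t}. - ln \<epsilon> < log_ratio \<epsilon> (V u \<omega> \<bullet> V u \<omega>)) \<longrightarrow> \<omega> \<in> H" .
  have "expectation (\<lambda>\<omega>. indicator A \<omega> * log_ratio \<epsilon> (V s \<omega> \<bullet> V s \<omega>)) \<le> expectation (\<lambda>\<omega>. ln (1 + 1 / \<kappa>))"
  proof (rule integral_mono_AE')
    have "indicator A \<omega> * log_ratio \<epsilon> (V s \<omega> \<bullet> V s \<omega>) \<le> ln (1 + 1 / \<kappa>)" for \<omega>
      using \<epsilon>(1) \<open>0 < \<kappa>\<close> log_ratio_le[OF \<epsilon>(1), of "V s \<omega> \<bullet> V s \<omega>" \<kappa>] by (auto simp: A_def indicator_def)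
    then show "AE \<omega> in M. indicator A \<omega> * log_ratio \<epsilon> (V s \<omega> \<bullet> V s \<omega>) \<le> ln (1 + 1 / \<kappa>)"
      by simp
  qed (use \<open>0 < \<kappa>\<close> in auto)
  then have start_le: "expectation (\<lambda>\<omega>. indicator A \<omega> * log_ratio \<epsilon> (V s \<omega> \<bullet> V s \<omega>)) \<le> ln (1 + 1 / \<kappa>)"
    by (simp add: prob_space)
  have at_origin: "- ln \<epsilon> < log_ratio \<epsilon> 0"
    using \<epsilon>(1) by (simp add: log_ratio_def)
  from cover AE_space have "AE \<omega> in M. \<kappa> \<le> V s \<omega> \<bullet> V s \<omega> \<and> (\<exists>u\<in>{s..t}. V u \<omega> = 0) \<longrightarrow> \<omega> \<in> H"
    by eventually_elim (use at_origin in \<open>force simp: A_def\<close>)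
  then show ?thesis
    using H start_le by (intro that[of H]) auto
qed

lemma AE_nonzero_of_level:
  assumes times: "0 \<le> s" "s < t" and "0 < \<kappa>"
  shows "AE \<omega> in M. \<not> (\<kappa> \<le> V s \<omega> \<bullet> V s \<omega> \<and> (\<exists>u\<in>{s..t}. V u \<omega> = 0))"
proof (rule AE_not_of_small_covers)
  fix e :: real assume "0 < e"
  define x where "x = ln (1 + 1 / \<kappa>) + 2 * \<theta> * (t - s)"
  have "0 \<le> x"
    using times \<theta> \<open>0 < \<kappa>\<close> by (simp add: x_def)
  then have level_pos: "0 < x / e + 1"
    using \<open>0 < e\<close> by (simp add: add_nonneg_pos)
  define \<epsilon> where "\<epsilon> = exp (- (x / e + 1))"
  have \<epsilon>: "0 < \<epsilon>" "\<epsilon> < 1" "- ln \<epsilon> = x / e + 1"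
    using level_pos by (simp_all add: \<epsilon>_def)
  obtain H where H: "H \<in> events" "- ln \<epsilon> * prob H \<le> x"
      "AE \<omega> in M. \<kappa> \<le> V s \<omega> \<bullet> V s \<omega> \<and> (\<exists>u\<in>{s..t}. V u \<omega> = 0) \<longrightarrow> \<omega> \<in> H"
    unfolding x_def by (rule origin_hitting_cover[OF times \<epsilon>(1,2) \<open>0 < \<kappa>\<close>])
  have "prob H \<le> x / (x / e + 1)"
    using H(2) level_pos unfolding \<epsilon>(3) by (simp add: pos_le_divide_eq mult.commute)
  also have "\<dots> \<le> e"
    using \<open>0 < e\<close> level_pos by (simp add: pos_divide_le_eq distrib_left)
  finally show "\<exists>H\<in>events. prob H \<le> e \<and>
      (AE \<omega> in M. \<kappa> \<le> V s \<omega> \<bullet> V s \<omega> \<and> (\<exists>u\<in>{s..t}. V u \<omega> = 0) \<longrightarrow> \<omega> \<in> H)"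
    using H by blast
qed

lemma AE_nonzero_after:
  assumes "0 \<le> s"
  shows "AE \<omega> in M. V s \<omega> \<noteq> 0 \<longrightarrow> (\<forall>t>s. V t \<omega> \<noteq> 0)"
proof -
  have "AE \<omega> in M. \<forall>n m. \<not> (1 / real (Suc m) \<le> V s \<omega> \<bullet> V s \<omega> \<and> (\<exists>u\<in>{s..s + real (Suc n)}. V u \<omega> = 0))"
    unfolding AE_all_countable using assms by (intro allI AE_nonzero_of_level) auto
  then show ?thesis
  proof eventually_elim
    case (elim \<omega>)
    show ?case
    proof (intro impI allI notI)
      fix t assume "V s \<omega> \<noteq> 0" "s < t" "V t \<omega> = 0"
      have "0 < V s \<omega> \<bullet> V s \<omega>"
        using \<open>V s \<omega> \<noteq> 0\<close> by simp
      then obtain m where "1 / real (Suc m) < V s \<omega> \<bullet> V s \<omega>"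
        using nat_approx_posE by blast
      moreover obtain n where "t - s < real n"
        using reals_Archimedean2 by blast
      ultimately show False
        using elim[rule_format, of m n] \<open>s < t\<close> \<open>V t \<omega> = 0\<close> by auto
    qed
  qed
qed

theorem AE_never_zero:
  assumes nonzero: "AE \<omega> in M. AE u in lborel. 0 \<le> u \<longrightarrow> V u \<omega> \<noteq> 0"
  shows "AE \<omega> in M. \<forall>t>0. V t \<omega> \<noteq> 0"
proof -
  have "AE \<omega> in M. \<forall>q\<in>\<rat> \<inter> {0..}. V q \<omega> \<noteq> 0 \<longrightarrow> (\<forall>t>q. V t \<omega> \<noteq> 0)"
    using AE_nonzero_after by (subst AE_ball_countable) (auto simp: countable_rat)
  with nonzero paths show ?thesis
  proof eventually_elim
    case (elim \<omega>)
    show ?case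
    proof (intro allI impI)
      fix t :: real assume "0 < t"
      obtain u where u: "0 < u" "u < t" "V u \<omega> \<noteq> 0"
      proof (rule ccontr)
        assume "\<not> thesis"
        then have "AE u in lborel. u \<notin> {0<..<t}"
          using elim(1) that by (elim eventually_mono) force
        then have "emeasure lborel {0<..<t} = 0"
          by (subst (asm) AE_iff_measurable[where N="{0<..<t}"]) auto
        then show False
          using \<open>0 < t\<close> by simp
      qed
      have "continuous_on {0<..<t} (\<lambda>u. V u \<omega>)"
        using elim(2)[THEN conjunct1] by (rule continuous_on_subset) auto
      from continuous_on_open_avoid[OF this _ _ u(3)] obtain d where d: "0 < d" "\<And>p. dist u p < d \<Longrightarrow> V p \<omega> \<noteq> 0"
        using u by auto
      obtain q where q: "q \<in> \<rat>" "u < q" "q < u + d" "q < t"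
        using Rats_dense_in_real[of u "min (u + d) t"] d(1) u(2) by auto
      then have "V q \<omega> \<noteq> 0"
        by (intro d(2)) (simp add: dist_real_def)
      moreover have "q \<in> \<rat> \<inter> {0..}"
        using q(1,2) u(1) by auto
      ultimately show "V t \<omega> \<noteq> 0"
        using elim(3) q(4) by blast
    qed
  qed
qed

end

end

section \<open>Oblique Bessel processes\<close>

definition oblique_drift :: "real \<Rightarrow> real \<Rightarrow> real \<Rightarrow> real \<Rightarrow> 'b::real_vector \<Rightarrow> 'b \<Rightarrow> real \<Rightarrow> real \<Rightarrow> 'b" where
  "oblique_drift \<alpha> \<beta> \<gamma> \<delta> c1 c2 x y = (1 / x) *\<^sub>R (\<alpha> *\<^sub>R c1 + \<gamma> *\<^sub>R c2) + (1 / y) *\<^sub>R (\<beta> *\<^sub>R c1 + \<delta> *\<^sub>R c2)"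

lemma AE_pos_of_null_zeros:
  fixes z :: "real \<Rightarrow> real"
  assumes z: "continuous_on {0..} z" and nonneg: "\<And>t. 0 \<le> t \<Longrightarrow> 0 \<le> z t"
    and null: "\<And>t. 0 \<le> t \<Longrightarrow> emeasure lborel {s\<in>{0..t}. z s = 0} = 0"
  shows "AE u in lborel. 0 \<le> u \<longrightarrow> 0 < z u"
proof -
  have "AE u in lborel. \<forall>n. u \<notin> {s\<in>{0..real n}. z s = 0}"
    unfolding AE_all_countable
  proof (rule allI, rule AE_not_in)
    fix n :: nat
    have "closed {s\<in>{0..real n}. z s = 0}"
      by (rule continuous_closed_preimage_constant[OF continuous_on_subset[OF z]]) auto
    then have "{s\<in>{0..real n}. z s = 0} \<in> sets lborel"
      by (simp add: borel_closed)
    then show "{s\<in>{0..real n}. z s = 0} \<in> null_sets lborel"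
      by (rule null_setsI[OF null[OF of_nat_0_le_iff]])
  qed
  then show ?thesis
  proof eventually_elim
    case (elim u)
    show ?case
    proof
      assume "0 \<le> u"
      obtain n where "u \<le> real n"
        using real_arch_simple by blast
      with elim \<open>0 \<le> u\<close> have "z u \<noteq> 0"
        by auto
      with nonneg[OF \<open>0 \<le> u\<close>] show "0 < z u"
        by simp
    qed
  qed
qed

lemma O2BP_AE_pos:
  assumes "O2BP M F \<alpha> \<beta> \<gamma> \<delta> B C X Y"
  shows "AE \<omega> in M. AE u in lborel. 0 \<le> u \<longrightarrow> 0 < X u \<omega> \<and> 0 < Y u \<omega>"
  using assms[unfolded O2BP_def, THEN conjunct2, THEN conjunct2]
proof eventually_elim
  case (elim \<omega>)
  note path = elim[THEN conjunct2, THEN conjunct2, rule_format]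
  have "AE u in lborel. 0 \<le> u \<longrightarrow> 0 < X u \<omega>"
    by (rule AE_pos_of_null_zeros[OF elim[THEN conjunct1]]) (use path in blast)+
  moreover have "AE u in lborel. 0 \<le> u \<longrightarrow> 0 < Y u \<omega>"
    by (rule AE_pos_of_null_zeros[OF elim[THEN conjunct2, THEN conjunct1]]) (use path in blast)+
  ultimately show ?case
    by eventually_elim blast
qed

lemma square_sum_sqrt_le:
  fixes x y p q la mu :: real
  assumes "0 < x" "0 < y" "0 \<le> la" "0 \<le> mu" "0 \<le> p" "0 \<le> q"
  shows "(sqrt (la * p) + sqrt (mu * q))\<^sup>2 \<le> (la * x + mu * y) * (p / x + q / y)"
proof -
  define z where "z = x / y"
  have z: "0 < z"
    using assms by (simp add: z_def)
  have "2 * (sqrt (la * p) * sqrt (mu * q)) = 2 * sqrt (la * q * z) * sqrt (mu * p / z)"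
    using z by (simp add: real_sqrt_mult[symmetric] ac_simps)
  also have "\<dots> \<le> (sqrt (la * q * z))\<^sup>2 + (sqrt (mu * p / z))\<^sup>2"
    by (rule sum_squares_bound)
  also have "\<dots> = la * q * z + mu * p / z"
    using assms z by simp
  finally have "(sqrt (la * p) + sqrt (mu * q))\<^sup>2 \<le> la * p + mu * q + (la * q * z + mu * p / z)"
    using assms by (simp add: power2_sum mult.assoc)
  also have "\<dots> = (la * x + mu * y) * (p / x + q / y)"
    using assms by (simp add: z_def field_simps)
  finally show ?thesis .
qed

lemma
  fixes g h :: "'c \<Rightarrow> real" and a b :: "'b::{banach, second_countable_topology}"
  assumes g: "set_integrable N A g" and h: "set_integrable N A h"
  shows set_integrable_scaleR_add: "set_integrable N A (\<lambda>u. g u *\<^sub>R a + h u *\<^sub>R b)"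
    and set_integral_scaleR_add: "(LINT u:A|N. g u *\<^sub>R a + h u *\<^sub>R b) = (LINT u:A|N. g u) *\<^sub>R a + (LINT u:A|N. h u) *\<^sub>R b"
proof -
  have integrable: "set_integrable N A (\<lambda>u. g u *\<^sub>R a)" "set_integrable N A (\<lambda>u. h u *\<^sub>R b)"
    by (rule set_integrable_scaleR_left, rule g h)+
  show "set_integrable N A (\<lambda>u. g u *\<^sub>R a + h u *\<^sub>R b)"
    by (rule set_integral_add(1)[OF integrable])
  have "(LINT u:A|N. p u *\<^sub>R c) = (LINT u:A|N. p u) *\<^sub>R c" if "set_integrable N A p" for p :: "'c \<Rightarrow> real" and c :: 'b
    using integral_scaleR_left[of c N "\<lambda>u. indicator A u *\<^sub>R p u"] that
    by (simp add: set_integrable_def set_lebesgue_integral_def)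
  then show "(LINT u:A|N. g u *\<^sub>R a + h u *\<^sub>R b) = (LINT u:A|N. g u) *\<^sub>R a + (LINT u:A|N. h u) *\<^sub>R b"
    unfolding set_integral_add(2)[OF integrable] by (simp only: g h)
qed

context brownian_pair
begin

lemma brownian_drift_process_O2BP:
  fixes c1 c2 :: "'b::euclidean_space"
  assumes O2BP: "O2BP M F \<alpha> \<beta> \<gamma> \<delta> B C X Y"
  shows "brownian_drift_process M F \<rho> B C c1 c2 (\<lambda>t \<omega>. X t \<omega> *\<^sub>R c1 + Y t \<omega> *\<^sub>R c2)
    (\<lambda>t \<omega>. oblique_drift \<alpha> \<beta> \<gamma> \<delta> c1 c2 (X t \<omega>) (Y t \<omega>))"
proof
  show "(\<lambda>\<omega>. X t \<omega> *\<^sub>R c1 + Y t \<omega> *\<^sub>R c2) \<in> borel_measurable (F t)" if "0 \<le> t" for t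
    using O2BP that by (intro borel_measurable_add borel_measurable_scaleR) (auto simp: O2BP_def adapted_def)
  show "AE \<omega> in M. continuous_on {0..} (\<lambda>t. X t \<omega> *\<^sub>R c1 + Y t \<omega> *\<^sub>R c2) \<and>
    (\<forall>t\<ge>0. set_integrable lborel {0..t} (\<lambda>u. oblique_drift \<alpha> \<beta> \<gamma> \<delta> c1 c2 (X u \<omega>) (Y u \<omega>)) \<and>
      X t \<omega> *\<^sub>R c1 + Y t \<omega> *\<^sub>R c2 = X 0 \<omega> *\<^sub>R c1 + Y 0 \<omega> *\<^sub>R c2 + (B t \<omega> *\<^sub>R c1 + C t \<omega> *\<^sub>R c2)
        + (LINT u:{0..t}|lborel. oblique_drift \<alpha> \<beta> \<gamma> \<delta> c1 c2 (X u \<omega>) (Y u \<omega>)))"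
    using O2BP[unfolded O2BP_def, THEN conjunct2, THEN conjunct2]
  proof eventually_elim
    case (elim \<omega>)
    show ?case
    proof (intro conjI allI impI)
      show "continuous_on {0..} (\<lambda>t. X t \<omega> *\<^sub>R c1 + Y t \<omega> *\<^sub>R c2)"
        using elim[THEN conjunct1] elim[THEN conjunct2, THEN conjunct1] by (intro continuous_intros)
      fix t :: real assume "0 \<le> t"
      note path = elim[THEN conjunct2, THEN conjunct2, rule_format, OF \<open>0 \<le> t\<close>]
      have inverse: "set_integrable lborel {0..t} (\<lambda>s. 1 / X s \<omega>)" "set_integrable lborel {0..t} (\<lambda>s. 1 / Y s \<omega>)"
        using path by blast+
      show "set_integrable lborel {0..t} (\<lambda>u. oblique_drift \<alpha> \<beta> \<gamma> \<delta> c1 c2 (X u \<omega>) (Y u \<omega>))"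
        unfolding oblique_drift_def by (rule set_integrable_scaleR_add[OF inverse])
      define I where "I = (LINT s:{0..t}|lborel. 1 / X s \<omega>)"
      define J where "J = (LINT s:{0..t}|lborel. 1 / Y s \<omega>)"
      have "X t \<omega> = X 0 \<omega> + B t \<omega> + \<alpha> * I + \<beta> * J" "Y t \<omega> = Y 0 \<omega> + C t \<omega> + \<gamma> * I + \<delta> * J"
        unfolding I_def J_def using path by blast+
      then show "X t \<omega> *\<^sub>R c1 + Y t \<omega> *\<^sub>R c2 = X 0 \<omega> *\<^sub>R c1 + Y 0 \<omega> *\<^sub>R c2 + (B t \<omega> *\<^sub>R c1 + C t \<omega> *\<^sub>R c2)
        + (LINT u:{0..t}|lborel. oblique_drift \<alpha> \<beta> \<gamma> \<delta> c1 c2 (X u \<omega>) (Y u \<omega>))"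
        unfolding oblique_drift_def set_integral_scaleR_add[OF inverse] I_def[symmetric] J_def[symmetric]
        by (simp add: scaleR_add_left scaleR_add_right ac_simps)
    qed
  qed
qed

lemma O2BP_AE_no_corner:
  fixes c1 c2 :: "'b::euclidean_space"
  defines "v \<equiv> \<lambda>x y. x *\<^sub>R c1 + y *\<^sub>R c2"
  assumes O2BP: "O2BP M F \<alpha> \<beta> \<gamma> \<delta> B C X Y" and \<theta>: "0 \<le> \<theta>"
    and dispersion: "\<And>x y. 0 < x \<Longrightarrow> 0 < y \<Longrightarrow>
      cov_trace \<rho> c1 c2 (\<lambda>a b. (v x y \<bullet> a) * (v x y \<bullet> b)) \<le> \<theta> * (v x y \<bullet> v x y)"
    and drift: "\<And>x y. 0 < x \<Longrightarrow> 0 < y \<Longrightarrow>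
      2 * \<theta> \<le> 2 * (v x y \<bullet> oblique_drift \<alpha> \<beta> \<gamma> \<delta> c1 c2 x y) + cov_trace \<rho> c1 c2 (\<bullet>)"
    and nonzero: "\<And>x y. 0 < x \<Longrightarrow> 0 < y \<Longrightarrow> v x y \<noteq> 0"
  shows "AE \<omega> in M. \<forall>t>0. \<not> (X t \<omega> = 0 \<and> Y t \<omega> = 0)"
proof -
  interpret process: brownian_drift_process M F \<rho> B C c1 c2 "\<lambda>t \<omega>. v (X t \<omega>) (Y t \<omega>)"
    "\<lambda>t \<omega>. oblique_drift \<alpha> \<beta> \<gamma> \<delta> c1 c2 (X t \<omega>) (Y t \<omega>)"
    unfolding v_def by (rule brownian_drift_process_O2BP[OF O2BP])
  have "AE \<omega> in M. \<forall>t>0. v (X t \<omega>) (Y t \<omega>) \<noteq> 0"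
  proof (rule process.AE_never_zero[OF \<theta>])
    show "AE \<omega> in M. AE u in lborel. 0 \<le> u \<longrightarrow> v (X u \<omega>) (Y u \<omega>) \<noteq> 0"
      using O2BP_AE_pos[OF O2BP] by (elim eventually_mono) (simp add: nonzero)
    show "AE \<omega> in M. AE u in lborel. 0 \<le> u \<longrightarrow>
      cov_trace \<rho> c1 c2 (\<lambda>a b. (v (X u \<omega>) (Y u \<omega>) \<bullet> a) * (v (X u \<omega>) (Y u \<omega>) \<bullet> b))
        \<le> \<theta> * (v (X u \<omega>) (Y u \<omega>) \<bullet> v (X u \<omega>) (Y u \<omega>)) \<and>
      2 * \<theta> \<le> 2 * (v (X u \<omega>) (Y u \<omega>) \<bullet> oblique_drift \<alpha> \<beta> \<gamma> \<delta> c1 c2 (X u \<omega>) (Y u \<omega>)) + cov_trace \<rho> c1 c2 (\<bullet>)"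
      using O2BP_AE_pos[OF O2BP] by (elim eventually_mono) (blast intro: dispersion drift)
  qed
  then show ?thesis
    by eventually_elim (auto simp: v_def)
qed

lemma O2BP_AE_no_corner_linear:
  fixes la mu :: real
  assumes O2BP: "O2BP M F \<alpha> \<beta> \<gamma> \<delta> B C X Y"
    and nonneg: "0 \<le> la" "0 \<le> mu" and pos: "0 < la \<or> 0 < mu"
    and p: "0 \<le> la * \<alpha> + mu * \<gamma>" and q: "0 \<le> la * \<beta> + mu * \<delta>"
    and condition: "(la\<^sup>2 + mu\<^sup>2 + 2 * \<rho> * la * mu) / 2
      \<le> (sqrt (la * (la * \<alpha> + mu * \<gamma>)) + sqrt (mu * (la * \<beta> + mu * \<delta>)))\<^sup>2"
  shows "AE \<omega> in M. \<forall>t>0. \<not> (X t \<omega> = 0 \<and> Y t \<omega> = 0)"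
proof (rule O2BP_AE_no_corner[where ?c1.0=la and ?c2.0=mu, OF O2BP])
  show "0 \<le> cov_trace \<rho> la mu (*)"
    by (rule cov_trace_real_nonneg[OF correlation])
  fix x y :: real assume xy: "0 < x" "0 < y"
  define z where "z = x *\<^sub>R la + y *\<^sub>R mu"
  have z: "z = la * x + mu * y"
    by (simp add: z_def)
  show "cov_trace \<rho> la mu (\<lambda>a b. ((x *\<^sub>R la + y *\<^sub>R mu) \<bullet> a) * ((x *\<^sub>R la + y *\<^sub>R mu) \<bullet> b))
    \<le> cov_trace \<rho> la mu (*) * ((x *\<^sub>R la + y *\<^sub>R mu) \<bullet> (x *\<^sub>R la + y *\<^sub>R mu))"
    unfolding z_def[symmetric] by (simp add: cov_trace_def algebra_simps)
  have "cov_trace \<rho> la mu (*) / 2 = (la\<^sup>2 + mu\<^sup>2 + 2 * \<rho> * la * mu) / 2"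
    by (simp add: cov_trace_real)
  also note condition
  also have "(sqrt (la * (la * \<alpha> + mu * \<gamma>)) + sqrt (mu * (la * \<beta> + mu * \<delta>)))\<^sup>2 \<le> z * ((la * \<alpha> + mu * \<gamma>) / x + (la * \<beta> + mu * \<delta>) / y)"
    unfolding z by (rule square_sum_sqrt_le[OF xy nonneg p q])
  finally show "2 * cov_trace \<rho> la mu (*) \<le> 2 * ((x *\<^sub>R la + y *\<^sub>R mu) \<bullet> oblique_drift \<alpha> \<beta> \<gamma> \<delta> la mu x y)
      + cov_trace \<rho> la mu (\<bullet>)"
    unfolding z_def[symmetric] inner_real_def oblique_drift_def by (simp add: ac_simps)
  have "0 < la * x + mu * y"
    using xy nonneg pos by (auto intro: add_pos_nonneg add_nonneg_pos)
  then show "x *\<^sub>R la + y *\<^sub>R mu \<noteq> 0"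
    by (simp add: ac_simps)
qed

lemma O2BP_AE_no_corner_radial:
  assumes O2BP: "O2BP M F \<alpha> \<beta> \<gamma> \<delta> B C X Y"
    and nonneg: "0 \<le> \<alpha> + \<delta>" "0 \<le> \<beta>" "0 \<le> \<gamma>" and le: "\<rho> \<le> \<alpha> + \<delta>"
  shows "AE \<omega> in M. \<forall>t>0. \<not> (X t \<omega> = 0 \<and> Y t \<omega> = 0)"
proof -
  let ?e1 = "(1, 0) :: real \<times> real" and ?e2 = "(0, 1) :: real \<times> real"
  show ?thesis
  proof (rule O2BP_AE_no_corner[where ?c1.0="?e1" and ?c2.0="?e2" and \<theta>="1 + max \<rho> 0", OF O2BP])
    fix x y :: real assume xy: "0 < x" "0 < y"
    have vector: "x *\<^sub>R ?e1 + y *\<^sub>R ?e2 = (x, y)"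
      by simp
    have "\<rho> * (2 * x * y) \<le> max \<rho> 0 * (2 * x * y)"
      using xy by (intro mult_right_mono) auto
    also have "\<dots> \<le> max \<rho> 0 * (x\<^sup>2 + y\<^sup>2)"
      by (intro mult_left_mono sum_squares_bound) auto
    finally have "x\<^sup>2 + \<rho> * (2 * x * y) + y\<^sup>2 \<le> (1 + max \<rho> 0) * (x\<^sup>2 + y\<^sup>2)"
      by (simp add: distrib_right)
    then show "cov_trace \<rho> ?e1 ?e2 (\<lambda>a b. ((x *\<^sub>R ?e1 + y *\<^sub>R ?e2) \<bullet> a) * ((x *\<^sub>R ?e1 + y *\<^sub>R ?e2) \<bullet> b))
      \<le> (1 + max \<rho> 0) * ((x *\<^sub>R ?e1 + y *\<^sub>R ?e2) \<bullet> (x *\<^sub>R ?e1 + y *\<^sub>R ?e2))"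
      unfolding vector by (simp add: cov_trace_def power2_eq_square ac_simps)
    have "0 \<le> x * \<beta> / y + y * \<gamma> / x"
      using xy nonneg by simp
    then have "max \<rho> 0 \<le> (x, y) \<bullet> oblique_drift \<alpha> \<beta> \<gamma> \<delta> ?e1 ?e2 x y"
      using xy nonneg(1) le by (simp add: oblique_drift_def distrib_left)
    then have "2 * max \<rho> 0 + 2 \<le> 2 * ((x *\<^sub>R ?e1 + y *\<^sub>R ?e2) \<bullet> oblique_drift \<alpha> \<beta> \<gamma> \<delta> ?e1 ?e2 x y)
      + cov_trace \<rho> ?e1 ?e2 (\<bullet>)"
      unfolding vector by (intro add_mono mult_left_mono) (simp_all add: cov_trace_def)
    then show "2 * (1 + max \<rho> 0) \<le> 2 * ((x *\<^sub>R ?e1 + y *\<^sub>R ?e2) \<bullet> oblique_drift \<alpha> \<beta> \<gamma> \<delta> ?e1 ?e2 x y)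
      + cov_trace \<rho> ?e1 ?e2 (\<bullet>)"
      by (simp only: distrib_left mult_1_right add.commute)
    show "x *\<^sub>R ?e1 + y *\<^sub>R ?e2 \<noteq> 0"
      using xy by (simp add: zero_prod_def)
  qed simp
qed

end

lemma corner_time_eq_infinity:
  assumes "\<forall>t>0. \<not> (X t \<omega> = 0 \<and> Y t \<omega> = 0)"
  shows "corner_time X Y \<omega> = \<infinity>"
proof -
  have "{ereal t |t. t > 0 \<and> X t \<omega> = 0 \<and> Y t \<omega> = 0} = {}"
    using assms by auto
  then show ?thesis
    unfolding corner_time_def by (simp only: Inf_empty top_ereal_def)
qed

theorem mainTheorem5:
  fixes M :: "'a measure" and F :: "real \<Rightarrow> 'a measure"
    and B C X Y :: "real \<Rightarrow> 'a \<Rightarrow> real"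
    and \<alpha> \<beta> \<gamma> \<delta> \<rho> :: real
  assumes "prob_space M" and "filtration_usual M F"
    and "\<alpha> > 0" and "\<delta> > 0" and "-1 \<le> \<rho>" and "\<rho> \<le> 1"
    and "corr_brownian M F \<rho> B C"
    and "O2BP M F \<alpha> \<beta> \<gamma> \<delta> B C X Y"
    and "(\<beta> \<ge> 0 \<and> \<gamma> \<ge> 0 \<and> -1 \<le> \<rho> \<and> \<rho> \<le> \<alpha> + \<delta>)
         \<or> (\<alpha> \<ge> 1/2 \<and> \<beta> \<ge> 0)
         \<or> (\<delta> \<ge> 1/2 \<and> \<gamma> \<ge> 0)
         \<or> (\<exists>la mu. la > 0 \<and> mu > 0 \<and> la * \<alpha> + mu * \<gamma> \<ge> 0 \<and> la * \<beta> + mu * \<delta> \<ge> 0 \<and>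
              (sqrt (la * (la * \<alpha> + mu * \<gamma>)) + sqrt (mu * (la * \<beta> + mu * \<delta>)))\<^sup>2
                \<ge> (la\<^sup>2 + mu\<^sup>2 + 2 * \<rho> * la * mu) / 2)"
  shows "AE \<omega> in M. corner_time X Y \<omega> = \<infinity>"
proof -
  interpret brownian_pair M F \<rho> B C
    using assms(1-7) by (simp add: brownian_pair_def filtered_prob_space_def filtered_prob_space_axioms_def
        brownian_pair_axioms_def)
  note linear = O2BP_AE_no_corner_linear[OF assms(8)]
  have "AE \<omega> in M. \<forall>t>0. \<not> (X t \<omega> = 0 \<and> Y t \<omega> = 0)"
    using assms(9)
  proof (elim disjE exE conjE)
    assume "\<beta> \<ge> 0" "\<gamma> \<ge> 0" "\<rho> \<le> \<alpha> + \<delta>"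
    then show ?thesis
      using assms(3,4) by (intro O2BP_AE_no_corner_radial[OF assms(8)]) auto
  next
    assume "\<alpha> \<ge> 1/2" "\<beta> \<ge> 0"
    then show ?thesis
      by (intro linear[of 1 0]) auto
  next
    assume "\<delta> \<ge> 1/2" "\<gamma> \<ge> 0"
    then show ?thesis
      by (intro linear[of 0 1]) auto
  qed (rule linear, auto)
  then show ?thesis
    by eventually_elim (rule corner_time_eq_infinity)
qed

end
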